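(* Let $W$ be a well-generated irreducible complex reflection group with reflection arrangement $\mathscr{A}$ and order multiplicity $\omega$, let $t_1,\dots,t_\ell$ be the flat invariants, $T=\mathbb{C}[t_1,\dots,t_{\ell-1}]$ and $D=\partial_{t_\ell}$. Let $\mathcal{G}_0$ be the $T$-submodule of $\mathrm{Der}_F$ generated by $\partial_{t_1},\dots,\partial_{t_\ell}$, let $\mathcal{G}_i:=\nabla_D^{-i}(\mathcal{G}_0)$ for $i\in\mathbb{Z}$, and for $k\in\mathbb{Z}$ let $\mathcal{H}^{(k)}:=\bigoplus_{i\ge 1-k}\mathcal{G}_i$ (internal direct sum in $\mathrm{Der}_F$). Then, as $T$-modules, $$\mathfrak{D}(\mathscr{A},-k\omega+1)^W=\mathcal{H}^{(k)}\ \text{ for all }k\in\mathbb{Z}\qquad\text{and}\qquad \mathfrak{D}(\mathscr{A},-\infty)^W=\bigoplus_{k\in\mathbb{Z}}\mathcal{G}_k,$$ and $\nabla_D$ induces $T$-linear isomorphisms $$\nabla_D:\mathcal{H}^{(k)}\xrightarrow{\ \sim\ }\mathcal{H}^{(k+1)}\ \ (k\in\mathbb{Z}),\qquad \nabla_D:\mathfrak{D}(\mathscr{A},-\infty)^W\xrightarrow{\ \sim\ }\mathfrak{D}(\mathscr{A},-\infty)^W.$$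
   Context: Reflection group. $V\cong\mathbb{C}^\ell$, and $W\subset \mathrm{GL}(V)$ is a finite irreducible group generated by (complex) reflections; it is well-generated if it is generated by $\ell$ reflections. $I$ is a $W$-invariant Hermitian inner product on $V$, $I^*$ the induced one on $V^*$. $\mathscr{A}$ is the set of reflecting hyperplanes; for $H\in\mathscr{A}$, $e_H$ is the order of the pointwise stabilizer of $H$ in $W$, $\omega(H):=e_H$, and $\alpha_H\in V^*$ is fixed with $H=\ker\alpha_H$, $I^*(\alpha_H,\alpha_H)=1$. Derivations. $S=\mathrm{Sym}(V^* )=\mathbb{C}[x_1,\dots,x_\ell]$ for a basis $x_1,\dots,x_\ell$ of $V^*$; $F=\mathrm{Frac}(S)$; $\mathrm{Der}_S=\bigoplus_i S\,\partial_{x_i}\subset \mathrm{Der}_F=\bigoplus_i F\,\partial_{x_i}$. $W$ acts on $\mathrm{Der}_F$ by $(w\theta)(f)=w(\theta(w^{-1}f))$, and $(\cdot)^W$ denotes $W$-invariants. A derivation $\theta=\sum_i (f_i/g_i)\partial_{x_i}$ with all $f_i$ homogeneous of degree $p$ (or $0$) and all $g_i\ne0$ homogeneous of degree $q$ is called homogeneous with $\mathrm{pdeg}\,\theta=p-q$. Logarithmic vector fields. $Q_{\mathscr{A}}=\prod_{H}\alpha_H$, $S'=S[Q_{\mathscr{A}}^{-1}]$, $\mathrm{Der}_{S'}=\bigoplus_i S'\partial_{x_i}$, and $S_{\langle\alpha_H\rangle}$ is the localization of $S$ at the prime ideal $\langle\alpha_H\rangle$. Then $$\mathfrak{D}(\mathscr{A},-\infty)=\{\theta\in\mathrm{Der}_{S'}\mid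 \theta(\beta)\in S_{\langle\alpha_H\rangle}\text{ for all }H\in\mathscr{A},\ \beta\in V^*\text{ with }I^*(\alpha_H,\beta)=0\},$$ and for $\nu:\mathscr{A}\to\mathbb{Z}$, $\mathfrak{D}(\mathscr{A},\nu)=\{\theta\in\mathfrak{D}(\mathscr{A},-\infty)\mid\theta(\alpha_H)\in\alpha_H^{\nu(H)}S_{\langle\alpha_H\rangle}\text{ for all }H\in\mathscr{A}\}$. Integers are also used for constant multiplicity functions. Connection. $\nabla_\theta(\sum_i p_i\partial_{x_i})=\sum_i\theta(p_i)\partial_{x_i}$ for $\theta\in\mathrm{Der}_F$, $p_i\in F$. Invariants. $S^W$ is a polynomial algebra with homogeneous generators of degrees $d_1\le\dots\le d_\ell$; $e_i=d_i-1$ are the exponents; $e_1^*\le\dots\le e_\ell^*$ are the coexponents (the polynomial degrees of a homogeneous $S^W$-basis of $\mathrm{Der}_S^W$); $h=\frac1\ell\sum_H e_H=d_\ell>d_{\ell-1}$ is the Coxeter number, and $e_i+e_{\ell+1-i}^*=h$. Given homogeneous generators $t_1,\dots,t_\ell$ of $R=S^W$ with $\deg t_i=d_i$, $\partial_{t_j}\in\mathrm{Der}_F$ is the derivation with $\partial_{t_j}(t_i)=\delta_{ij}$, $\mathrm{Der}_R=\bigoplus_j R\,\partial_{t_j}\subset\mathrm{Der}_F$, and $D=\partial_{t_\ell}$ is the primitive vector field. $\Delta=\prod_H\alpha_H^{e_H}\in R$ is the discriminant and $\mathrm{Der}_R(-\log\Delta)=\{\theta\in\mathrm{Der}_R\mid\theta\Delta\in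 R\Delta\}$, which is identified with $\mathrm{Der}_S^W$. Flat systems (known results of Kato–Mano–Sekiguchi, Bessis, and Hoge–Mano–Röhrle–Stump). One fixes homogeneous generators $t_1,\dots,t_\ell$ of $R$ with $\deg t_i=d_i$ (the flat invariants) and a homogeneous $R$-basis $\eta_1,\dots,\eta_\ell$ of $\mathrm{Der}_R(-\log\Delta)$ with $\mathrm{pdeg}\,\eta_j=e_j^*$ (the flat derivations) such that: the matrix $M_\eta=(\eta_{\ell+1-i}(t_j))_{i,j}$ equals $t_\ell\mathbf{1}_\ell+M^{(0)}$ with $M^{(0)}$ having entries in $T$; $\eta_1=E:=\frac1h\sum_i x_i\partial_{x_i}$; and, with $B_\infty=\mathrm{diag}(e_1/h,\dots,e_\ell/h)-\mathbf{1}_\ell$ and $\partial_t=(\partial_{t_1},\dots,\partial_{t_\ell})^{\mathrm{tr}}$, the map $\nabla_D:\mathrm{Der}_R(-\log\Delta)\to\mathrm{Der}_R$ is a $T$-linear isomorphism with inverse $\nabla_D^{-1}$ satisfying $\nabla_D^{-1}\partial_t=-B_\infty^{-1}M_\eta\,\partial_t$, and $\nabla_D\partial_t=-M_\eta^{-1}(B_\infty+\mathbf{1}_\ell)\partial_t$ (entrywise). For $k\ge0$, $\nabla_D^k$ is the $k$-fold iterate of $\nabla_D$, and $\nabla_D^{-k}$ is the $k$-fold iterate of $\nabla_D^{-1}:\mathrm{Der}_R\to\mathrm{Der}_R(-\log\Delta)\subset\mathrm{Der}_R$. *)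

theory Defs
  imports
    "HOL-Analysis.Cartesian_Space"
    "HOL-Algebra.Generated_Groups"
    "HOL-Library.Poly_Mapping"
    "HOL-Computational_Algebra.Fraction_Field"
begin

text \<open>
  The vector space is \<open>V = complex ^ 'n\<close>, so \<open>\<ell> = CARD('n)\<close>; a vector \<open>a :: complex ^ 'n\<close> also
  stands for the linear form \<open>v \<mapsto> \<Sum>i. a$i * v$i\<close> of \<open>V\<^sup>*\<close>.  Families indexed by \<open>1,\<dots>,\<ell>\<close>
  (such as \<open>t\<close>, \<open>\<eta>\<close>, \<open>d\<close>) are functions on \<^typ>\<open>nat\<close>, and only their values on \<open>{1..\<ell>}\<close> matter.
  The class \<^class>\<open>linorder\<close> on the index type is needed only because the library proves with its help
  that polynomials form an integral domain; it does not restrict \<open>\<ell>\<close>.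
\<close>

section \<open>Polynomials and rational functions\<close>

type_synonym 'n cvec = "complex ^ 'n"
type_synonym 'n cmat = "complex ^ 'n ^ 'n"
type_synonym 'i mpoly = "('i \<Rightarrow>\<^sub>0 nat) \<Rightarrow>\<^sub>0 complex"
type_synonym 'n ratfun = "'n mpoly fract"
type_synonym 'n derivation = "('n ratfun) ^ 'n"

definition to_F :: "('n::{finite,linorder}) mpoly \<Rightarrow> 'n ratfun" where
  "to_F p = Fract p 1"

definition cst :: "complex \<Rightarrow> ('n::{finite,linorder}) ratfun" where
  "cst c = to_F (Poly_Mapping.single 0 c)"

definition var :: "'n \<Rightarrow> ('n::{finite,linorder}) ratfun" where
  "var i = to_F (Poly_Mapping.single (Poly_Mapping.single i 1) 1)"

definition lin :: "('n::{finite,linorder}) cvec \<Rightarrow> 'n ratfun" where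
  "lin a = (\<Sum>i\<in>UNIV. cst (a $ i) * var i)"

definition polys :: "('n::{finite,linorder}) ratfun set" where
  "polys = {to_F p | p. True}"

definition homogeneous :: "nat \<Rightarrow> ('n::{finite,linorder}) ratfun \<Rightarrow> bool" where
  "homogeneous k f \<longleftrightarrow>
     (\<exists>p. f = to_F p \<and> (\<forall>m\<in>Poly_Mapping.keys p. (\<Sum>i\<in>UNIV. Poly_Mapping.lookup m i) = k))"

lemma mpoly_sum_monomials:
  "(\<Sum>m\<in>Poly_Mapping.keys p. Poly_Mapping.single m (Poly_Mapping.lookup p m)) = p"
  by (rule poly_mapping_eqI)
     (auto simp: lookup_sum lookup_single when_def in_keys_iff)

lemma additive_eqI:
  fixes A B :: "('b \<Rightarrow>\<^sub>0 'c::comm_monoid_add) \<Rightarrow> 'a::ab_group_add"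
  assumes "\<And>p q. A (p + q) = A p + A q" "\<And>p q. B (p + q) = B p + B q"
    and "\<And>m c. A (Poly_Mapping.single m c) = B (Poly_Mapping.single m c)"
  shows "A p = B p"
proof -
  have z: "A 0 = 0" "B 0 = 0"
    using assms(1)[of 0 0] assms(2)[of 0 0] by simp_all
  have "A (\<Sum>m\<in>K. Poly_Mapping.single m (f m)) = B (\<Sum>m\<in>K. Poly_Mapping.single m (f m))"
    if "finite K" for K f
    using that by (induction K) (simp_all add: z assms)
  from this[of "Poly_Mapping.keys p" "Poly_Mapping.lookup p"]
  have "A (\<Sum>m\<in>Poly_Mapping.keys p. Poly_Mapping.single m (Poly_Mapping.lookup p m)) =
        B (\<Sum>m\<in>Poly_Mapping.keys p. Poly_Mapping.single m (Poly_Mapping.lookup p m))"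
    by simp
  then show ?thesis
    by (simp add: mpoly_sum_monomials)
qed

subsection \<open>Substitution\<close>

definition eval_monom :: "('i \<Rightarrow> 'n ratfun) \<Rightarrow> ('i \<Rightarrow>\<^sub>0 nat) \<Rightarrow> ('n::{finite,linorder}) ratfun" where
  "eval_monom y m = (\<Prod>i\<in>Poly_Mapping.keys m. y i ^ Poly_Mapping.lookup m i)"

definition eval_poly :: "('i \<Rightarrow> 'n ratfun) \<Rightarrow> 'i mpoly \<Rightarrow> ('n::{finite,linorder}) ratfun" where
  "eval_poly y p = (\<Sum>m\<in>Poly_Mapping.keys p. cst (Poly_Mapping.lookup p m) * eval_monom y m)"

definition poly_vars :: "'i mpoly \<Rightarrow> 'i set" where
  "poly_vars p = (\<Union>m\<in>Poly_Mapping.keys p. Poly_Mapping.keys m)"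

text \<open>The algebra \<open>\<complex>[y\<^sub>j : j \<in> J]\<close>.\<close>

definition adjoin :: "('i \<Rightarrow> 'n ratfun) \<Rightarrow> 'i set \<Rightarrow> ('n::{finite,linorder}) ratfun set" where
  "adjoin y J = {eval_poly y p | p. poly_vars p \<subseteq> J}"

definition alg_indep :: "('i \<Rightarrow> ('n::{finite,linorder}) ratfun) \<Rightarrow> 'i set \<Rightarrow> bool" where
  "alg_indep y J \<longleftrightarrow> (\<forall>p. poly_vars p \<subseteq> J \<and> eval_poly y p = 0 \<longrightarrow> p = 0)"

text \<open>
  The value is independent of the chosen representation when \<open>y\<close> is algebraically independent
  (lemma \<open>eval_rat_Fract\<close>), which covers the invertible linear substitutions used below.
\<close>

definition eval_rat :: "('n \<Rightarrow> 'n ratfun) \<Rightarrow> 'n ratfun \<Rightarrow> ('n::{finite,linorder}) ratfun" where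
  "eval_rat y f =
     (SOME g. \<exists>a b. b \<noteq> 0 \<and> f = Fract a b \<and> g = eval_poly y a / eval_poly y b)"

lemma cst_0 [simp]: "cst 0 = 0"
  by (simp add: cst_def to_F_def Zero_fract_def)

lemma cst_add: "cst (a + b) = cst a + cst b"
  by (simp add: cst_def to_F_def single_add)

lemma cst_mult: "cst (a * b) = cst a * cst b"
  by (simp add: cst_def to_F_def mult_single)

lemma eval_poly_superset:
  assumes "finite K" "Poly_Mapping.keys p \<subseteq> K"
  shows "eval_poly y p = (\<Sum>m\<in>K. cst (Poly_Mapping.lookup p m) * eval_monom y m)"
  unfolding eval_poly_def using assms
  by (intro sum.mono_neutral_left) (auto simp: in_keys_iff)

lemma eval_poly_add: "eval_poly y (p + q) = eval_poly y p + eval_poly y q"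
proof -
  let ?K = "Poly_Mapping.keys p \<union> Poly_Mapping.keys q"
  show ?thesis
    using Poly_Mapping.keys_add[of p q]
    by (simp add: eval_poly_superset[of ?K] lookup_add cst_add algebra_simps sum.distrib)
qed

lemma eval_poly_single: "eval_poly y (Poly_Mapping.single m c) = cst c * eval_monom y m"
  by (cases "c = 0") (simp_all add: eval_poly_def)

lemma eval_monom_superset:
  assumes "finite K" "Poly_Mapping.keys m \<subseteq> K"
  shows "eval_monom y m = (\<Prod>i\<in>K. y i ^ Poly_Mapping.lookup m i)"
  unfolding eval_monom_def using assms
  by (intro prod.mono_neutral_left) (auto simp: in_keys_iff)

lemma eval_monom_add: "eval_monom y (m + m') = eval_monom y m * eval_monom y m'"
proof -
  let ?K = "Poly_Mapping.keys m \<union> Poly_Mapping.keys m'"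
  show ?thesis
    using Poly_Mapping.keys_add[of m m']
    by (simp add: eval_monom_superset[of ?K] lookup_add power_add prod.distrib)
qed

lemma eval_poly_mult: "eval_poly y (p * q) = eval_poly y p * eval_poly y q"
proof (rule additive_eqI[of "\<lambda>p. eval_poly y (p * q)" "\<lambda>p. eval_poly y p * eval_poly y q" p])
  fix m c
  show "eval_poly y (Poly_Mapping.single m c * q) =
        eval_poly y (Poly_Mapping.single m c) * eval_poly y q"
    by (rule additive_eqI[of "\<lambda>q. eval_poly y (Poly_Mapping.single m c * q)"
          "\<lambda>q. eval_poly y (Poly_Mapping.single m c) * eval_poly y q" q])
       (simp_all add: eval_poly_add eval_poly_single eval_monom_add mult_single cst_mult
          algebra_simps)
qed (simp_all add: eval_poly_add algebra_simps)

lemma eval_rat_Fract: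
  assumes y: "alg_indep y UNIV" and b: "b \<noteq> 0"
  shows "eval_rat y (Fract a b) = eval_poly y a / eval_poly y b"
  unfolding eval_rat_def
proof (rule some_equality)
  fix g assume "\<exists>a' b'. b' \<noteq> 0 \<and> Fract a b = Fract a' b' \<and> g = eval_poly y a' / eval_poly y b'"
  then obtain a' b' where *: "b' \<noteq> 0" "Fract a b = Fract a' b'"
    and g: "g = eval_poly y a' / eval_poly y b'"
    by blast
  from * b have "a * b' = a' * b"
    by (simp add: eq_fract)
  then have "eval_poly y a * eval_poly y b' = eval_poly y a' * eval_poly y b"
    by (metis eval_poly_mult)
  moreover have "eval_poly y b \<noteq> 0" "eval_poly y b' \<noteq> 0"
    using y b * by (auto simp: alg_indep_def)
  ultimately show "g = eval_poly y a / eval_poly y b"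
    by (simp add: g frac_eq_eq)
qed (use b in blast)

subsection \<open>Partial derivatives\<close>

definition pderiv_poly :: "'n \<Rightarrow> 'n mpoly \<Rightarrow> ('n::{finite,linorder}) mpoly" where
  "pderiv_poly i p = (\<Sum>m\<in>Poly_Mapping.keys p.
     Poly_Mapping.single (m - Poly_Mapping.single i 1)
       (of_nat (Poly_Mapping.lookup m i) * Poly_Mapping.lookup p m))"

lemma pderiv_poly_superset:
  assumes "finite K" "Poly_Mapping.keys p \<subseteq> K"
  shows "pderiv_poly i p = (\<Sum>m\<in>K. Poly_Mapping.single (m - Poly_Mapping.single i 1)
       (of_nat (Poly_Mapping.lookup m i) * Poly_Mapping.lookup p m))"
  unfolding pderiv_poly_def using assms
  by (intro sum.mono_neutral_left) (auto simp: in_keys_iff)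

lemma pderiv_poly_add: "pderiv_poly i (p + q) = pderiv_poly i p + pderiv_poly i q"
proof -
  let ?K = "Poly_Mapping.keys p \<union> Poly_Mapping.keys q"
  show ?thesis
    using Poly_Mapping.keys_add[of p q]
    by (simp add: pderiv_poly_superset[of ?K] lookup_add algebra_simps sum.distrib single_add)
qed

lemma pderiv_poly_single:
  "pderiv_poly i (Poly_Mapping.single m c) =
     Poly_Mapping.single (m - Poly_Mapping.single i 1) (of_nat (Poly_Mapping.lookup m i) * c)"
  by (cases "c = 0") (simp_all add: pderiv_poly_def)

lemma monom_shift:
  fixes m m' :: "'n \<Rightarrow>\<^sub>0 nat"
  assumes "Poly_Mapping.lookup m i \<noteq> 0"
  shows "m - Poly_Mapping.single i 1 + m' = m + m' - Poly_Mapping.single i 1"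
  using assms by (intro poly_mapping_eqI) (auto simp: lookup_add lookup_minus lookup_single when_def)

lemma pderiv_poly_mult: "pderiv_poly i (p * q) = pderiv_poly i p * q + p * pderiv_poly i q"
proof (rule additive_eqI[of "\<lambda>p. pderiv_poly i (p * q)"
      "\<lambda>p. pderiv_poly i p * q + p * pderiv_poly i q" p])
  fix m c
  show "pderiv_poly i (Poly_Mapping.single m c * q) =
        pderiv_poly i (Poly_Mapping.single m c) * q + Poly_Mapping.single m c * pderiv_poly i q"
  proof (rule additive_eqI[of "\<lambda>q. pderiv_poly i (Poly_Mapping.single m c * q)"
        "\<lambda>q. pderiv_poly i (Poly_Mapping.single m c) * q
              + Poly_Mapping.single m c * pderiv_poly i q" q])
    fix m' c'
    have 1: "Poly_Mapping.single (m - Poly_Mapping.single i 1 + m')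
            (of_nat (Poly_Mapping.lookup m i) * c * c') =
          Poly_Mapping.single (m + m' - Poly_Mapping.single i 1)
            (of_nat (Poly_Mapping.lookup m i) * c * c')"
      by (cases "Poly_Mapping.lookup m i = 0") (simp_all add: monom_shift del: One_nat_def)
    have 2: "Poly_Mapping.single (m + (m' - Poly_Mapping.single i 1))
            (c * (of_nat (Poly_Mapping.lookup m' i) * c')) =
          Poly_Mapping.single (m + m' - Poly_Mapping.single i 1)
            (c * (of_nat (Poly_Mapping.lookup m' i) * c'))"
      by (cases "Poly_Mapping.lookup m' i = 0")
         (use monom_shift[of m' i m] in \<open>simp_all add: add.commute del: One_nat_def\<close>)
    show "pderiv_poly i (Poly_Mapping.single m c * Poly_Mapping.single m' c') =
        pderiv_poly i (Poly_Mapping.single m c) * Poly_Mapping.single m' c'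
        + Poly_Mapping.single m c * pderiv_poly i (Poly_Mapping.single m' c')"
      unfolding mult_single pderiv_poly_single 1 2 single_add[symmetric] lookup_add
      by (simp add: algebra_simps)
  qed (simp_all add: pderiv_poly_add algebra_simps)
qed (simp_all add: pderiv_poly_add algebra_simps)

lemma quotient_rule_cong:
  fixes a b c d :: "'a::idom"
  assumes "a * d = c * b" "a' * d + a * d' = c' * b + c * b'"
  shows "(b * a' - a * b') * (d * d) = (d * c' - c * d') * (b * b)"
  using assms by algebra

lift_definition pderiv_rat :: "'n \<Rightarrow> 'n ratfun \<Rightarrow> ('n::{finite,linorder}) ratfun" is
  "\<lambda>i (a, b). (b * pderiv_poly i a - a * pderiv_poly i b, b * b)"
proof -
  fix i :: "'n::{finite,linorder}" and x y :: "'n mpoly \<times> 'n mpoly"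
  assume *: "fractrel x y"
  obtain a b c d where xy: "x = (a, b)" "y = (c, d)"
    by fastforce
  from * xy have nz: "b \<noteq> 0" "d \<noteq> 0" and eq: "a * d = c * b"
    by auto
  let ?D = "pderiv_poly i :: 'n mpoly \<Rightarrow> 'n mpoly"
  have "?D a * d + a * ?D d = ?D c * b + c * ?D b"
    using arg_cong[OF eq, of ?D] by (simp add: pderiv_poly_mult)
  with eq have "(b * ?D a - a * ?D b) * (d * d) = (d * ?D c - c * ?D d) * (b * b)"
    by (rule quotient_rule_cong)
  then show "fractrel (case x of (a, b) \<Rightarrow> (b * ?D a - a * ?D b, b * b))
      (case y of (a, b) \<Rightarrow> (b * ?D a - a * ?D b, b * b))"
    using nz xy by simp
qed

lemma pderiv_rat_Fract:
  "b \<noteq> 0 \<Longrightarrow>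
     pderiv_rat i (Fract a b) = Fract (b * pderiv_poly i a - a * pderiv_poly i b) (b * b)"
  by (simp add: Fract.abs_eq pderiv_rat.abs_eq)

section \<open>Derivations\<close>

text \<open>
  The element \<open>\<Sum>\<^sub>i p\<^sub>i \<partial>\<^sub>x\<^sub>i\<close> of \<open>Der\<^sub>F\<close> is the vector of its coefficients \<open>p\<^sub>i\<close>; \<open>der_app\<close> lets it
  act on \<open>F\<close>.  The \<open>F\<close>-module structure is \<^term>\<open>(*s)\<close>.
\<close>

definition der_app :: "('n::{finite,linorder}) derivation \<Rightarrow> 'n ratfun \<Rightarrow> 'n ratfun" where
  "der_app \<theta> f = (\<Sum>i\<in>UNIV. \<theta> $ i * pderiv_rat i f)"

definition nabla :: "('n::{finite,linorder}) derivation \<Rightarrow> 'n derivation \<Rightarrow> 'n derivation" where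
  "nabla \<theta> \<phi> = (\<chi> i. der_app \<theta> (\<phi> $ i))"

definition DerS :: "('n::{finite,linorder}) derivation set" where
  "DerS = {\<theta>. \<forall>i. \<theta> $ i \<in> polys}"

definition has_pdeg :: "('n::{finite,linorder}) derivation \<Rightarrow> int \<Rightarrow> bool" where
  "has_pdeg \<theta> z \<longleftrightarrow> (\<exists>p q f g. z = int p - int q \<and>
     (\<forall>i. homogeneous p (f i) \<and> homogeneous q (g i) \<and> g i \<noteq> 0 \<and> \<theta> $ i = f i / g i))"

definition submodule :: "('n::{finite,linorder}) ratfun set \<Rightarrow> 'n derivation set \<Rightarrow> bool" where
  "submodule A M \<longleftrightarrow> 0 \<in> M \<and> (\<forall>\<theta>\<in>M. \<forall>\<phi>\<in>M. \<theta> + \<phi> \<in> M) \<and> (\<forall>a\<in>A. \<forall>\<theta>\<in>M. a *s \<theta> \<in> M)"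

definition combinations ::
    "('n::{finite,linorder}) ratfun set \<Rightarrow> (nat \<Rightarrow> 'n derivation) \<Rightarrow> 'n derivation set" where
  "combinations A v = {\<Sum>j=1..CARD('n). c j *s v j | c. \<forall>j\<in>{1..CARD('n)}. c j \<in> A}"

definition is_basis ::
    "('n::{finite,linorder}) ratfun set \<Rightarrow> 'n derivation set \<Rightarrow> (nat \<Rightarrow> 'n derivation) \<Rightarrow> bool" where
  "is_basis A M v \<longleftrightarrow> M = combinations A v \<and>
     (\<forall>c. (\<forall>j\<in>{1..CARD('n)}. c j \<in> A) \<and> (\<Sum>j=1..CARD('n). c j *s v j) = 0
        \<longrightarrow> (\<forall>j\<in>{1..CARD('n)}. c j = 0))"

definition module_iso ::
    "('n::{finite,linorder}) ratfun set \<Rightarrow> ('n derivation \<Rightarrow> 'n derivation)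
      \<Rightarrow> 'n derivation set \<Rightarrow> 'n derivation set \<Rightarrow> bool" where
  "module_iso A f M N \<longleftrightarrow> submodule A M \<and> submodule A N \<and> bij_betw f M N \<and>
     (\<forall>\<theta>\<in>M. \<forall>\<phi>\<in>M. f (\<theta> + \<phi>) = f \<theta> + f \<phi>) \<and> (\<forall>a\<in>A. \<forall>\<theta>\<in>M. f (a *s \<theta>) = a *s f \<theta>)"

definition family_sum :: "int set \<Rightarrow> (int \<Rightarrow> ('n::{finite,linorder}) derivation set) \<Rightarrow> 'n derivation set"
  where
  "family_sum J G = {\<Sum>i\<in>K. g i | K g. finite K \<and> K \<subseteq> J \<and> (\<forall>i\<in>K. g i \<in> G i)}"

definition internal_direct_sum ::
    "('n::{finite,linorder}) ratfun set \<Rightarrow> int set \<Rightarrow> (int \<Rightarrow> 'n derivation set)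
      \<Rightarrow> 'n derivation set \<Rightarrow> bool" where
  "internal_direct_sum A J G M \<longleftrightarrow> (\<forall>i\<in>J. submodule A (G i)) \<and> M = family_sum J G \<and>
     (\<forall>K g. finite K \<and> K \<subseteq> J \<and> (\<forall>i\<in>K. g i \<in> G i) \<and> (\<Sum>i\<in>K. g i) = 0 \<longrightarrow> (\<forall>i\<in>K. g i = 0))"

section \<open>Complex reflection groups\<close>

definition GL :: "('n::finite) cmat monoid" where
  "GL = \<lparr>carrier = {A. invertible A}, mult = (**), one = mat 1\<rparr>"

definition fixed_space :: "('n::finite) cmat \<Rightarrow> 'n cvec set" where
  "fixed_space w = {v. w *v v = v}"

text \<open>Finite order is automatic for the elements of a finite group.\<close>

definition reflections :: "('n::finite) cmat set \<Rightarrow> 'n cmat set" where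
  "reflections W = {r \<in> W. vec.dim (fixed_space r) + 1 = CARD('n)}"

definition irreducible_group :: "('n::finite) cmat set \<Rightarrow> bool" where
  "irreducible_group W \<longleftrightarrow>
     (\<forall>U. vec.subspace U \<and> (\<forall>w\<in>W. \<forall>v\<in>U. w *v v \<in> U) \<longrightarrow> U = {0} \<or> U = UNIV)"

definition irreducible_reflection_group :: "('n::finite) cmat set \<Rightarrow> bool" where
  "irreducible_reflection_group W \<longleftrightarrow> subgroup W GL \<and> finite W \<and> irreducible_group W \<and>
     generate GL (reflections W) = W"

definition well_generated :: "('n::finite) cmat set \<Rightarrow> bool" where
  "well_generated W \<longleftrightarrow>
     (\<exists>X \<subseteq> reflections W. card X = CARD('n) \<and> generate GL X = W)"

definition arrangement :: "('n::finite) cmat set \<Rightarrow> 'n cvec set set" where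
  "arrangement W = fixed_space ` reflections W"

definition stab_order :: "('n::finite) cmat set \<Rightarrow> 'n cvec set \<Rightarrow> nat" where
  "stab_order W H = card {w \<in> W. \<forall>v\<in>H. w *v v = v}"

definition coxeter_number :: "('n::finite) cmat set \<Rightarrow> complex" where
  "coxeter_number W = (\<Sum>H\<in>arrangement W. of_nat (stab_order W H)) / of_nat CARD('n)"

definition invariant_inner ::
    "('n::finite) cmat set \<Rightarrow> ('n cvec \<Rightarrow> 'n cvec \<Rightarrow> complex) \<Rightarrow> bool" where
  "invariant_inner W I \<longleftrightarrow>
     (\<forall>u v w. I (u + v) w = I u w + I v w) \<and> (\<forall>c u w. I (c *s u) w = c * I u w) \<and>
     (\<forall>u v. I v u = cnj (I u v)) \<and> (\<forall>v. v \<noteq> 0 \<longrightarrow> Re (I v v) > 0) \<and>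
     (\<forall>w\<in>W. \<forall>u v. I (w *v u) (w *v v) = I u v)"

definition form_app :: "('n::finite) cvec \<Rightarrow> 'n cvec \<Rightarrow> complex" where
  "form_app a v = (\<Sum>i\<in>UNIV. a $ i * v $ i)"

definition riesz :: "(('n::finite) cvec \<Rightarrow> 'n cvec \<Rightarrow> complex) \<Rightarrow> 'n cvec \<Rightarrow> 'n cvec" where
  "riesz I a = (THE u. \<forall>v. I v u = form_app a v)"

text \<open>\<^term>\<open>riesz I\<close> is antilinear; the swap makes \<open>I\<^sup>*\<close> linear in its first argument, like \<open>I\<close>.\<close>

definition dual_inner ::
    "(('n::finite) cvec \<Rightarrow> 'n cvec \<Rightarrow> complex) \<Rightarrow> 'n cvec \<Rightarrow> 'n cvec \<Rightarrow> complex" where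
  "dual_inner I a b = I (riesz I b) (riesz I a)"

definition normal_forms ::
    "('n::finite) cmat set \<Rightarrow> ('n cvec \<Rightarrow> 'n cvec \<Rightarrow> complex)
      \<Rightarrow> ('n cvec set \<Rightarrow> 'n cvec) \<Rightarrow> bool" where
  "normal_forms W I \<alpha> \<longleftrightarrow> (\<forall>H\<in>arrangement W.
     H = {v. form_app (\<alpha> H) v = 0} \<and> dual_inner I (\<alpha> H) (\<alpha> H) = 1)"

subsection \<open>Actions and invariants\<close>

text \<open>On \<open>V\<^sup>*\<close>, \<open>w x\<^sub>i = x\<^sub>i \<circ> w\<inverse>\<close>, which is the \<open>i\<close>-th row of the inverse matrix.\<close>

definition act :: "'n cmat \<Rightarrow> 'n ratfun \<Rightarrow> ('n::{finite,linorder}) ratfun" where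
  "act w f = eval_rat (\<lambda>i. lin (matrix_inv w $ i)) f"

text \<open>The \<open>i\<close>-th coefficient of \<open>w\<theta>\<close> is \<open>(w\<theta>)(x\<^sub>i) = w(\<theta>(w\<inverse> x\<^sub>i))\<close>.\<close>

definition act_der :: "'n cmat \<Rightarrow> 'n derivation \<Rightarrow> ('n::{finite,linorder}) derivation" where
  "act_der w \<theta> = (\<chi> i. act w (der_app \<theta> (act (matrix_inv w) (var i))))"

definition inv_ders ::
    "'n cmat set \<Rightarrow> 'n derivation set \<Rightarrow> ('n::{finite,linorder}) derivation set" where
  "inv_ders W M = {\<theta>\<in>M. \<forall>w\<in>W. act_der w \<theta> = \<theta>}"

definition inv_ring :: "'n cmat set \<Rightarrow> ('n::{finite,linorder}) ratfun set" where
  "inv_ring W = {f\<in>polys. \<forall>w\<in>W. act w f = f}"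

definition basic_invariants ::
    "'n cmat set \<Rightarrow> (nat \<Rightarrow> nat) \<Rightarrow> (nat \<Rightarrow> ('n::{finite,linorder}) ratfun) \<Rightarrow> bool" where
  "basic_invariants W d t \<longleftrightarrow> (\<forall>i\<in>{1..CARD('n)}. homogeneous (d i) (t i)) \<and>
     alg_indep t {1..CARD('n)} \<and> inv_ring W = adjoin t {1..CARD('n)}"

definition degrees :: "('n::{finite,linorder}) cmat set \<Rightarrow> (nat \<Rightarrow> nat) \<Rightarrow> bool" where
  "degrees W d \<longleftrightarrow> mono_on {1..CARD('n)} d \<and> (\<exists>t. basic_invariants W d t)"

definition coexponents :: "('n::{finite,linorder}) cmat set \<Rightarrow> (nat \<Rightarrow> nat) \<Rightarrow> bool" where
  "coexponents W e \<longleftrightarrow> mono_on {1..CARD('n)} e \<and>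
     (\<exists>\<theta>. is_basis (inv_ring W) (inv_ders W DerS) \<theta> \<and>
        (\<forall>j\<in>{1..CARD('n)}. has_pdeg (\<theta> j) (int (e j))))"

section \<open>Logarithmic vector fields\<close>

definition Q_arr ::
    "'n cmat set \<Rightarrow> ('n cvec set \<Rightarrow> 'n cvec) \<Rightarrow> ('n::{finite,linorder}) ratfun"
  where
  "Q_arr W \<alpha> = (\<Prod>H\<in>arrangement W. lin (\<alpha> H))"

definition discriminant ::
    "'n cmat set \<Rightarrow> ('n cvec set \<Rightarrow> 'n cvec) \<Rightarrow> ('n::{finite,linorder}) ratfun"
  where
  "discriminant W \<alpha> = (\<Prod>H\<in>arrangement W. lin (\<alpha> H) ^ stab_order W H)"

definition DerS' ::
    "'n cmat set \<Rightarrow> ('n cvec set \<Rightarrow> 'n cvec)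
      \<Rightarrow> ('n::{finite,linorder}) derivation set" where
  "DerS' W \<alpha> = {\<theta>. \<forall>i. \<theta> $ i \<in> {f / Q_arr W \<alpha> ^ n | f n. f \<in> polys}}"

text \<open>The localization \<open>S\<^sub>\<langle>\<^sub>a\<^sub>\<rangle>\<close> for a linear form \<open>a\<close>.\<close>

definition localization :: "'n cvec \<Rightarrow> ('n::{finite,linorder}) ratfun set" where
  "localization a = {f / g | f g. f \<in> polys \<and> g \<in> polys \<and> \<not> (\<exists>s\<in>polys. g = lin a * s)}"

definition logD_inf ::
    "'n cmat set \<Rightarrow> ('n cvec \<Rightarrow> 'n cvec \<Rightarrow> complex)
      \<Rightarrow> ('n cvec set \<Rightarrow> 'n cvec) \<Rightarrow> ('n::{finite,linorder}) derivation set" where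
  "logD_inf W I \<alpha> = {\<theta> \<in> DerS' W \<alpha>. \<forall>H\<in>arrangement W. \<forall>\<beta>. dual_inner I (\<alpha> H) \<beta> = 0 \<longrightarrow>
     der_app \<theta> (lin \<beta>) \<in> localization (\<alpha> H)}"

definition logD ::
    "'n cmat set \<Rightarrow> ('n cvec \<Rightarrow> 'n cvec \<Rightarrow> complex)
      \<Rightarrow> ('n cvec set \<Rightarrow> 'n cvec) \<Rightarrow> ('n cvec set \<Rightarrow> int)
      \<Rightarrow> ('n::{finite,linorder}) derivation set" where
  "logD W I \<alpha> \<nu> = {\<theta> \<in> logD_inf W I \<alpha>. \<forall>H\<in>arrangement W.
     der_app \<theta> (lin (\<alpha> H)) \<in> {lin (\<alpha> H) powi \<nu> H * f | f. f \<in> localization (\<alpha> H)}}"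

section \<open>Flat systems\<close>

definition partial_t :: "(nat \<Rightarrow> 'n ratfun) \<Rightarrow> nat \<Rightarrow> ('n::{finite,linorder}) derivation" where
  "partial_t t j = (THE \<theta>. \<forall>i\<in>{1..CARD('n)}. der_app \<theta> (t i) = (if i = j then 1 else 0))"

definition primitive :: "(nat \<Rightarrow> 'n ratfun) \<Rightarrow> ('n::{finite,linorder}) derivation" where
  "primitive t = partial_t t CARD('n)"

definition T_ring :: "(nat \<Rightarrow> 'n ratfun) \<Rightarrow> ('n::{finite,linorder}) ratfun set" where
  "T_ring t = adjoin t {1..CARD('n) - 1}"

definition DerR ::
    "'n cmat set \<Rightarrow> (nat \<Rightarrow> 'n ratfun) \<Rightarrow> ('n::{finite,linorder}) derivation set" where
  "DerR W t = combinations (inv_ring W) (partial_t t)"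

definition DerR_log ::
    "'n cmat set \<Rightarrow> ('n cvec set \<Rightarrow> 'n cvec) \<Rightarrow> (nat \<Rightarrow> 'n ratfun)
      \<Rightarrow> ('n::{finite,linorder}) derivation set" where
  "DerR_log W \<alpha> t = {\<theta> \<in> DerR W t.
     der_app \<theta> (discriminant W \<alpha>) \<in> {f * discriminant W \<alpha> | f. f \<in> inv_ring W}}"

definition nabla_inv ::
    "'n cmat set \<Rightarrow> ('n cvec set \<Rightarrow> 'n cvec) \<Rightarrow> (nat \<Rightarrow> 'n ratfun)
      \<Rightarrow> 'n derivation \<Rightarrow> ('n::{finite,linorder}) derivation" where
  "nabla_inv W \<alpha> t = inv_into (DerR_log W \<alpha> t) (nabla (primitive t))"

definition euler :: "'n cmat set \<Rightarrow> ('n::{finite,linorder}) derivation" where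
  "euler W = (\<chi> i. cst (1 / coxeter_number W) * var i)"

text \<open>The diagonal entries \<open>e\<^sub>i/h - 1\<close> of \<open>B\<^sub>\<infinity>\<close>, with \<open>e\<^sub>i = d\<^sub>i - 1\<close>.\<close>

definition B_inf :: "('n::finite) cmat set \<Rightarrow> (nat \<Rightarrow> nat) \<Rightarrow> nat \<Rightarrow> complex" where
  "B_inf W d i = (of_nat (d i) - 1) / coxeter_number W - 1"

definition M_mat ::
    "(nat \<Rightarrow> 'n ratfun) \<Rightarrow> (nat \<Rightarrow> 'n derivation) \<Rightarrow> nat \<Rightarrow> nat \<Rightarrow> ('n::{finite,linorder}) ratfun"
  where
  "M_mat t \<eta> i j = der_app (\<eta> (CARD('n) + 1 - i)) (t j)"

definition inverse_matrices ::
    "(nat \<Rightarrow> nat \<Rightarrow> ('n::{finite,linorder}) ratfun) \<Rightarrow> (nat \<Rightarrow> nat \<Rightarrow> 'n ratfun) \<Rightarrow> bool" where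
  "inverse_matrices M N \<longleftrightarrow> (\<forall>i\<in>{1..CARD('n)}. \<forall>j\<in>{1..CARD('n)}.
     (\<Sum>k=1..CARD('n). M i k * N k j) = (if i = j then 1 else 0) \<and>
     (\<Sum>k=1..CARD('n). N i k * M k j) = (if i = j then 1 else 0))"

text \<open>
  \<open>t\<close> are the flat invariants and \<open>\<eta>\<close> the flat derivations, of degrees \<open>d\<close> and coexponents \<open>e\<close>.
  The last two conjuncts are the rows of \<open>\<nabla>\<^sub>D\<inverse> \<partial>\<^sub>t = - B\<^sub>\<infinity>\<inverse> M\<^sub>\<eta> \<partial>\<^sub>t\<close> and
  \<open>\<nabla>\<^sub>D \<partial>\<^sub>t = - M\<^sub>\<eta>\<inverse> (B\<^sub>\<infinity> + 1) \<partial>\<^sub>t\<close>.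
\<close>

definition flat_system ::
    "'n cmat set \<Rightarrow> ('n cvec set \<Rightarrow> 'n cvec) \<Rightarrow> (nat \<Rightarrow> nat) \<Rightarrow> (nat \<Rightarrow> nat)
      \<Rightarrow> (nat \<Rightarrow> 'n ratfun) \<Rightarrow> (nat \<Rightarrow> ('n::{finite,linorder}) derivation) \<Rightarrow> bool" where
  "flat_system W \<alpha> d e t \<eta> \<longleftrightarrow>
     basic_invariants W d t \<and>
     is_basis (inv_ring W) (DerR_log W \<alpha> t) \<eta> \<and>
     (\<forall>j\<in>{1..CARD('n)}. has_pdeg (\<eta> j) (int (e j))) \<and>
     (\<forall>i\<in>{1..CARD('n)}. \<forall>j\<in>{1..CARD('n)}.
        M_mat t \<eta> i j - (if i = j then t CARD('n) else 0) \<in> T_ring t) \<and>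
     \<eta> 1 = euler W \<and>
     module_iso (T_ring t) (nabla (primitive t)) (DerR_log W \<alpha> t) (DerR W t) \<and>
     (\<forall>i\<in>{1..CARD('n)}. nabla_inv W \<alpha> t (partial_t t i) =
        (\<Sum>j=1..CARD('n). (- cst (inverse (B_inf W d i)) * M_mat t \<eta> i j) *s partial_t t j)) \<and>
     (\<exists>N. inverse_matrices (M_mat t \<eta>) N \<and>
        (\<forall>i\<in>{1..CARD('n)}. nabla (primitive t) (partial_t t i) =
          (\<Sum>j=1..CARD('n). (- N i j * cst (B_inf W d j + 1)) *s partial_t t j)))"

section \<open>The filtration\<close>

definition G_zero :: "(nat \<Rightarrow> 'n ratfun) \<Rightarrow> ('n::{finite,linorder}) derivation set" where
  "G_zero t = combinations (T_ring t) (partial_t t)"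

definition G_piece ::
    "'n cmat set \<Rightarrow> ('n cvec set \<Rightarrow> 'n cvec) \<Rightarrow> (nat \<Rightarrow> 'n ratfun) \<Rightarrow> int
      \<Rightarrow> ('n::{finite,linorder}) derivation set" where
  "G_piece W \<alpha> t i =
     (if i \<ge> 0 then (nabla_inv W \<alpha> t ^^ nat i) ` G_zero t
      else (nabla (primitive t) ^^ nat (- i)) ` G_zero t)"

definition H_filt ::
    "'n cmat set \<Rightarrow> ('n cvec set \<Rightarrow> 'n cvec) \<Rightarrow> (nat \<Rightarrow> 'n ratfun) \<Rightarrow> int
      \<Rightarrow> ('n::{finite,linorder}) derivation set" where
  "H_filt W \<alpha> t k = family_sum {1 - k..} (G_piece W \<alpha> t)"

end

theory Submission
  imports Defs "HOL-Computational_Algebra.Polynomial"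
begin

text \<open>
  Along every reflecting hyperplane \<open>H\<close> the operator \<open>\<nabla>\<^sub>D\<close> raises the pole order of invariant
  fields by exactly \<open>e = e\<^sub>H\<close>; both the description of the filtration and the isomorphisms come from
  this local fact and from the relation of \<open>\<nabla>\<^sub>D\<close> with the matrix \<open>M\<^sub>\<eta>\<close>.

  The pointwise stabilizer of \<open>H\<close> fixes the forms orthogonal to \<open>\<alpha>\<^sub>H\<close> and acts on \<open>\<alpha>\<^sub>H\<close> by a faithful
  character.  For an invariant field \<open>\<theta>\<close>, the functions \<open>\<theta>(\<beta>)\<close> with \<open>\<beta>\<close> orthogonal to \<open>\<alpha>\<^sub>H\<close> are
  thus invariant under the stabilizer and have order divisible by \<open>e\<close> along \<open>H\<close>, whereas \<open>\<theta>(\<alpha>\<^sub>H)\<close>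
  has order congruent to \<open>1\<close> modulo \<open>e\<close> (lemmas \<open>order_of_invariant\<close> and
  \<open>order_of_semi_invariant\<close>).  As \<open>D \<alpha>\<^sub>H\<close> has order \<open>1 - e\<close> (lemma \<open>D_\<alpha>_exact\<close>), \<open>D\<close> lowers orders of
  the second kind, which are never \<open>0\<close>, by exactly \<open>e\<close>.  Hence a field \<open>\<theta>\<close> in \<open>\<D>(\<A>, -\<infinity>)\<^sup>W\<close>
  belongs to \<open>\<D>(\<A>, -k\<omega> + 1)\<^sup>W\<close> if and only if \<open>\<nabla>\<^sub>D \<theta>\<close> belongs to the module for \<open>k + 1\<close>
  (lemma \<open>nablaD_Dlog_iff\<close>), and \<open>\<nabla>\<^sub>D\<close> is injective because the \<open>\<alpha>\<^sub>H\<close> span \<open>V\<^sup>*\<close>.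

  The poles of \<open>\<partial>\<^sub>t\<^sub>j\<close> are controlled by differentiating the equation \<open>P(f) = 0\<close>, where \<open>f\<close> is a
  generic linear form and \<open>P(T) = \<Prod>\<^sub>g (T - g f)\<close> has coefficients in \<open>R\<close>: the product
  \<open>P'(f) \<partial>\<^sub>t\<^sub>j f\<close> is a polynomial, and \<open>P'(f) = \<Prod>\<^bsub>g \<noteq> 1\<^esub> (f - g f)\<close> has order \<open>e - 1\<close> along \<open>H\<close>
  (lemma \<open>pole_bound\<close>).  It follows that \<open>Der\<^sub>R = \<D>(\<A>, -\<omega> + 1)\<^sup>W\<close> and
  \<open>Der\<^sub>R(-log \<Delta>) = \<D>(\<A>, 1)\<^sup>W\<close>.

  For surjectivity of \<open>\<nabla>\<^sub>D\<close> from the module for \<open>k\<close> to the one for \<open>k + 1\<close>, the case \<open>k \<le> 0\<close> follows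
  from the isomorphism \<open>Der\<^sub>R(-log \<Delta>) \<rightarrow> Der\<^sub>R\<close> and exactness.  For \<open>k > 0\<close>, the fields
  \<open>\<phi>\<^sub>j = \<nabla>\<^sub>D\<^sup>k \<partial>\<^sub>t\<^sub>j\<close> form an \<open>R\<close>-basis of the target (lemma \<open>Dlog_basis\<close>), which is checked locally
  along each \<open>H\<close>: the pole order grows in one direction only, and exactness shows that the new fields
  reach it.  The relation \<open>M\<^sub>\<eta> \<nabla>\<^sub>D\<^sup>k \<partial>\<^sub>t = - (B\<^sub>\<infinity> + k) \<nabla>\<^sub>D\<^sup>k\<^sup>-\<^sup>1 \<partial>\<^sub>t\<close>
  (lemma \<open>M_\<phi>\<close>) and \<open>M\<^sub>\<eta> = t\<^sub>\<ell> + M\<^sup>(\<^sup>0\<^sup>)\<close> then show by induction on the degree of \<open>f\<close> in \<open>t\<^sub>\<ell>\<close> that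
  every \<open>f \<phi>\<^sub>j\<close> with \<open>f\<close> in \<open>R\<close> is an image (lemma \<open>nablaD_Dlog_nat\<close>).

  Finally, the shape of \<open>M\<^sub>\<eta>\<close> gives \<open>Der\<^sub>R = \<G>\<^sub>0 \<oplus> Der\<^sub>R(-log \<Delta>)\<close>, and \<open>\<nabla>\<^sub>D\<close> lowers the
  degree in \<open>t\<^sub>\<ell>\<close> of the second component.  So \<open>Der\<^sub>R\<close> is the direct sum of the \<open>\<G>\<^sub>i\<close> with
  \<open>i \<ge> 0\<close>, and powers of \<open>\<nabla>\<^sub>D\<close> transport this to all \<open>k\<close>.
\<close>

section \<open>Polynomials inside the field of rational functions\<close>

definition subalgebra :: "('n::{finite,linorder}) ratfun set \<Rightarrow> bool" where
  "subalgebra A \<longleftrightarrow> (\<forall>c. cst c \<in> A) \<and> (\<forall>f\<in>A. \<forall>g\<in>A. f + g \<in> A \<and> f * g \<in> A)"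

lemma cst_1 [simp]: "cst 1 = 1"
  by (simp add: cst_def to_F_def One_fract_def)

lemma cst_minus: "cst (- a) = - cst a"
  using cst_add[of a "- a"] by (simp add: eq_neg_iff_add_eq_0 add.commute)

lemma cst_diff: "cst (a - b) = cst a - cst b"
  using cst_add[of a "- b"] by (simp add: cst_minus)

lemma cst_eq_0_iff [simp]: "cst c = 0 \<longleftrightarrow> c = 0"
proof
  assume "cst c = (0 :: 'a ratfun)"
  then have "Poly_Mapping.single (0 :: 'a \<Rightarrow>\<^sub>0 nat) c = 0"
    by (simp add: cst_def to_F_def Zero_fract_def eq_fract)
  then show "c = 0"
    by (metis lookup_single_eq lookup_zero)
qed simp

lemma cst_eq_iff [simp]: "cst a = cst b \<longleftrightarrow> a = b"
  using cst_eq_0_iff[of "a - b"] by (simp add: cst_diff)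

lemma cst_inverse: "cst (inverse c) = inverse (cst c)"
proof (cases "c = 0")
  case False
  then have "cst (inverse c) * cst c = 1"
    by (simp flip: cst_mult)
  then show ?thesis
    by (metis inverse_unique mult.commute)
qed simp

lemma cst_power: "cst (c ^ n) = cst c ^ n"
  by (induction n) (simp_all add: cst_mult)

lemma cst_of_nat: "cst (of_nat n) = of_nat n"
  by (induction n) (simp_all add: cst_add)

lemma cst_of_int: "cst (of_int n) = of_int n"
  by (cases n) (simp_all add: cst_of_nat cst_minus cst_diff)

lemma of_nat_ratfun_eq_0_iff: "(of_nat n :: ('n::{finite,linorder}) ratfun) = 0 \<longleftrightarrow> n = 0"
  by (simp flip: cst_of_nat)

lemma to_F_add: "to_F (p + q) = to_F p + to_F q"
  by (simp add: to_F_def)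

lemma to_F_mult: "to_F (p * q) = to_F p * to_F q"
  by (simp add: to_F_def)

lemma to_F_eq_iff [simp]: "to_F p = to_F q \<longleftrightarrow> p = q"
  by (simp add: to_F_def eq_fract)

lemma to_F_0 [simp]: "to_F 0 = 0"
  by (simp add: to_F_def Zero_fract_def)

lemma to_F_1 [simp]: "to_F 1 = 1"
  by (simp add: to_F_def One_fract_def)

lemma to_F_eq_0_iff [simp]: "to_F p = 0 \<longleftrightarrow> p = 0"
  using to_F_eq_iff[of p 0] by (simp del: to_F_eq_iff)

lemma Fract_eq_quotient: "Fract a b = to_F a / to_F b"
  by (simp add: to_F_def)

lemma to_F_single:
  "to_F (Poly_Mapping.single m c) = cst c * eval_monom var m"
proof -
  have pow: "to_F p ^ k = to_F (p ^ k)" for p :: "'a mpoly" and k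
    by (induction k) (simp_all add: to_F_mult)
  have *: "eval_monom var m = to_F (Poly_Mapping.single m 1)" for m :: "'a \<Rightarrow>\<^sub>0 nat"
  proof -
    have var_pow: "var i ^ k = to_F (Poly_Mapping.single (Poly_Mapping.single i k) 1)" for i :: 'a and k
    proof (induction k)
      case (Suc k)
      then show ?case
        by (simp add: var_def mult_single single_add[symmetric] flip: to_F_mult)
    qed simp
    have fin: "(\<Prod>i\<in>K. var i ^ f i) = to_F (Poly_Mapping.single (\<Sum>i\<in>K. Poly_Mapping.single i (f i)) 1)"
      if "finite K" for K :: "'a set" and f
      using that by (induction K) (simp_all add: var_pow mult_single flip: to_F_mult)
    have "eval_monom var m =
        to_F (Poly_Mapping.single (\<Sum>i\<in>Poly_Mapping.keys m. Poly_Mapping.single i (Poly_Mapping.lookup m i)) 1)"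
      unfolding eval_monom_def by (rule fin) simp
    also have "(\<Sum>i\<in>Poly_Mapping.keys m. Poly_Mapping.single i (Poly_Mapping.lookup m i)) = m"
      by (rule poly_mapping_eqI) (auto simp: lookup_sum lookup_single when_def in_keys_iff)
    finally show ?thesis .
  qed
  show ?thesis
    by (simp add: * cst_def mult_single flip: to_F_mult)
qed

lemma to_F_eq_eval_poly: "to_F p = eval_poly var p"
  by (rule additive_eqI[of to_F "eval_poly var"])
     (simp_all add: to_F_add eval_poly_add eval_poly_single to_F_single)

lemma polys_to_F [simp]: "to_F p \<in> polys"
  by (auto simp: polys_def)

lemma ratfun_cases:
  obtains p q where "p \<in> polys" "q \<in> polys" "q \<noteq> 0" "f = p / q"
  by (cases f) (metis Fract_eq_quotient polys_to_F to_F_eq_0_iff)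

lemma subalgebra_polys: "subalgebra polys"
  unfolding subalgebra_def
proof (intro conjI allI ballI)
  show "cst c \<in> polys" for c :: complex
    by (simp add: cst_def)
  fix f g :: "'a ratfun" assume "f \<in> polys" "g \<in> polys"
  then obtain p q where "f = to_F p" "g = to_F q"
    by (auto simp: polys_def)
  then show "f + g \<in> polys" "f * g \<in> polys"
    by (simp_all flip: to_F_add to_F_mult)
qed

context
  fixes A :: "('n::{finite,linorder}) ratfun set"
  assumes A: "subalgebra A"
begin

lemma subalgebra_cst: "cst c \<in> A"
  and subalgebra_add: "f \<in> A \<Longrightarrow> g \<in> A \<Longrightarrow> f + g \<in> A"
  and subalgebra_mult: "f \<in> A \<Longrightarrow> g \<in> A \<Longrightarrow> f * g \<in> A"
  using A by (auto simp: subalgebra_def)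

lemma subalgebra_0: "0 \<in> A"
  using subalgebra_cst[of 0] by simp

lemma subalgebra_1: "1 \<in> A"
  using subalgebra_cst[of 1] by simp

lemma subalgebra_uminus: "f \<in> A \<Longrightarrow> - f \<in> A"
  using subalgebra_mult[of "cst (-1)" f] subalgebra_cst[of "-1"] by (simp add: cst_minus)

lemma subalgebra_diff: "f \<in> A \<Longrightarrow> g \<in> A \<Longrightarrow> f - g \<in> A"
  using subalgebra_add[of f "- g"] subalgebra_uminus[of g] by simp

lemma subalgebra_sum: "(\<And>i. i \<in> K \<Longrightarrow> f i \<in> A) \<Longrightarrow> sum f K \<in> A"
  by (induction K rule: infinite_finite_induct) (auto intro: subalgebra_0 subalgebra_add)

lemma subalgebra_prod: "(\<And>i. i \<in> K \<Longrightarrow> f i \<in> A) \<Longrightarrow> prod f K \<in> A"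
  by (induction K rule: infinite_finite_induct) (auto intro: subalgebra_1 subalgebra_mult)

lemma subalgebra_power: "f \<in> A \<Longrightarrow> f ^ n \<in> A"
  by (induction n) (auto intro: subalgebra_1 subalgebra_mult)

lemma adjoin_least:
  assumes "\<And>j. j \<in> J \<Longrightarrow> y j \<in> A"
  shows "adjoin y J \<subseteq> A"
proof
  fix f assume "f \<in> adjoin y J"
  then obtain p where p: "f = eval_poly y p" "poly_vars p \<subseteq> J"
    by (auto simp: adjoin_def)
  have "eval_monom y m \<in> A" if "m \<in> Poly_Mapping.keys p" for m
    unfolding eval_monom_def using that p(2) assms
    by (intro subalgebra_prod subalgebra_power) (auto simp: poly_vars_def)
  then show "f \<in> A"
    unfolding p(1) eval_poly_def by (intro subalgebra_sum subalgebra_mult subalgebra_cst)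
qed

lemma polys_least:
  assumes "\<And>i. var i \<in> A"
  shows "polys \<subseteq> A"
proof -
  have "polys \<subseteq> adjoin var UNIV"
    by (auto simp: polys_def adjoin_def to_F_eq_eval_poly)
  also have "\<dots> \<subseteq> A"
    by (rule adjoin_least) (rule assms)
  finally show ?thesis .
qed

end

lemma polys_var [simp]: "var i \<in> polys"
  by (simp add: var_def)

lemmas polys_closed =
  subalgebra_cst[OF subalgebra_polys] subalgebra_add[OF subalgebra_polys]
  subalgebra_mult[OF subalgebra_polys] subalgebra_0[OF subalgebra_polys]
  subalgebra_1[OF subalgebra_polys] subalgebra_uminus[OF subalgebra_polys]
  subalgebra_diff[OF subalgebra_polys] subalgebra_sum[OF subalgebra_polys]
  subalgebra_prod[OF subalgebra_polys] subalgebra_power[OF subalgebra_polys]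

lemma polys_lin [simp]: "lin a \<in> polys"
  unfolding lin_def by (intro polys_closed polys_var)

lemma subalgebra_adjoin: "subalgebra (adjoin y J)"
  unfolding subalgebra_def
proof (intro conjI allI ballI)
  fix c show "cst c \<in> adjoin y J"
    unfolding adjoin_def
    by (rule CollectI, rule exI[of _ "Poly_Mapping.single 0 c"])
       (auto simp: eval_poly_single eval_monom_def poly_vars_def)
next
  fix f g assume "f \<in> adjoin y J" "g \<in> adjoin y J"
  then obtain p q where pq: "f = eval_poly y p" "g = eval_poly y q" "poly_vars p \<subseteq> J" "poly_vars q \<subseteq> J"
    by (auto simp: adjoin_def)
  have "poly_vars (p + q) \<subseteq> J"
    using pq Poly_Mapping.keys_add[of p q] unfolding poly_vars_def by blast
  then show "f + g \<in> adjoin y J"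
    unfolding adjoin_def using pq by (auto simp: eval_poly_add intro!: exI[of _ "p + q"])
  have "poly_vars (p * q) \<subseteq> J"
  proof -
    have "Poly_Mapping.keys m \<subseteq> J" if m: "m \<in> Poly_Mapping.keys (p * q)" for m
    proof -
      obtain a b where "a \<in> Poly_Mapping.keys p" "b \<in> Poly_Mapping.keys q" "m = a + b"
        using subsetD[OF Poly_Mapping.keys_mult m] by blast
      then show ?thesis
        using Poly_Mapping.keys_add[of a b] pq unfolding poly_vars_def by blast
    qed
    then show ?thesis by (auto simp: poly_vars_def)
  qed
  then show "f * g \<in> adjoin y J"
    unfolding adjoin_def using pq by (auto simp: eval_poly_mult intro!: exI[of _ "p * q"])
qed

lemma adjoin_generator: "j \<in> J \<Longrightarrow> y j \<in> adjoin y J"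
  unfolding adjoin_def
  by (rule CollectI, rule exI[of _ "Poly_Mapping.single (Poly_Mapping.single j 1) 1"])
     (auto simp: eval_poly_single eval_monom_def poly_vars_def)

lemma lin_add: "lin (a + b) = lin a + lin b"
  by (simp add: lin_def cst_add algebra_simps sum.distrib)

lemma lin_scale: "lin (c *s a) = cst c * lin a"
  by (simp add: lin_def cst_mult sum_distrib_left mult.assoc)

lemma lin_0 [simp]: "lin 0 = 0"
  by (simp add: lin_def)

lemma lin_uminus: "lin (- a) = - lin a"
  using lin_add[of a "- a"] by (simp add: eq_neg_iff_add_eq_0 add.commute)

lemma lin_diff: "lin (a - b) = lin a - lin b"
  using lin_add[of a "- b"] by (simp add: lin_uminus)

lemma lin_axis [simp]: "lin (axis i 1) = var i"
proof -
  have "lin (axis i 1) = (\<Sum>j\<in>UNIV. if j = i then var j else 0)"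
    unfolding lin_def by (rule sum.cong) (auto simp: axis_def)
  then show ?thesis by simp
qed

section \<open>Derivations of the field of rational functions\<close>

definition is_deriv :: "(('n::{finite,linorder}) ratfun \<Rightarrow> 'n ratfun) \<Rightarrow> bool" where
  "is_deriv \<delta> \<longleftrightarrow> (\<forall>f g. \<delta> (f + g) = \<delta> f + \<delta> g) \<and> (\<forall>f g. \<delta> (f * g) = \<delta> f * g + f * \<delta> g)
     \<and> (\<forall>c. \<delta> (cst c) = 0)"

context
  fixes \<delta> :: "('n::{finite,linorder}) ratfun \<Rightarrow> 'n ratfun"
  assumes \<delta>: "is_deriv \<delta>"
begin

lemma deriv_add: "\<delta> (f + g) = \<delta> f + \<delta> g"
  and deriv_mult: "\<delta> (f * g) = \<delta> f * g + f * \<delta> g"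
  and deriv_cst: "\<delta> (cst c) = 0"
  using \<delta> by (auto simp: is_deriv_def)

lemma deriv_0: "\<delta> 0 = 0"
  using deriv_cst[of 0] by simp

lemma deriv_1: "\<delta> 1 = 0"
  using deriv_cst[of 1] by simp

lemma deriv_uminus: "\<delta> (- f) = - \<delta> f"
  using deriv_add[of f "- f"] by (simp add: deriv_0 eq_neg_iff_add_eq_0 add.commute)

lemma deriv_diff: "\<delta> (f - g) = \<delta> f - \<delta> g"
  using deriv_add[of f "- g"] by (simp add: deriv_uminus)

lemma deriv_sum: "\<delta> (sum f K) = (\<Sum>i\<in>K. \<delta> (f i))"
  by (induction K rule: infinite_finite_induct) (simp_all add: deriv_0 deriv_add)

lemma deriv_scale: "\<delta> (cst c * f) = cst c * \<delta> f"
  by (simp add: deriv_mult deriv_cst)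

lemma deriv_divide:
  assumes "g \<noteq> 0"
  shows "\<delta> (f / g) = (\<delta> f * g - f * \<delta> g) / (g * g)"
proof -
  have "\<delta> f = \<delta> (f / g) * g + f / g * \<delta> g"
    using deriv_mult[of "f / g" g] assms by simp
  then show ?thesis
    using assms by (simp add: field_simps)
qed

lemma deriv_power: "\<delta> (f ^ n) = of_nat n * f ^ (n - 1) * \<delta> f"
proof (induction n)
  case (Suc n)
  then show ?case
    by (cases n) (simp_all add: deriv_mult algebra_simps)
qed (simp add: deriv_1)

lemma deriv_inverse: "f \<noteq> 0 \<Longrightarrow> \<delta> (inverse f) = - \<delta> f / (f * f)"
  using deriv_divide[of f 1] by (simp add: deriv_1 inverse_eq_divide)

lemma deriv_powi:
  assumes "f \<noteq> 0"
  shows "\<delta> (f powi n) = of_int n * f powi (n - 1) * \<delta> f"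
proof (cases "n \<ge> 0")
  case True
  then obtain k where k: "n = int k"
    using zero_le_imp_eq_int by blast
  show ?thesis
  proof (cases k)
    case (Suc m)
    then have "n - 1 = int m" "f powi n = f ^ Suc m"
      using k by (simp_all add: power_int_def nat_add_distrib)
    then show ?thesis
      by (simp only: deriv_power power_int_of_nat) (simp add: k Suc algebra_simps)
  qed (simp add: k deriv_1)
next
  case False
  then obtain k where k: "n = - int k" "k > 0"
    by (metis int_cases4 linorder_not_le of_nat_0 of_nat_le_0_iff of_nat_0_less_iff neg_0_le_iff_le not_gr0 zero_le_imp_eq_int less_imp_le minus_minus)
  have sq: "f powi (2 * int k) = f ^ k * f ^ k"
    using assms by (simp only: mult_2 power_int_add power_int_of_nat simp_thms)
  have "\<delta> (inverse (f ^ k)) = - (of_nat k * f ^ (k - 1) * \<delta> f) / (f ^ k * f ^ k)"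
    using assms by (simp add: deriv_inverse deriv_power)
  also have "\<dots> = of_int n * (f powi (int (k - 1) - int k - int k)) * \<delta> f"
    using assms sq by (simp add: k power_int_diff divide_simps)
  also have "int (k - 1) - int k - int k = n - 1"
    using k by (simp add: of_nat_diff)
  finally show ?thesis
    using assms by (simp add: k power_int_minus)
qed

end

lemma is_deriv_pderiv_rat: "is_deriv (pderiv_rat i)"
proof -
  let ?d = "\<lambda>p. to_F (pderiv_poly i p)"
  have quot: "pderiv_rat i (to_F a / to_F b) = (?d a * to_F b - to_F a * ?d b) / (to_F b * to_F b)"
    if "b \<noteq> 0" for a b :: "'a mpoly"
  proof -
    have "pderiv_rat i (to_F a / to_F b) = to_F (b * pderiv_poly i a - a * pderiv_poly i b) / to_F (b * b)"
      using that pderiv_rat_Fract[of b i a] by (simp add: Fract_eq_quotient)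
    also have "to_F (b * pderiv_poly i a - a * pderiv_poly i b) = ?d a * to_F b - to_F a * ?d b"
      using to_F_add[of "b * pderiv_poly i a - a * pderiv_poly i b" "a * pderiv_poly i b"]
      by (simp add: to_F_mult algebra_simps)
    finally show ?thesis by (simp add: to_F_mult)
  qed
  show ?thesis
    unfolding is_deriv_def
  proof (intro conjI allI)
    fix f g :: "'a ratfun"
    obtain a b where f: "f = to_F a / to_F b" "b \<noteq> 0"
      by (cases f) (auto simp: Fract_eq_quotient)
    obtain c d where g: "g = to_F c / to_F d" "d \<noteq> 0"
      by (cases g) (auto simp: Fract_eq_quotient)
    have nz: "to_F b \<noteq> 0" "to_F d \<noteq> 0" "b * d \<noteq> 0"
      using f g by simp_all
    have sum: "f + g = to_F (a * d + c * b) / to_F (b * d)"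
      using nz by (simp add: f g to_F_add to_F_mult add_frac_eq)
    have "pderiv_rat i (f + g) =
        ((?d a * to_F d + to_F a * ?d d + (?d c * to_F b + to_F c * ?d b)) * (to_F b * to_F d)
          - (to_F a * to_F d + to_F c * to_F b) * (?d b * to_F d + to_F b * ?d d))
        / (to_F b * to_F d * (to_F b * to_F d))"
      unfolding sum quot[OF nz(3)]
      by (simp only: pderiv_poly_add pderiv_poly_mult to_F_add to_F_mult)
    also have "\<dots> = pderiv_rat i f + pderiv_rat i g"
      using nz by (simp add: f g quot field_simps)
    finally show "pderiv_rat i (f + g) = pderiv_rat i f + pderiv_rat i g" .
    have prod: "f * g = to_F (a * c) / to_F (b * d)"
      by (simp add: f g to_F_mult)
    have "pderiv_rat i (f * g) =
        ((?d a * to_F c + to_F a * ?d c) * (to_F b * to_F d)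
          - (to_F a * to_F c) * (?d b * to_F d + to_F b * ?d d))
        / (to_F b * to_F d * (to_F b * to_F d))"
      unfolding prod quot[OF nz(3)] by (simp only: pderiv_poly_mult to_F_add to_F_mult)
    also have "\<dots> = pderiv_rat i f * g + f * pderiv_rat i g"
      using nz by (simp add: f g quot field_simps)
    finally show "pderiv_rat i (f * g) = pderiv_rat i f * g + f * pderiv_rat i g" .
  next
    fix c
    show "pderiv_rat i (cst c) = 0"
      using quot[of 1 "Poly_Mapping.single 0 c"] pderiv_poly_single[of i 0 1]
      by (simp add: cst_def pderiv_poly_single)
  qed
qed

lemma pderiv_rat_to_F: "pderiv_rat i (to_F p) = to_F (pderiv_poly i p)"
  using pderiv_rat_Fract[of 1 i p] pderiv_poly_single[of i 0 1]
  by (simp add: to_F_def)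

lemma pderiv_rat_var: "pderiv_rat i (var j) = (if i = j then 1 else 0)"
  by (simp add: var_def pderiv_rat_to_F pderiv_poly_single lookup_single when_def
      del: One_nat_def)

lemma is_deriv_der_app: "is_deriv (der_app \<theta>)"
  unfolding is_deriv_def der_app_def
  by (simp add: deriv_add[OF is_deriv_pderiv_rat] deriv_mult[OF is_deriv_pderiv_rat]
      deriv_cst[OF is_deriv_pderiv_rat] algebra_simps sum.distrib sum_distrib_left)

lemmas der_app_add = deriv_add[OF is_deriv_der_app]
lemmas der_app_mult = deriv_mult[OF is_deriv_der_app]
lemmas der_app_cst [simp] = deriv_cst[OF is_deriv_der_app]
lemmas der_app_0 [simp] = deriv_0[OF is_deriv_der_app]
lemmas der_app_1 [simp] = deriv_1[OF is_deriv_der_app]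
lemmas der_app_diff = deriv_diff[OF is_deriv_der_app]
lemmas der_app_sum = deriv_sum[OF is_deriv_der_app]
lemmas der_app_scale = deriv_scale[OF is_deriv_der_app]
lemmas der_app_power = deriv_power[OF is_deriv_der_app]
lemmas der_app_powi = deriv_powi[OF is_deriv_der_app]

lemma der_app_var [simp]: "der_app \<theta> (var i) = \<theta> $ i"
  by (simp add: der_app_def pderiv_rat_var if_distrib cong: if_cong)

lemma der_app_lin: "der_app \<theta> (lin a) = (\<Sum>i\<in>UNIV. cst (a $ i) * \<theta> $ i)"
  by (simp add: lin_def der_app_sum der_app_scale)

lemma der_app_plus_left: "der_app (\<theta> + \<phi>) f = der_app \<theta> f + der_app \<phi> f"
  by (simp add: der_app_def algebra_simps sum.distrib)

lemma der_app_scale_left: "der_app (c *s \<theta>) f = c * der_app \<theta> f"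
  by (simp add: der_app_def sum_distrib_left mult.assoc)

lemma der_app_zero_left [simp]: "der_app 0 f = 0"
  by (simp add: der_app_def)

lemma der_app_minus_left: "der_app (\<theta> - \<phi>) f = der_app \<theta> f - der_app \<phi> f"
  by (simp add: der_app_def algebra_simps sum_subtractf)

lemma der_app_sum_left: "der_app (sum \<theta> K) f = (\<Sum>i\<in>K. der_app (\<theta> i) f)"
  by (induction K rule: infinite_finite_induct) (simp_all add: der_app_plus_left)

lemma derivation_eqI: "(\<And>a. der_app \<theta> (lin a) = der_app \<phi> (lin a)) \<Longrightarrow> \<theta> = \<phi>"
  by (metis der_app_var lin_axis vec_eq_iff)



lemma is_deriv_unique:
  assumes "is_deriv \<delta>" "is_deriv \<delta>'" "\<And>i. \<delta> (var i) = \<delta>' (var i)"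
  shows "\<delta> f = \<delta>' f"
proof -
  have "subalgebra {f. \<delta> f = \<delta>' f}"
    using assms(1,2) by (auto simp: subalgebra_def is_deriv_def)
  then have "polys \<subseteq> {f. \<delta> f = \<delta>' f}"
    by (rule polys_least) (simp add: assms(3))
  moreover obtain p q where "p \<in> polys" "q \<in> polys" "q \<noteq> 0" "f = p / q"
    by (rule ratfun_cases)
  ultimately show ?thesis
    by (auto simp: deriv_divide[OF assms(1)] deriv_divide[OF assms(2)] subset_iff)
qed

lemma is_deriv_eq_der_app:
  assumes "is_deriv \<delta>"
  shows "\<delta> f = der_app (\<chi> i. \<delta> (var i)) f"
  by (rule is_deriv_unique[OF assms is_deriv_der_app]) simp

lemma der_app_nabla_lin: "der_app (nabla \<theta> \<phi>) (lin a) = der_app \<theta> (der_app \<phi> (lin a))"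
  by (simp add: der_app_lin nabla_def der_app_sum der_app_scale)

lemma nabla_add: "nabla \<theta> (\<phi> + \<psi>) = nabla \<theta> \<phi> + nabla \<theta> \<psi>"
  by (simp add: nabla_def vec_eq_iff der_app_add)

lemma nabla_diff: "nabla \<theta> (\<phi> - \<psi>) = nabla \<theta> \<phi> - nabla \<theta> \<psi>"
  by (simp add: nabla_def vec_eq_iff der_app_diff)

lemma nabla_0 [simp]: "nabla \<theta> 0 = 0"
  by (simp add: nabla_def vec_eq_iff)

lemma nabla_sum: "nabla \<theta> (sum \<phi> K) = (\<Sum>i\<in>K. nabla \<theta> (\<phi> i))"
  by (induction K rule: infinite_finite_induct) (simp_all add: nabla_add)

lemma nabla_scale: "nabla \<theta> (c *s \<phi>) = der_app \<theta> c *s \<phi> + c *s nabla \<theta> \<phi>"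
  by (simp add: nabla_def vec_eq_iff der_app_mult)

lemma pderiv_poly_in_polys: "f \<in> polys \<Longrightarrow> pderiv_rat i f \<in> polys"
  by (auto simp: polys_def pderiv_rat_to_F)

section \<open>Order of vanishing along a hyperplane\<close>

lemma mpoly_induct [case_names const variable add mult]:
  fixes p :: "('n::{finite,linorder}) mpoly"
  assumes "\<And>c. P (Poly_Mapping.single 0 c)"
    and "\<And>i. P (Poly_Mapping.single (Poly_Mapping.single i 1) 1)"
    and "\<And>p q. P p \<Longrightarrow> P q \<Longrightarrow> P (p + q)"
    and "\<And>p q. P p \<Longrightarrow> P q \<Longrightarrow> P (p * q)"
  shows "P p"
proof -
  have "subalgebra {to_F p | p. P p}"
    unfolding subalgebra_def cst_def
    using assms(1,3,4) by (auto simp flip: to_F_add to_F_mult)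
  then have "polys \<subseteq> {to_F p | p. P p}"
    by (rule polys_least) (use assms(2) in \<open>auto simp: var_def\<close>)
  then have "to_F p \<in> {to_F p | p. P p}"
    by (rule subsetD) simp
  then show ?thesis
    by auto
qed

lemma eval_poly_const [simp]: "eval_poly y (Poly_Mapping.single 0 c) = cst c"
  by (simp add: eval_poly_single eval_monom_def)

lemma eval_poly_variable [simp]: "eval_poly y (Poly_Mapping.single (Poly_Mapping.single i 1) 1) = y i"
  by (simp add: eval_poly_single eval_monom_def)

definition lin_poly :: "('n::{finite,linorder}) cvec \<Rightarrow> 'n mpoly" where
  "lin_poly a = (\<Sum>i\<in>UNIV. Poly_Mapping.single (Poly_Mapping.single i 1) (a $ i))"

lemma eval_lin_poly:
  fixes y :: "'n::{finite,linorder} \<Rightarrow> 'n ratfun"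
  shows "eval_poly y (lin_poly a) = (\<Sum>i\<in>UNIV. cst (a $ i) * y i)"
proof -
  have z: "eval_poly y 0 = 0"
    by (simp add: eval_poly_def)
  have "eval_poly y (\<Sum>i\<in>K. f i) = (\<Sum>i\<in>K. eval_poly y (f i))" if "finite K" for K :: "'n set" and f
    using that by (induction K) (simp_all add: z eval_poly_add)
  from this[of UNIV] show ?thesis unfolding lin_poly_def
    by (simp add: eval_poly_single eval_monom_def)
qed

lemma to_F_lin_poly: "to_F (lin_poly a) = lin a"
  by (simp add: to_F_eq_eval_poly eval_lin_poly lin_def)

lemma lin_eq_0_iff [simp]: "lin a = 0 \<longleftrightarrow> a = 0"
proof
  assume 0: "lin a = 0"
  have "cst (a $ i) = 0" for i
    using der_app_lin[of "axis i 1" a] 0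
    by (simp add: axis_def if_distrib[where f = "\<lambda>x. _ * x"] cong: if_cong)
  then show "a = 0"
    by (simp add: vec_eq_iff)
qed simp

definition lin_dvd :: "('n::{finite,linorder}) cvec \<Rightarrow> 'n ratfun \<Rightarrow> bool" where
  "lin_dvd a f \<longleftrightarrow> (\<exists>s\<in>polys. f = lin a * s)"

lemma lin_dvd_polys: "lin_dvd a f \<Longrightarrow> f \<in> polys"
  by (auto simp: lin_dvd_def intro: polys_closed)

lemma lin_dvd_0 [simp]: "lin_dvd a 0"
  unfolding lin_dvd_def by (rule bexI[of _ 0]) (simp_all add: polys_closed)

lemma lin_dvd_add: "lin_dvd a f \<Longrightarrow> lin_dvd a g \<Longrightarrow> lin_dvd a (f + g)"
  unfolding lin_dvd_def by (metis distrib_left polys_closed(2))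

lemma lin_dvd_mult: "lin_dvd a f \<Longrightarrow> g \<in> polys \<Longrightarrow> lin_dvd a (f * g)"
  unfolding lin_dvd_def by (auto simp: mult.assoc polys_closed(3))

lemma lin_dvd_mult2: "lin_dvd a g \<Longrightarrow> f \<in> polys \<Longrightarrow> lin_dvd a (f * g)"
  using lin_dvd_mult by (metis mult.commute)

lemma lin_dvd_uminus: "lin_dvd a f \<Longrightarrow> lin_dvd a (- f)"
  using lin_dvd_mult[of a f "-1"] by (simp add: polys_closed)

lemma lin_dvd_diff: "lin_dvd a f \<Longrightarrow> lin_dvd a g \<Longrightarrow> lin_dvd a (f - g)"
  using lin_dvd_add[of a f "- g"] lin_dvd_uminus[of a g] by simp

text \<open>
  Eliminating a variable with the help of the equation \<open>a = 0\<close> is a ring homomorphism into the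
  integral domain of polynomials, and its kernel is the ideal generated by \<open>a\<close>.
\<close>

definition eliminate :: "('n::{finite,linorder}) cvec \<Rightarrow> 'n \<Rightarrow> 'n mpoly \<Rightarrow> 'n ratfun" where
  "eliminate a k = eval_poly (\<lambda>i. if i = k then var k - cst (inverse (a $ k)) * lin a else var i)"

lemma lin_dvd_minus_eliminate: "lin_dvd a (to_F p - eliminate a k p)"
proof (induction p rule: mpoly_induct)
  case (const c)
  then show ?case by (simp add: eliminate_def cst_def)
next
  case (variable i)
  have "lin_dvd a (cst (inverse (a $ k)) * lin a)"
    unfolding lin_dvd_def by (rule bexI[of _ "cst (inverse (a $ k))"]) (simp_all add: polys_closed(1) mult.commute)
  then show ?case
    by (simp add: eliminate_def var_def del: One_nat_def)
next
  case (add p q)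
  then show ?case
    using lin_dvd_add[OF add] by (simp add: eliminate_def eval_poly_add to_F_add algebra_simps)
next
  case (mult p q)
  have "eliminate a k q = to_F q - (to_F q - eliminate a k q)"
    by simp
  then have "eliminate a k q \<in> polys"
    using lin_dvd_polys[OF mult(2)] by (metis polys_closed(7) polys_to_F)
  then have "lin_dvd a (to_F p * (to_F q - eliminate a k q) + (to_F p - eliminate a k p) * eliminate a k q)"
    by (intro lin_dvd_add lin_dvd_mult lin_dvd_mult2 mult) auto
  then show ?case
    by (simp add: eliminate_def eval_poly_mult to_F_mult algebra_simps)
qed

lemma eliminate_eq_0_iff:
  assumes "a $ k \<noteq> 0"
  shows "eliminate a k p = 0 \<longleftrightarrow> lin_dvd a (to_F p)"
proof
  assume "eliminate a k p = 0"
  then show "lin_dvd a (to_F p)"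
    using lin_dvd_minus_eliminate[of a p k] by simp
next
  assume "lin_dvd a (to_F p)"
  then obtain q where "to_F p = to_F (lin_poly a * q)"
    by (auto simp: lin_dvd_def polys_def to_F_mult to_F_lin_poly)
  then have p: "p = lin_poly a * q"
    by simp
  have "eliminate a k (lin_poly a) =
      (\<Sum>i\<in>UNIV. cst (a $ i) * var i - (if i = k then lin a else 0))"
    unfolding eliminate_def eval_lin_poly using assms
    by (intro sum.cong) (auto simp: algebra_simps cst_inverse)
  also have "\<dots> = 0"
    by (simp add: sum_subtractf lin_def)
  finally show "eliminate a k p = 0"
    by (simp add: p eliminate_def eval_poly_mult)
qed

lemma lin_prime:
  assumes "a \<noteq> 0" "f \<in> polys" "g \<in> polys" "lin_dvd a (f * g)"
  shows "lin_dvd a f \<or> lin_dvd a g"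
proof -
  obtain k where k: "a $ k \<noteq> 0"
    using assms(1) by (auto simp: vec_eq_iff)
  obtain p q where pq: "f = to_F p" "g = to_F q"
    using assms(2,3) by (auto simp: polys_def)
  have "eliminate a k (p * q) = 0"
    using assms(4) k pq by (simp add: eliminate_eq_0_iff to_F_mult)
  then show ?thesis
    using k pq by (auto simp: eliminate_def eval_poly_mult simp flip: eliminate_eq_0_iff[of a k])
qed

lemma not_lin_dvd_1: "\<not> lin_dvd a 1"
proof
  assume "lin_dvd a 1"
  then have "a \<noteq> 0"
    by (auto simp: lin_dvd_def)
  then obtain k where k: "a $ k \<noteq> 0"
    by (auto simp: vec_eq_iff)
  have "eliminate a k 1 = 0"
    using \<open>lin_dvd a 1\<close> by (simp add: eliminate_eq_0_iff[OF k])
  moreover have "eliminate a k 1 = 1"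
    using eval_poly_const[of _ 1] by (simp add: eliminate_def)
  ultimately show False
    by simp
qed

lemma lin_dvd_lin_iff:
  assumes "a \<noteq> 0"
  shows "lin_dvd a (lin b) \<longleftrightarrow> (\<exists>c. b = c *s a)"
proof
  obtain k where k: "a $ k \<noteq> 0"
    using assms by (auto simp: vec_eq_iff)
  assume "lin_dvd a (lin b)"
  then have "eliminate a k (lin_poly b) = 0"
    by (simp add: eliminate_eq_0_iff[OF k] to_F_lin_poly)
  moreover have "eliminate a k (lin_poly b) =
      (\<Sum>i\<in>UNIV. cst (b $ i) * var i - (if i = k then cst (b $ k / a $ k) * lin a else 0))"
    unfolding eliminate_def eval_lin_poly
    by (intro sum.cong) (auto simp: algebra_simps divide_inverse cst_mult)
  ultimately have "lin (b - (b $ k / a $ k) *s a) = 0"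
    by (simp add: sum_subtractf lin_diff lin_scale) (simp add: lin_def)
  then show "\<exists>c. b = c *s a"
    by auto
next
  assume "\<exists>c. b = c *s a"
  then show "lin_dvd a (lin b)"
    by (auto simp: lin_dvd_def lin_scale mult.commute intro: polys_closed)
qed

text \<open>
  Recording the total degree in a further variable is an injective ring homomorphism, so degrees
  add up and bound the multiplicity of a linear factor.
\<close>

definition grade :: "('n::{finite,linorder}) mpoly \<Rightarrow> 'n mpoly poly" where
  "grade p = (\<Sum>m\<in>Poly_Mapping.keys p.
     Polynomial.monom (Poly_Mapping.single m (Poly_Mapping.lookup p m)) (\<Sum>i\<in>UNIV. Poly_Mapping.lookup m i))"

lemma grade_superset:
  assumes "finite K" "Poly_Mapping.keys p \<subseteq> K"
  shows "grade p = (\<Sum>m\<in>K.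
     Polynomial.monom (Poly_Mapping.single m (Poly_Mapping.lookup p m)) (\<Sum>i\<in>UNIV. Poly_Mapping.lookup m i))"
  unfolding grade_def using assms
  by (intro sum.mono_neutral_left) (auto simp: in_keys_iff)

lemma grade_add: "grade (p + q) = grade p + grade q"
proof -
  let ?K = "Poly_Mapping.keys p \<union> Poly_Mapping.keys q"
  show ?thesis
    using Poly_Mapping.keys_add[of p q]
    by (simp add: grade_superset[of ?K] lookup_add single_add sum.distrib flip: Polynomial.add_monom)
qed

lemma grade_single:
  "grade (Poly_Mapping.single m c) =
     Polynomial.monom (Poly_Mapping.single m c) (\<Sum>i\<in>UNIV. Poly_Mapping.lookup m i)"
  by (cases "c = 0") (simp_all add: grade_def)

lemma grade_mult: "grade (p * q) = grade p * grade q"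
proof (rule additive_eqI[of "\<lambda>p. grade (p * q)" "\<lambda>p. grade p * grade q" p])
  fix m c
  show "grade (Poly_Mapping.single m c * q) = grade (Poly_Mapping.single m c) * grade q"
    by (rule additive_eqI[of "\<lambda>q. grade (Poly_Mapping.single m c * q)"
          "\<lambda>q. grade (Poly_Mapping.single m c) * grade q" q])
       (simp_all add: grade_add grade_single mult_single mult_monom lookup_add sum.distrib
          algebra_simps)
qed (simp_all add: grade_add algebra_simps)

lemma poly_grade_1: "poly (grade p) 1 = p"
  by (rule additive_eqI[of "\<lambda>p. poly (grade p) 1" "\<lambda>p. p"])
     (simp_all add: grade_add grade_single poly_monom)

lemma grade_eq_0_iff: "grade p = 0 \<longleftrightarrow> p = 0"
proof
  show "grade p = 0 \<Longrightarrow> p = 0"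
    using poly_grade_1[of p] by simp
qed (simp add: grade_def)

lemma degree_grade_lin_poly:
  assumes "a \<noteq> 0"
  shows "degree (grade (lin_poly a)) = 1"
proof -
  have "grade (\<Sum>i\<in>K. Poly_Mapping.single (Poly_Mapping.single i 1) (a $ i)) =
        Polynomial.monom (\<Sum>i\<in>K. Poly_Mapping.single (Poly_Mapping.single i 1) (a $ i)) 1"
    if "finite K" for K
    using that
  proof (induction K)
    case empty
    then show ?case by (simp add: grade_def)
  next
    case (insert i K)
    have "(\<Sum>j\<in>UNIV. Poly_Mapping.lookup (Poly_Mapping.single i (1::nat)) j) = 1"
      by (simp add: lookup_single when_def)
    then have "grade (Poly_Mapping.single (Poly_Mapping.single i 1) (a $ i)) =
        Polynomial.monom (Poly_Mapping.single (Poly_Mapping.single i 1) (a $ i)) 1"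
      by (simp only: grade_single)
    then show ?case
      using insert by (simp only: sum.insert grade_add Polynomial.add_monom not_False_eq_True)
  qed
  then have "grade (lin_poly a) = Polynomial.monom (lin_poly a) 1"
    unfolding lin_poly_def by simp
  moreover have "lin_poly a \<noteq> 0"
    using to_F_lin_poly[of a] assms by auto
  ultimately show ?thesis
    by (simp add: degree_monom_eq)
qed

text \<open>The multiplicity of the factor is bounded by the total degree.\<close>

lemma lin_factor_exists:
  assumes a: "a \<noteq> 0" and f: "f \<in> polys" "f \<noteq> 0"
  obtains n s where "s \<in> polys" "\<not> lin_dvd a s" "f = lin a ^ n * s"
proof -
  obtain p where p: "f = to_F p" "p \<noteq> 0"
    using f by (auto simp: polys_def)
  define P where "P n \<longleftrightarrow> (\<exists>s\<in>polys. f = lin a ^ n * s)" for n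
  have "n \<le> degree (grade p)" if Pn: "P n" for n
  proof -
    obtain q where q: "f = lin a ^ n * to_F q"
      using Pn by (auto simp: P_def polys_def)
    have pow: "lin a ^ n = to_F (lin_poly a ^ n)"
      by (induction n) (simp_all add: to_F_mult to_F_lin_poly)
    have "p = lin_poly a ^ n * q"
      using q p unfolding pow by (simp flip: to_F_mult)
    moreover have "grade (lin_poly a ^ n) = grade (lin_poly a) ^ n"
    proof (induction n)
      case 0
      have "grade (Poly_Mapping.single 0 1) = Polynomial.monom (Poly_Mapping.single (0 :: 'a \<Rightarrow>\<^sub>0 nat) 1) 0"
        unfolding grade_single by simp
      then show ?case by simp
    qed (simp add: grade_mult)
    ultimately have "grade p = grade (lin_poly a) ^ n * grade q"
      by (simp add: grade_mult)
    moreover have "grade p \<noteq> 0"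
      using p by (simp add: grade_eq_0_iff)
    ultimately have "degree (grade p) = n * degree (grade (lin_poly a)) + degree (grade q)"
      using degree_grade_lin_poly[OF a] by (cases "grade (lin_poly a) = 0") (simp_all add: degree_mult_eq degree_power_eq)
    then show ?thesis
      using degree_grade_lin_poly[OF a] by simp
  qed
  moreover have "P 0"
    using f by (auto simp: P_def)
  ultimately have max: "P (Greatest P)" "\<And>n. P n \<Longrightarrow> n \<le> Greatest P"
    by (blast intro: GreatestI_nat Greatest_le_nat)+
  then obtain s where s: "s \<in> polys" "f = lin a ^ Greatest P * s"
    by (auto simp: P_def)
  have "\<not> lin_dvd a s"
  proof
    assume "lin_dvd a s"
    then obtain r where "r \<in> polys" "s = lin a * r"
      by (auto simp: lin_dvd_def)
    then have "P (Suc (Greatest P))"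
      using s by (auto simp: P_def mult_ac intro!: bexI[of _ r])
    then show False
      using max(2) by fastforce
  qed
  with s show ?thesis
    by (intro that)
qed

text \<open>The units of the localization at \<open>a\<close>.\<close>

definition lunit :: "('n::{finite,linorder}) cvec \<Rightarrow> 'n ratfun \<Rightarrow> bool" where
  "lunit a u \<longleftrightarrow> (\<exists>f\<in>polys. \<exists>g\<in>polys. \<not> lin_dvd a f \<and> \<not> lin_dvd a g \<and> u = f / g)"

lemma lunit_nonzero: "lunit a u \<Longrightarrow> u \<noteq> 0"
  by (auto simp: lunit_def)

lemma lunit_1: "lunit a 1"
  unfolding lunit_def by (rule bexI[of _ 1], rule bexI[of _ 1]) (simp_all add: not_lin_dvd_1 polys_closed(5))

lemma lunit_inverse: "lunit a u \<Longrightarrow> lunit a (inverse u)"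
  unfolding lunit_def by (metis inverse_divide)

lemma lunit_mult: "a \<noteq> 0 \<Longrightarrow> lunit a u \<Longrightarrow> lunit a v \<Longrightarrow> lunit a (u * v)"
proof -
  assume a: "a \<noteq> 0" and "lunit a u" "lunit a v"
  then obtain f g f' g' where *: "f \<in> polys" "g \<in> polys" "\<not> lin_dvd a f" "\<not> lin_dvd a g" "u = f / g"
    "f' \<in> polys" "g' \<in> polys" "\<not> lin_dvd a f'" "\<not> lin_dvd a g'" "v = f' / g'"
    unfolding lunit_def by blast
  then have "u * v = (f * f') / (g * g')" "f * f' \<in> polys" "g * g' \<in> polys"
      "\<not> lin_dvd a (f * f')" "\<not> lin_dvd a (g * g')"
    using lin_prime[OF a, of f f'] lin_prime[OF a, of g g'] by (auto simp: polys_closed)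
  then show ?thesis
    unfolding lunit_def by blast
qed

lemma lunit_polys: "f \<in> polys \<Longrightarrow> \<not> lin_dvd a f \<Longrightarrow> lunit a f"
  unfolding lunit_def by (rule bexI[of _ f], rule bexI[of _ 1]) (auto simp: not_lin_dvd_1 polys_closed)

lemma lunit_powi_imp_0:
  assumes a: "a \<noteq> 0" and "lunit a (lin a powi n)"
  shows "n = 0"
proof -
  have *: False if k: "lunit a (lin a ^ Suc k)" for k
  proof -
    obtain f g where fg: "f \<in> polys" "g \<in> polys" "\<not> lin_dvd a f" "\<not> lin_dvd a g" "lin a ^ Suc k = f / g"
      using k unfolding lunit_def by blast
    then have "f = lin a * (lin a ^ k * g)"
      by (auto simp: field_simps)
    moreover have "lin a ^ k * g \<in> polys"
      using fg by (simp add: polys_closed)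
    ultimately show False
      using fg(3) unfolding lin_dvd_def by blast
  qed
  show ?thesis
  proof (cases n rule: int_cases3)
    case (pos k)
    then show ?thesis
      using assms *[of "k - 1"] by (simp add: power_int_of_nat)
  next
    case (neg k)
    then have "lunit a (lin a ^ k)"
      using lunit_inverse[OF assms(2)] by (simp add: power_int_minus)
    then show ?thesis
      using neg *[of "k - 1"] by simp
  qed simp
qed

definition vord :: "('n::{finite,linorder}) cvec \<Rightarrow> 'n ratfun \<Rightarrow> int" where
  "vord a f = (THE n. \<exists>u. lunit a u \<and> f = lin a powi n * u)"

lemma vord_eqI:
  assumes a: "a \<noteq> 0" and u: "lunit a u" "f = lin a powi n * u"
  shows "vord a f = n"
  unfolding vord_def
proof (rule the_equality)
  show "\<exists>u. lunit a u \<and> f = lin a powi n * u"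
    using u by blast
  fix m assume "\<exists>v. lunit a v \<and> f = lin a powi m * v"
  then obtain v where v: "lunit a v" "f = lin a powi m * v"
    by blast
  have "lin a powi (m - n) = u * inverse v"
    using u v a lunit_nonzero[OF v(1)] by (simp add: power_int_diff field_simps)
  then have "m - n = 0"
    by (intro lunit_powi_imp_0[OF a]) (simp add: a lunit_mult lunit_inverse u v)
  then show "m = n" by simp
qed

lemma vord_decompose:
  assumes a: "a \<noteq> 0" and f: "f \<noteq> 0"
  obtains u where "lunit a u" "f = lin a powi (vord a f) * u"
proof -
  obtain p q where pq: "p \<in> polys" "q \<in> polys" "q \<noteq> 0" "f = p / q"
    by (rule ratfun_cases)
  moreover have "p \<noteq> 0"
    using f pq by auto
  moreover obtain m r where "r \<in> polys" "\<not> lin_dvd a r" "p = lin a ^ m * r"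
    using lin_factor_exists[OF a \<open>p \<in> polys\<close> \<open>p \<noteq> 0\<close>] .
  moreover obtain n s where "s \<in> polys" "\<not> lin_dvd a s" "q = lin a ^ n * s"
    using lin_factor_exists[OF a \<open>q \<in> polys\<close> \<open>q \<noteq> 0\<close>] .
  ultimately have u: "lunit a (r / s)" "f = lin a powi (int m - int n) * (r / s)"
    using a by (auto simp: lunit_def power_int_diff)
  then have "vord a f = int m - int n"
    by (rule vord_eqI[OF a])
  with u that show ?thesis by simp
qed

lemma vord_mult:
  assumes "a \<noteq> 0" "f \<noteq> 0" "g \<noteq> 0"
  shows "vord a (f * g) = vord a f + vord a g"
proof -
  obtain u where u: "lunit a u" "f = lin a powi (vord a f) * u"
    using vord_decompose assms by metis
  obtain v where v: "lunit a v" "g = lin a powi (vord a g) * v"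
    using vord_decompose assms by metis
  have "f * g = lin a powi (vord a f + vord a g) * (u * v)"
    by (subst u(2), subst v(2)) (use assms in \<open>simp add: power_int_add\<close>)
  then show ?thesis
    using vord_eqI[OF assms(1) lunit_mult[OF assms(1) u(1) v(1)]] by blast
qed

lemma vord_lunit: "a \<noteq> 0 \<Longrightarrow> lunit a u \<Longrightarrow> vord a u = 0"
  by (rule vord_eqI) simp_all

lemma vord_lin_self [simp]: "a \<noteq> 0 \<Longrightarrow> vord a (lin a) = 1"
  by (rule vord_eqI[OF _ lunit_1]) simp_all

lemma vord_1 [simp]: "a \<noteq> 0 \<Longrightarrow> vord a 1 = 0"
  by (rule vord_lunit[OF _ lunit_1])

lemma lunit_cst: "c \<noteq> 0 \<Longrightarrow> lunit a (cst c)"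
proof (rule lunit_polys)
  assume "c \<noteq> 0"
  then have "lin_dvd a 1" if "lin_dvd a (cst c)"
    using lin_dvd_mult[OF that, of "cst (inverse c)"] by (simp add: polys_closed flip: cst_mult)
  then show "\<not> lin_dvd a (cst c)"
    using not_lin_dvd_1 by blast
qed (rule polys_closed)

lemma vord_cst [simp]: "a \<noteq> 0 \<Longrightarrow> c \<noteq> 0 \<Longrightarrow> vord a (cst c) = 0"
  by (simp add: vord_lunit lunit_cst)

lemma vord_inverse: "a \<noteq> 0 \<Longrightarrow> f \<noteq> 0 \<Longrightarrow> vord a (inverse f) = - vord a f"
  using vord_mult[of a f "inverse f"] by simp

lemma vord_divide: "a \<noteq> 0 \<Longrightarrow> f \<noteq> 0 \<Longrightarrow> g \<noteq> 0 \<Longrightarrow> vord a (f / g) = vord a f - vord a g"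
  by (simp add: divide_inverse vord_mult vord_inverse)

lemma vord_prod:
  "a \<noteq> 0 \<Longrightarrow> (\<And>i. i \<in> K \<Longrightarrow> f i \<noteq> 0) \<Longrightarrow> vord a (prod f K) = (\<Sum>i\<in>K. vord a (f i))"
  by (induction K rule: infinite_finite_induct) (simp_all add: vord_mult)

lemma vord_power: "a \<noteq> 0 \<Longrightarrow> f \<noteq> 0 \<Longrightarrow> vord a (f ^ n) = int n * vord a f"
  by (induction n) (simp_all add: vord_mult algebra_simps)

lemma vord_powi: "a \<noteq> 0 \<Longrightarrow> f \<noteq> 0 \<Longrightarrow> vord a (f powi n) = n * vord a f"
proof -
  assume *: "a \<noteq> 0" "f \<noteq> 0"
  show ?thesis
  proof (cases "n \<ge> 0")
    case True
    then show ?thesis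
      using vord_power[OF *, of "nat n"] by (simp add: power_int_def)
  next
    case False
    then show ?thesis
      using vord_power[OF *, of "nat (- n)"] *
      by (simp add: power_int_def power_inverse vord_inverse)
  qed
qed

lemma vord_lin_not_proportional:
  assumes "a \<noteq> 0" "\<nexists>c. b = c *s a"
  shows "vord a (lin b) = 0"
  using assms by (intro vord_lunit lunit_polys) (auto simp: lin_dvd_lin_iff)

text \<open>
  The fractional ideal \<open>a\<^sup>n S\<^sub>\<langle>\<^sub>a\<^sub>\<rangle>\<close>, described by orders so that statements about poles and zeros
  become linear inequalities.
\<close>

definition vge :: "('n::{finite,linorder}) cvec \<Rightarrow> int \<Rightarrow> 'n ratfun set" where
  "vge a n = {f. f = 0 \<or> n \<le> vord a f}"

lemma subalgebra_localization:
  assumes "a \<noteq> 0"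
  shows "subalgebra (localization a)"
  unfolding subalgebra_def
proof (intro conjI allI ballI)
  have loc: "localization a = {f / g | f g. f \<in> polys \<and> g \<in> polys \<and> \<not> lin_dvd a g}"
    unfolding localization_def lin_dvd_def ..
  show "cst c \<in> localization a" for c
  proof -
    have "cst c = cst c / 1" by simp
    then show ?thesis
      unfolding loc using not_lin_dvd_1[of a] polys_closed(5) polys_closed(1)[of c] by blast
  qed
  fix f g assume "f \<in> localization a" "g \<in> localization a"
  then obtain p q r s where *: "p \<in> polys" "q \<in> polys" "\<not> lin_dvd a q" "f = p / q"
    "r \<in> polys" "s \<in> polys" "\<not> lin_dvd a s" "g = r / s"
    unfolding loc by auto
  then have nz: "q \<noteq> 0" "s \<noteq> 0" "\<not> lin_dvd a (q * s)"
    using lin_prime[OF assms, of q s] by auto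
  have "f + g = (p * s + r * q) / (q * s)" "f * g = (p * r) / (q * s)"
    using * nz by (simp_all add: field_simps)
  moreover have "p * s + r * q \<in> polys" "q * s \<in> polys" "p * r \<in> polys"
    using * by (simp_all add: polys_closed)
  ultimately show "f + g \<in> localization a" "f * g \<in> localization a"
    unfolding loc using nz by blast+
qed

lemma localization_eq_vge:
  assumes "a \<noteq> 0"
  shows "localization a = vge a 0"
proof (intro Set.set_eqI iffI)
  fix f assume "f \<in> localization a"
  then obtain p q where pq: "p \<in> polys" "q \<in> polys" "\<not> lin_dvd a q" "f = p / q"
    unfolding localization_def lin_dvd_def by blast
  show "f \<in> vge a 0"
  proof (cases "f = 0")
    case False
    then have "p \<noteq> 0" "q \<noteq> 0"
      using pq by auto
    obtain m r where r: "r \<in> polys" "\<not> lin_dvd a r" "p = lin a ^ m * r"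
      using lin_factor_exists[OF assms \<open>p \<in> polys\<close> \<open>p \<noteq> 0\<close>] .
    have "vord a f = int m"
      by (rule vord_eqI[OF assms, of "r / q"])
        (use r pq in \<open>auto simp: lunit_def\<close>)
    then show ?thesis by (simp add: vge_def)
  qed (simp add: vge_def)
next
  fix f assume f: "f \<in> vge a 0"
  show "f \<in> localization a"
  proof (cases "f = 0")
    case True
    then show ?thesis using subalgebra_0[OF subalgebra_localization[OF assms]] by simp
  next
    case False
    then obtain u where u: "lunit a u" "f = lin a powi (vord a f) * u"
      using vord_decompose[OF assms] by metis
    then obtain p q where pq: "p \<in> polys" "q \<in> polys" "\<not> lin_dvd a q" "u = p / q"
      by (auto simp: lunit_def)
    have "0 \<le> vord a f"
      using f False by (simp add: vge_def)
    then have "f = (lin a ^ nat (vord a f) * p) / q"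
      by (subst u(2)) (simp add: pq power_int_def)
    moreover have "lin a ^ nat (vord a f) * p \<in> polys"
      using pq by (simp add: polys_closed)
    ultimately show ?thesis
      unfolding localization_def using pq unfolding lin_dvd_def by blast
  qed
qed

lemma powi_localization_eq_vge:
  assumes "a \<noteq> 0"
  shows "{lin a powi n * f | f. f \<in> localization a} = vge a n"
proof (intro Set.set_eqI iffI)
  fix f assume "f \<in> {lin a powi n * f | f. f \<in> localization a}"
  then obtain g where g: "f = lin a powi n * g" "g \<in> vge a 0"
    by (auto simp: localization_eq_vge[OF assms])
  then show "f \<in> vge a n"
    using assms by (cases "g = 0") (auto simp: vge_def vord_mult vord_powi)
next
  fix f assume f: "f \<in> vge a n"
  have "f = lin a powi n * (lin a powi (- n) * f)"
    using assms by (simp add: power_int_minus)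
  moreover have "lin a powi (- n) * f \<in> vge a 0"
    using f assms by (cases "f = 0") (auto simp: vge_def vord_mult vord_powi)
  ultimately show "f \<in> {lin a powi n * f | f. f \<in> localization a}"
    unfolding localization_eq_vge[OF assms] by blast
qed

lemma vge_0 [simp]: "0 \<in> vge a n"
  by (simp add: vge_def)

lemma vge_mono: "f \<in> vge a n \<Longrightarrow> m \<le> n \<Longrightarrow> f \<in> vge a m"
  by (auto simp: vge_def)

lemma vge_mult: "a \<noteq> 0 \<Longrightarrow> f \<in> vge a m \<Longrightarrow> g \<in> vge a n \<Longrightarrow> f * g \<in> vge a (m + n)"
  by (cases "f = 0"; cases "g = 0") (auto simp: vge_def vord_mult)

lemma vge_mult0: "a \<noteq> 0 \<Longrightarrow> f \<in> vge a 0 \<Longrightarrow> g \<in> vge a n \<Longrightarrow> f * g \<in> vge a n"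
  using vge_mult[of a f 0 g n] by simp

lemma vge_add:
  assumes a: "a \<noteq> 0" and "f \<in> vge a n" "g \<in> vge a n"
  shows "f + g \<in> vge a n"
proof -
  obtain f' g' where "f = lin a powi n * f'" "f' \<in> localization a" "g = lin a powi n * g'" "g' \<in> localization a"
    using assms unfolding powi_localization_eq_vge[OF a, symmetric] by auto
  moreover from this have "f' + g' \<in> localization a"
    by (intro subalgebra_add[OF subalgebra_localization[OF a]])
  ultimately show ?thesis
    unfolding powi_localization_eq_vge[OF a, symmetric] by (auto simp flip: distrib_left)
qed

lemma vge_polys: "a \<noteq> 0 \<Longrightarrow> f \<in> polys \<Longrightarrow> f \<in> vge a 0"
proof -
  assume "a \<noteq> 0" "f \<in> polys"
  moreover have "f = f / 1" by simp
  ultimately have "f \<in> localization a"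
    unfolding localization_def using not_lin_dvd_1[of a, unfolded lin_dvd_def] polys_closed(5) by blast
  then show ?thesis
    using localization_eq_vge \<open>a \<noteq> 0\<close> by blast
qed

lemma vge_cst: "a \<noteq> 0 \<Longrightarrow> cst c \<in> vge a 0"
  by (simp add: vge_polys polys_closed)

lemma vge_scale: "a \<noteq> 0 \<Longrightarrow> f \<in> vge a n \<Longrightarrow> cst c * f \<in> vge a n"
  by (simp add: vge_mult0 vge_cst)

lemma vge_uminus: "a \<noteq> 0 \<Longrightarrow> f \<in> vge a n \<Longrightarrow> - f \<in> vge a n"
  using vge_scale[of a f n "-1"] by (simp add: cst_minus)

lemma vge_diff: "a \<noteq> 0 \<Longrightarrow> f \<in> vge a n \<Longrightarrow> g \<in> vge a n \<Longrightarrow> f - g \<in> vge a n"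
  using vge_add[of a f n "- g"] by (simp add: vge_uminus)

lemma vge_sum: "a \<noteq> 0 \<Longrightarrow> (\<And>i. i \<in> K \<Longrightarrow> f i \<in> vge a n) \<Longrightarrow> sum f K \<in> vge a n"
  by (induction K rule: infinite_finite_induct) (auto intro: vge_add)

lemma subalgebra_vge_0: "a \<noteq> 0 \<Longrightarrow> subalgebra (vge a 0)"
  using subalgebra_localization[of a] by (simp add: localization_eq_vge)

lemma vge_vord: "f \<in> vge a (vord a f)"
  by (simp add: vge_def)

lemma vord_add_eq:
  assumes a: "a \<noteq> 0" and f: "f \<noteq> 0" and g: "g \<in> vge a (vord a f + 1)"
  shows "f + g \<noteq> 0" "vord a (f + g) = vord a f"
proof -
  have no: "f \<notin> vge a (vord a f + 1)"
    using f by (simp add: vge_def)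
  have **: "f + g \<notin> vge a (vord a f + 1)"
  proof
    assume "f + g \<in> vge a (vord a f + 1)"
    from vge_diff[OF a this g] no show False by simp
  qed
  then show nz: "f + g \<noteq> 0"
    by (auto simp: vge_def)
  have "f + g \<in> vge a (vord a f)"
    using g by (intro vge_add a vge_vord) (auto elim: vge_mono)
  with ** nz show "vord a (f + g) = vord a f"
    by (auto simp: vge_def)
qed

text \<open>
  Polynomials are recovered from their localizations one linear factor at a time, for which the
  primality of linear forms suffices.
\<close>

lemma polys_cancel_lin:
  assumes a: "a \<noteq> 0" and f: "f \<in> vge a 0" "lin a * f \<in> polys"
  shows "f \<in> polys"
proof -
  obtain p q where pq: "p \<in> polys" "q \<in> polys" "\<not> lin_dvd a q" "f = p / q"
    using f(1) unfolding localization_eq_vge[OF a, symmetric] localization_def lin_dvd_def by blast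
  then have "(lin a * f) * q = lin a * p"
    by auto
  then have "lin_dvd a ((lin a * f) * q)"
    using pq by (auto simp: lin_dvd_def)
  then have "lin_dvd a (lin a * f)"
    using lin_prime[OF a f(2) pq(2)] pq(3) by blast
  then show ?thesis
    using a by (auto simp: lin_dvd_def)
qed

text \<open>By the quotient rule, the poles of a derivation on the coordinates bound those on the whole local ring.\<close>

lemma deriv_localization:
  assumes a: "a \<noteq> 0" and d: "is_deriv \<delta>" and m: "\<And>i. \<delta> (var i) \<in> vge a m" and f: "f \<in> vge a 0"
  shows "\<delta> f \<in> vge a m"
proof -
  let ?A = "{f \<in> vge a 0. \<delta> f \<in> vge a m}"
  have "subalgebra ?A"
    unfolding subalgebra_def
  proof (intro conjI allI ballI)
    show "cst c \<in> ?A" for c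
      by (simp add: deriv_cst[OF d] vge_cst[OF a])
    fix f g assume fg: "f \<in> ?A" "g \<in> ?A"
    then show "f + g \<in> ?A"
      by (simp add: deriv_add[OF d] vge_add[OF a])
    have "g * \<delta> f + f * \<delta> g \<in> vge a m"
      using fg by (intro vge_add[OF a] vge_mult0[OF a]) auto
    then show "f * g \<in> ?A"
      using fg by (simp add: deriv_mult[OF d] vge_mult0[OF a] mult.commute)
  qed
  then have sub: "polys \<subseteq> ?A"
    by (rule polys_least) (auto simp: m vge_polys[OF a])
  obtain p q where pq: "p \<in> polys" "q \<in> polys" "\<not> lin_dvd a q" "f = p / q"
    using f unfolding localization_eq_vge[OF a, symmetric] localization_def lin_dvd_def by blast
  have q: "q \<noteq> 0" "vord a q = 0"
    using pq by (auto intro: vord_lunit[OF a] lunit_polys)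
  then have inv: "inverse (q * q) \<in> vge a 0"
    by (simp add: vge_def vord_mult vord_inverse a)
  have "\<delta> f = inverse (q * q) * (q * \<delta> p - p * \<delta> q)"
    unfolding pq(4) deriv_divide[OF d q(1)] by (simp add: field_simps)
  also have "\<dots> \<in> vge a m"
    using sub pq inv by (intro vge_mult0[OF a inv] vge_diff[OF a] vge_mult0[OF a]) auto
  finally show ?thesis .
qed

section \<open>The action of a linear group on rational functions and derivations\<close>

definition is_hom :: "(('n::{finite,linorder}) ratfun \<Rightarrow> 'n ratfun) \<Rightarrow> bool" where
  "is_hom \<phi> \<longleftrightarrow> (\<forall>f g. \<phi> (f + g) = \<phi> f + \<phi> g) \<and> (\<forall>f g. \<phi> (f * g) = \<phi> f * \<phi> g) \<and> (\<forall>c. \<phi> (cst c) = cst c)"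

context
  fixes \<phi> :: "('n::{finite,linorder}) ratfun \<Rightarrow> 'n ratfun"
  assumes \<phi>: "is_hom \<phi>"
begin

lemma hom_add: "\<phi> (f + g) = \<phi> f + \<phi> g"
  and hom_mult: "\<phi> (f * g) = \<phi> f * \<phi> g"
  and hom_cst: "\<phi> (cst c) = cst c"
  using \<phi> by (auto simp: is_hom_def)

lemma hom_0: "\<phi> 0 = 0"
  using hom_cst[of 0] by simp

lemma hom_1: "\<phi> 1 = 1"
  using hom_cst[of 1] by simp

lemma hom_eq_0_iff: "\<phi> f = 0 \<longleftrightarrow> f = 0"
proof
  assume 0: "\<phi> f = 0"
  show "f = 0"
  proof (rule ccontr)
    assume "f \<noteq> 0"
    then have "\<phi> f * \<phi> (inverse f) = 1"
      by (simp add: hom_1 flip: hom_mult)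
    then show False
      by (simp add: 0)
  qed
qed (simp add: hom_0)

lemma hom_uminus: "\<phi> (- f) = - \<phi> f"
  using hom_add[of f "- f"] by (simp add: hom_0 eq_neg_iff_add_eq_0 add.commute)

lemma hom_sum: "\<phi> (sum f K) = (\<Sum>i\<in>K. \<phi> (f i))"
  by (induction K rule: infinite_finite_induct) (simp_all add: hom_0 hom_add)

lemma hom_inverse: "\<phi> (inverse f) = inverse (\<phi> f)"
proof (cases "f = 0")
  case False
  then have "\<phi> f * \<phi> (inverse f) = 1"
    by (simp add: hom_1 flip: hom_mult)
  then show ?thesis
    by (simp add: inverse_unique)
qed (simp add: hom_0)

lemma hom_divide: "\<phi> (f / g) = \<phi> f / \<phi> g"
  by (simp add: divide_inverse hom_mult hom_inverse)

lemma hom_power: "\<phi> (f ^ n) = \<phi> f ^ n"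
  by (induction n) (simp_all add: hom_1 hom_mult)

lemma hom_powi: "\<phi> (f powi n) = \<phi> f powi n"
  by (simp add: power_int_def hom_power hom_inverse)

end

lemma is_hom_unique:
  assumes "is_hom \<phi>" "is_hom \<psi>" "\<And>i. \<phi> (var i) = \<psi> (var i)"
  shows "\<phi> f = \<psi> f"
proof -
  have "subalgebra {f. \<phi> f = \<psi> f}"
    using assms(1,2) by (auto simp: subalgebra_def is_hom_def)
  then have sub: "polys \<subseteq> {f. \<phi> f = \<psi> f}"
    by (rule polys_least) (simp add: assms(3))
  obtain p q where "p \<in> polys" "q \<in> polys" "q \<noteq> 0" "f = p / q"
    by (rule ratfun_cases)
  then show ?thesis
    using sub by (auto simp: hom_divide[OF assms(1)] hom_divide[OF assms(2)] subset_iff)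
qed

text \<open>The action on linear forms: \<open>(w a)(v) = a (w\<inverse> v)\<close>.\<close>

definition dact :: "('n::finite) cmat \<Rightarrow> 'n cvec \<Rightarrow> 'n cvec" where
  "dact w a = (\<chi> j. \<Sum>i\<in>UNIV. a $ i * matrix_inv w $ i $ j)"

lemma matrix_inv_right: "invertible w \<Longrightarrow> w ** matrix_inv w = mat 1"
  and matrix_inv_left: "invertible w \<Longrightarrow> matrix_inv w ** w = mat 1"
  unfolding invertible_def matrix_inv_def by (metis (mono_tags, lifting) someI_ex)+

lemma matrix_inv_unique:
  fixes w :: "('n::finite) cmat"
  assumes "w ** v = mat 1"
  shows "matrix_inv w = v"
proof -
  have w: "invertible w"
    using assms invertible_right_inverse by blast
  have "matrix_inv w ** (w ** v) = v"
    by (simp add: matrix_mul_assoc matrix_inv_left[OF w])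
  then show ?thesis
    by (simp add: assms)
qed

lemma invertible_matrix_inv: "invertible w \<Longrightarrow> invertible (matrix_inv w)"
  unfolding invertible_def using matrix_inv_left matrix_inv_right invertible_def by metis

lemma matrix_inv_matrix_inv:
  fixes w :: "('n::finite) cmat"
  shows "invertible w \<Longrightarrow> matrix_inv (matrix_inv w) = w"
  by (rule matrix_inv_unique) (rule matrix_inv_left)

lemma matrix_inv_mult:
  fixes w v :: "('n::finite) cmat"
  assumes "invertible w" "invertible v"
  shows "matrix_inv (w ** v) = matrix_inv v ** matrix_inv w"
proof (rule matrix_inv_unique)
  have "w ** v ** (matrix_inv v ** matrix_inv w) = w ** (v ** matrix_inv v) ** matrix_inv w"
    by (simp add: matrix_mul_assoc)
  then show "w ** v ** (matrix_inv v ** matrix_inv w) = mat 1"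
    by (simp add: matrix_inv_right assms)
qed

lemma form_app_dact: "form_app (dact w a) v = form_app a (matrix_inv w *v v)"
  unfolding form_app_def dact_def matrix_vector_mult_def
  by (simp add: sum_distrib_left sum_distrib_right mult.assoc) (rule sum.swap)

lemma form_app_eqI: "(\<And>v. form_app a v = form_app b v) \<Longrightarrow> a = b"
proof -
  assume *: "\<And>v. form_app a v = form_app b v"
  have "form_app c (axis i 1) = c $ i" for c :: "'a cvec" and i
    by (simp add: form_app_def axis_def if_distrib[where f = "\<lambda>x. _ * x"] cong: if_cong)
  then show "a = b"
    using *[of "axis _ 1"] by (simp add: vec_eq_iff)
qed

lemma form_app_add: "form_app (a + b) v = form_app a v + form_app b v"
  by (simp add: form_app_def algebra_simps sum.distrib)

lemma form_app_scale: "form_app (c *s a) v = c * form_app a v"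
  by (simp add: form_app_def sum_distrib_left mult.assoc)

lemma form_app_diff: "form_app (a - b) v = form_app a v - form_app b v"
  by (simp add: form_app_def algebra_simps sum_subtractf)

lemma form_app_scale_right: "form_app a (c *s v) = c * form_app a v"
  by (simp add: form_app_def sum_distrib_left mult_ac)

lemma form_app_diff_right: "form_app a (v - w) = form_app a v - form_app a w"
  by (simp add: form_app_def algebra_simps sum_subtractf)

lemma form_app_0 [simp]: "form_app 0 v = 0" "form_app a 0 = 0"
  by (simp_all add: form_app_def)

lemma dact_add: "dact w (a + b) = dact w a + dact w b"
  by (simp add: dact_def vec_eq_iff algebra_simps sum.distrib)

lemma dact_scale: "dact w (c *s a) = c *s dact w a"
  by (simp add: dact_def vec_eq_iff sum_distrib_left mult.assoc)

lemma dact_diff: "dact w (a - b) = dact w a - dact w b"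
  by (simp add: dact_def vec_eq_iff algebra_simps sum_subtractf)

lemma dact_0 [simp]: "dact w 0 = 0"
  by (simp add: dact_def vec_eq_iff)

lemma dact_dact:
  "invertible w \<Longrightarrow> invertible v \<Longrightarrow> dact w (dact v a) = dact (w ** v) a"
  by (rule form_app_eqI) (simp add: form_app_dact matrix_inv_mult matrix_vector_mul_assoc)

lemma matrix_inv_mat_1 [simp]: "matrix_inv (mat 1 :: ('n::finite) cmat) = mat 1"
  by (rule matrix_inv_unique) simp

lemma invertible_mat_1 [simp]: "invertible (mat 1 :: ('n::finite) cmat)"
  unfolding invertible_def by (rule exI[of _ "mat 1"]) simp

lemma dact_mat_1 [simp]: "dact (mat 1) a = a"
  by (rule form_app_eqI) (simp add: form_app_dact)

lemma dact_eq_self_imp: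
  assumes "invertible w" "\<And>a. dact w a = a"
  shows "w = mat 1"
proof -
  have "matrix_inv w *v v = v" for v
  proof -
    have "form_app a (matrix_inv w *v v) = form_app a v" for a
      using assms(2)[of a] form_app_dact[of w a v] by simp
    then have "form_app (axis i 1) (matrix_inv w *v v) = form_app (axis i 1) v" for i
      by blast
    then show ?thesis
      by (simp add: form_app_def axis_def vec_eq_iff if_distribR cong: if_cong)
         (simp add: if_distrib[where f = "\<lambda>x. x * _"] cong: if_cong)
  qed
  then have "matrix_inv w = mat 1"
    by (simp add: matrix_eq)
  then show ?thesis
    using matrix_inv_matrix_inv[OF assms(1)] by simp
qed

lemma lin_sum_rows: "(\<Sum>i\<in>UNIV. cst (a $ i) * lin (B $ i)) = lin (\<chi> j. \<Sum>i\<in>UNIV. a $ i * B $ i $ j)"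
proof -
  have "(\<Sum>i\<in>K. cst (a $ i) * lin (B $ i)) = lin (\<Sum>i\<in>K. a $ i *s B $ i)" if "finite K" for K
    using that by (induction K) (simp_all add: lin_add lin_scale)
  from this[of UNIV] have "(\<Sum>i\<in>UNIV. cst (a $ i) * lin (B $ i)) = lin (\<Sum>i\<in>UNIV. a $ i *s B $ i)"
    by simp
  also have "(\<Sum>i\<in>UNIV. a $ i *s B $ i) = (\<chi> j. \<Sum>i\<in>UNIV. a $ i * B $ i $ j)"
    by (simp add: vec_eq_iff)
  finally show ?thesis .
qed

text \<open>
  Substituting rows of \<open>A\<close> and then rows of \<open>B\<close> amounts to substituting the rows of \<open>A B\<close>; for
  mutually inverse matrices the first substitution is therefore injective.
\<close>

lemma eval_poly_lin_comp:
  fixes A B :: "('n::{finite,linorder}) cmat"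
  shows "\<exists>q. eval_poly (\<lambda>i. lin (A $ i)) p = to_F q \<and>
    eval_poly (\<lambda>i. lin (B $ i)) q = eval_poly (\<lambda>i. lin ((A ** B) $ i)) p"
proof (induction p rule: mpoly_induct)
  case (const c)
  show ?case
    by (rule exI[of _ "Poly_Mapping.single 0 c"]) (simp add: cst_def)
next
  case (variable i)
  have "(\<chi> j. \<Sum>k\<in>UNIV. A $ i $ k * B $ k $ j) = (A ** B) $ i"
    by (simp add: vec_eq_iff matrix_matrix_mult_def)
  then show ?case
    by (intro exI[of _ "lin_poly (A $ i)"])
      (simp only: eval_poly_variable to_F_lin_poly eval_lin_poly lin_sum_rows simp_thms)
next
  case (add p q)
  then show ?case
    by (metis eval_poly_add to_F_add)
next
  case (mult p q)
  then show ?case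
    by (metis eval_poly_mult to_F_mult)
qed

lemma alg_indep_linear_substitution:
  fixes A :: "('n::{finite,linorder}) cmat"
  assumes "A ** B = mat 1"
  shows "alg_indep (\<lambda>i. lin (A $ i)) UNIV"
  unfolding alg_indep_def
proof (intro allI impI)
  fix p assume p: "poly_vars p \<subseteq> UNIV \<and> eval_poly (\<lambda>i. lin (A $ i)) p = 0"
  obtain q where q: "eval_poly (\<lambda>i. lin (A $ i)) p = to_F q"
    "eval_poly (\<lambda>i. lin (B $ i)) q = eval_poly (\<lambda>i. lin ((A ** B) $ i)) p"
    using eval_poly_lin_comp by blast
  have "(\<lambda>i. lin ((A ** B) $ i)) = var"
  proof
    fix i
    have "(mat 1 :: 'n cmat) $ i = axis i 1"
      by (auto simp: vec_eq_iff mat_def axis_def)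
    then show "lin ((A ** B) $ i) = var i"
      by (simp add: assms)
  qed
  then have "to_F p = eval_poly (\<lambda>i. lin (B $ i)) q"
    by (simp add: q(2) to_F_eq_eval_poly)
  moreover have "q = 0"
    using p q(1) by simp
  ultimately have "to_F p = 0"
    by (simp add: eval_poly_def)
  then show "p = 0"
    by simp
qed

lemma act_quotient:
  assumes "invertible w" "q \<noteq> 0"
  shows "act w (to_F p / to_F q) =
    eval_poly (\<lambda>i. lin (matrix_inv w $ i)) p / eval_poly (\<lambda>i. lin (matrix_inv w $ i)) q"
  unfolding act_def Fract_eq_quotient[symmetric]
  by (rule eval_rat_Fract[OF alg_indep_linear_substitution assms(2)]) (rule matrix_inv_left[OF assms(1)])

lemma act_to_F: "invertible w \<Longrightarrow> act w (to_F p) = eval_poly (\<lambda>i. lin (matrix_inv w $ i)) p"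
  using act_quotient[of w 1 p] eval_poly_const[of "\<lambda>i. lin (matrix_inv w $ i)" 1] by simp

lemma is_hom_act:
  assumes w: "invertible w"
  shows "is_hom (act w)"
  unfolding is_hom_def
proof (intro conjI allI)
  let ?e = "eval_poly (\<lambda>i. lin (matrix_inv w $ i))"
  have e: "?e p \<noteq> 0" if "p \<noteq> 0" for p
    using alg_indep_linear_substitution[OF matrix_inv_left[OF w]] that by (auto simp: alg_indep_def)
  fix f g :: "'a ratfun"
  obtain a b where f: "f = to_F a / to_F b" "b \<noteq> 0"
    by (cases f) (auto simp: Fract_eq_quotient)
  obtain c d where g: "g = to_F c / to_F d" "d \<noteq> 0"
    by (cases g) (auto simp: Fract_eq_quotient)
  have bd: "b * d \<noteq> 0"
    using f g by simp
  have sum: "f + g = to_F (a * d + c * b) / to_F (b * d)"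
    using f g by (simp add: to_F_add to_F_mult add_frac_eq)
  show "act w (f + g) = act w f + act w g"
    unfolding sum act_quotient[OF w bd] unfolding f(1) g(1) act_quotient[OF w f(2)] act_quotient[OF w g(2)]
    using e[OF f(2)] e[OF g(2)] by (simp add: eval_poly_add eval_poly_mult add_frac_eq)
  have prod: "f * g = to_F (a * c) / to_F (b * d)"
    by (simp add: f g to_F_mult)
  show "act w (f * g) = act w f * act w g"
    unfolding prod act_quotient[OF w bd] unfolding f(1) g(1) act_quotient[OF w f(2)] act_quotient[OF w g(2)]
    by (simp add: eval_poly_mult)
next
  show "act w (cst c) = cst c" for c
    unfolding cst_def act_to_F[OF w] by (simp add: cst_def)
qed

lemma act_lin:
  assumes w: "invertible w"
  shows "act w (lin a) = lin (dact w a)"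
  unfolding dact_def lin_sum_rows[symmetric] to_F_lin_poly[symmetric, of a] act_to_F[OF w] eval_lin_poly ..

lemma act_act:
  assumes "invertible w" "invertible v"
  shows "act w (act v f) = act (w ** v) f"
proof (rule is_hom_unique[of "\<lambda>f. act w (act v f)"])
  show "is_hom (\<lambda>f. act w (act v f))"
    using is_hom_act[OF assms(1)] is_hom_act[OF assms(2)] by (simp add: is_hom_def)
  show "is_hom (act (w ** v))"
    by (rule is_hom_act[OF invertible_mult[OF assms]])
  show "act w (act v (var i)) = act (w ** v) (var i)" for i
    unfolding lin_axis[symmetric] using assms by (simp only: act_lin dact_dact invertible_mult)
qed

lemma act_mat_1 [simp]: "act (mat 1) f = f"
proof (rule is_hom_unique[OF is_hom_act])
  show "act (mat 1) (var i) = var i" for i :: 'a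
    unfolding lin_axis[symmetric] by (simp only: act_lin invertible_mat_1 dact_mat_1)
qed (simp_all add: is_hom_def)

lemma act_act_inv [simp]:
  assumes "invertible w"
  shows "act w (act (matrix_inv w) f) = f" "act (matrix_inv w) (act w f) = f"
  using assms by (simp_all add: act_act invertible_matrix_inv matrix_inv_left matrix_inv_right)

lemma act_polys:
  assumes w: "invertible w" and f: "f \<in> polys"
  shows "act w f \<in> polys"
proof -
  have "subalgebra {f. act w f \<in> polys}"
    by (auto simp: subalgebra_def hom_add[OF is_hom_act[OF w]] hom_mult[OF is_hom_act[OF w]]
        hom_cst[OF is_hom_act[OF w]] polys_closed)
  then have "polys \<subseteq> {f. act w f \<in> polys}"
    by (rule polys_least) (metis act_lin[OF w] lin_axis mem_Collect_eq polys_lin)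
  then show ?thesis
    using f by blast
qed

lemma der_app_act_der:
  assumes w: "invertible w"
  shows "der_app (act_der w \<theta>) f = act w (der_app \<theta> (act (matrix_inv w) f))"
proof -
  note h = is_hom_act[OF w] is_hom_act[OF invertible_matrix_inv[OF w]]
  have "is_deriv (\<lambda>f. act w (der_app \<theta> (act (matrix_inv w) f)))"
    unfolding is_deriv_def hom_add[OF h(2)] der_app_add hom_add[OF h(1)]
      hom_mult[OF h(2)] der_app_mult hom_mult[OF h(1)] act_act_inv[OF w]
      hom_cst[OF h(2)] der_app_cst hom_0[OF h(1)] by simp
  from is_deriv_eq_der_app[OF this, of f] show ?thesis
    unfolding act_der_def by (rule sym)
qed

lemma act_der_eq_iff:
  assumes w: "invertible w"
  shows "act_der w \<theta> = \<theta> \<longleftrightarrow> (\<forall>f. act w (der_app \<theta> f) = der_app \<theta> (act w f))"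
proof
  assume "act_der w \<theta> = \<theta>"
  then show "\<forall>f. act w (der_app \<theta> f) = der_app \<theta> (act w f)"
    using der_app_act_der[OF w, of \<theta>] by (metis act_act_inv(2)[OF w])
next
  assume *: "\<forall>f. act w (der_app \<theta> f) = der_app \<theta> (act w f)"
  show "act_der w \<theta> = \<theta>"
    by (rule derivation_eqI) (simp add: der_app_act_der[OF w] * w)
qed

lemma act_der_eqI:
  assumes w: "invertible w"
    and "\<And>a. act w (der_app \<theta> (lin a)) = der_app \<theta> (lin (dact w a))"
  shows "act_der w \<theta> = \<theta>"
proof (rule derivation_eqI)
  fix a
  have "der_app (act_der w \<theta>) (lin a) = act w (der_app \<theta> (lin (dact (matrix_inv w) a)))"
    by (simp add: der_app_act_der[OF w] act_lin invertible_matrix_inv w)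
  also have "\<dots> = der_app \<theta> (lin a)"
    by (simp add: assms dact_dact invertible_matrix_inv w matrix_inv_right)
  finally show "der_app (act_der w \<theta>) (lin a) = der_app \<theta> (lin a)" .
qed

section \<open>Geometry of the reflections\<close>

definition stab :: "('n::finite) cmat set \<Rightarrow> 'n cvec set \<Rightarrow> 'n cmat set" where
  "stab W H = {w \<in> W. \<forall>v\<in>H. w *v v = v}"

lemma linear_functional_eq_form_app:
  fixes f :: "('n::finite) cvec \<Rightarrow> complex"
  assumes add: "\<And>u v. f (u + v) = f u + f v" and scale: "\<And>c u. f (c *s u) = c * f u"
  shows "f u = form_app (\<chi> j. f (axis j 1)) u"
proof -
  have z: "f 0 = 0"
    using add[of 0 0] by simp
  have "f (\<Sum>j\<in>K. u $ j *s axis j 1) = (\<Sum>j\<in>K. f (axis j 1) * u $ j)" if "finite K" for K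
    using that by (induction K) (simp_all add: z add scale mult.commute)
  from this[of UNIV] show ?thesis
    by (simp add: basis_expansion form_app_def)
qed

locale reflection_setting =
  fixes W :: "('n::{finite,linorder}) cmat set"
    and I :: "'n cvec \<Rightarrow> 'n cvec \<Rightarrow> complex"
    and \<alpha> :: "'n cvec set \<Rightarrow> 'n cvec"
  assumes irreducible: "irreducible_reflection_group W"
    and well_generated: "well_generated W"
    and inner: "invariant_inner W I"
    and normal: "normal_forms W I \<alpha>"
begin

abbreviation "\<A> \<equiv> arrangement W"
abbreviation "stabilizer \<equiv> stab W"

lemma W_subgroup: "subgroup W GL"
  and finite_W [simp]: "finite W"
  and W_irreducible: "irreducible_group W"
  and W_generated: "generate GL (reflections W) = W"
  using irreducible by (auto simp: irreducible_reflection_group_def)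

lemma W_invertible [simp]: "w \<in> W \<Longrightarrow> invertible w"
  using subgroup.subset[OF W_subgroup] by (auto simp: GL_def)

lemma W_mult [simp]: "v \<in> W \<Longrightarrow> w \<in> W \<Longrightarrow> v ** w \<in> W"
  using subgroup.m_closed[OF W_subgroup] by (simp add: GL_def)

lemma W_one [simp]: "mat 1 \<in> W"
  using subgroup.one_closed[OF W_subgroup] by (simp add: GL_def)

lemma inv_GL: "invertible w \<Longrightarrow> inv\<^bsub>GL\<^esub> w = matrix_inv (w :: 'n cmat)"
  unfolding m_inv_def
  by (rule the_equality)
    (auto simp: GL_def invertible_matrix_inv matrix_inv_left matrix_inv_right dest: matrix_inv_unique)

lemma W_inv [simp]: "w \<in> W \<Longrightarrow> matrix_inv w \<in> W"
  using subgroup.m_inv_closed[OF W_subgroup] by (metis inv_GL W_invertible)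

lemma reflections_nonempty: "reflections W \<noteq> {}"
proof -
  obtain X where "X \<subseteq> reflections W" "card X = CARD('n)"
    using well_generated by (auto simp: well_generated_def)
  then show ?thesis
    by (metis card.empty subset_empty zero_less_card_finite less_irrefl)
qed

lemma finite_arrangement [simp]: "finite \<A>"
  by (simp add: arrangement_def reflections_def)

lemma arrangement_nonempty: "\<A> \<noteq> {}"
  using reflections_nonempty by (simp add: arrangement_def)

lemma I_add: "I (u + v) w = I u w + I v w"
  and I_scale: "I (c *s u) w = c * I u w"
  and I_sym: "I v u = cnj (I u v)"
  and I_pos: "v \<noteq> 0 \<Longrightarrow> Re (I v v) > 0"
  and I_inv: "g \<in> W \<Longrightarrow> I (g *v u) (g *v v) = I u v"
  using inner unfolding invariant_inner_def by blast+

lemma I_add_right: "I w (u + v) = I w u + I w v"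
  using I_sym[of w "u + v"] I_sym[of w u] I_sym[of w v] by (simp add: I_add)

lemma I_scale_right: "I w (c *s u) = cnj c * I w u"
  using I_sym[of w "c *s u"] I_sym[of w u] by (simp add: I_scale)

lemma I_diff_right: "I w (u - v) = I w u - I w v"
  using I_add_right[of w "u - v" v] by (simp add: algebra_simps)

lemma I_nondegenerate:
  assumes "\<And>v. I v u = I v u'"
  shows "u = u'"
proof -
  have "I (u - u') (u - u') = 0"
    by (simp add: I_diff_right assms)
  then show ?thesis
    using I_pos[of "u - u'"] by force
qed

text \<open>Positivity makes the Gram matrix of \<open>I\<close> injective, hence invertible.\<close>

lemma riesz_exists: "\<exists>u. \<forall>v. I v u = form_app a v"
proof -
  define A :: "'n cmat" where "A = (\<chi> i j. I (axis j 1) (axis i 1))"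
  have A: "A *v u = (\<chi> i. I u (axis i 1))" for u
    using linear_functional_eq_form_app[of "\<lambda>u. I u (axis _ 1)" u]
    by (simp add: A_def matrix_vector_mult_def vec_eq_iff I_add I_scale form_app_def)
  have "u = 0" if "A *v u = 0" for u
  proof -
    have "I u (axis i 1) = 0" for i
      using that by (simp add: A vec_eq_iff)
    then have "I (axis i 1) u = 0" for i
      using I_sym[of "axis i 1" u] by simp
    then have "I v u = 0" for v
      using linear_functional_eq_form_app[of "\<lambda>v. I v u" v] by (simp add: I_add I_scale form_app_def)
    then show "u = 0"
      using I_pos[of u] by force
  qed
  then obtain B where "B ** A = mat 1"
    using matrix_left_invertible_ker[of A] by auto
  then have "A ** B = mat 1"
    using matrix_left_right_inverse by blast
  define u where "u = B *v (\<chi> i. cnj (a $ i))"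
  have "A *v u = (\<chi> i. cnj (a $ i))"
    by (simp add: u_def matrix_vector_mul_assoc \<open>A ** B = mat 1\<close>)
  then have "I u (axis i 1) = cnj (a $ i)" for i
    by (simp add: A vec_eq_iff)
  then have "I (axis i 1) u = a $ i" for i
    using I_sym[of "axis i 1" u] by simp
  then have "I v u = form_app a v" for v
    using linear_functional_eq_form_app[of "\<lambda>v. I v u" v] by (simp add: I_add I_scale)
  then show ?thesis by blast
qed

lemma riesz: "I v (riesz I a) = form_app a v"
proof -
  have "\<exists>!u. \<forall>v. I v u = form_app a v"
    using riesz_exists[of a] I_nondegenerate by metis
  from theI'[OF this] show ?thesis
    by (simp add: riesz_def)
qed

lemma riesz_eqI: "(\<And>v. I v u = form_app a v) \<Longrightarrow> riesz I a = u"
  by (rule I_nondegenerate) (simp add: riesz)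

lemma riesz_add: "riesz I (a + b) = riesz I a + riesz I b"
  by (rule riesz_eqI) (simp add: I_add_right riesz form_app_add)

lemma riesz_scale: "riesz I (c *s a) = cnj c *s riesz I a"
  by (rule riesz_eqI) (simp add: I_scale_right riesz form_app_scale)

lemma riesz_dact: "w \<in> W \<Longrightarrow> riesz I (dact w a) = w *v riesz I a"
proof (rule riesz_eqI)
  fix v assume w: "w \<in> W"
  have "I v (w *v riesz I a) = I (w *v (matrix_inv w *v v)) (w *v riesz I a)"
    using w by (simp add: matrix_vector_mul_assoc matrix_inv_right)
  also have "\<dots> = form_app (dact w a) v"
    using w by (simp add: I_inv riesz form_app_dact)
  finally show "I v (w *v riesz I a) = form_app (dact w a) v" .
qed

lemma riesz_surj: "\<exists>a. riesz I a = u"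
proof
  show "riesz I (\<chi> j. I (axis j 1) u) = u"
    by (rule riesz_eqI) (rule linear_functional_eq_form_app; simp add: I_add I_scale)
qed

lemma riesz_0: "riesz I 0 = 0"
  by (rule riesz_eqI) (use I_diff_right[of _ 0 0] in simp)

lemma riesz_inject: "riesz I a = riesz I b \<Longrightarrow> a = b"
  using riesz by (metis form_app_eqI)

text \<open>
  The inner product transports irreducibility from \<open>V\<close> to \<open>V\<^sup>*\<close>.
\<close>

lemma dual_irreducible:
  assumes K: "vec.subspace K" and inv: "\<And>w a. w \<in> W \<Longrightarrow> a \<in> K \<Longrightarrow> dact w a \<in> K"
  shows "K = {0} \<or> K = UNIV"
proof -
  let ?U = "riesz I ` K"
  have "vec.subspace ?U"
  proof (rule vec.subspaceI)
    show "0 \<in> ?U"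
      using vec.subspace_0[OF K] riesz_0 by force
    show "x + y \<in> ?U" if "x \<in> ?U" "y \<in> ?U" for x y
      using that vec.subspace_add[OF K] by (auto simp flip: riesz_add)
    show "c *s x \<in> ?U" if x: "x \<in> ?U" for c x
    proof -
      obtain a where a: "a \<in> K" "x = riesz I a"
        using x by blast
      then have "c *s x = riesz I (cnj c *s a)"
        by (simp add: riesz_scale)
      then show ?thesis
        using vec.subspace_scale[OF K a(1)] by blast
    qed
  qed
  moreover have "\<forall>w\<in>W. \<forall>v\<in>?U. w *v v \<in> ?U"
    using inv by (auto simp flip: riesz_dact)
  ultimately have "?U = {0} \<or> ?U = UNIV"
    using W_irreducible unfolding irreducible_group_def by blast
  then show ?thesis
  proof
    assume "?U = {0}"
    then have "K \<subseteq> {0}"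
      using riesz_inject riesz_0 by (metis image_eqI singleton_iff subsetI)
    then show ?thesis
      using vec.subspace_0[OF K] by blast
  next
    assume U: "?U = UNIV"
    have "a \<in> K" for a
    proof -
      obtain b where "b \<in> K" "riesz I a = riesz I b"
        using U by (metis UNIV_I imageE)
      then show ?thesis
        using riesz_inject by metis
    qed
    then show ?thesis by blast
  qed
qed

lemma mat_1_not_reflection: "mat 1 \<notin> reflections W"
proof -
  have "fixed_space (mat 1 :: 'n cmat) = UNIV"
    by (simp add: fixed_space_def)
  then have "vec.dim (fixed_space (mat 1 :: 'n cmat)) = CARD('n)"
    by (simp only: vec_dim_card)
  then show ?thesis
    by (simp add: reflections_def)
qed

lemma no_invariant_form:
  assumes "\<And>w. w \<in> W \<Longrightarrow> dact w a = a"
  shows "a = 0"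
proof -
  let ?K = "{a. \<forall>w\<in>W. dact w a = a}"
  have "vec.subspace ?K"
    by (rule vec.subspaceI) (auto simp: dact_add dact_scale)
  then have "?K = {0} \<or> ?K = UNIV"
    by (rule dual_irreducible) auto
  moreover have "?K \<noteq> UNIV"
  proof
    assume U: "?K = UNIV"
    obtain r where r: "r \<in> reflections W"
      using reflections_nonempty by blast
    then have rW: "r \<in> W"
      by (simp add: reflections_def)
    then have "r = mat 1"
      using U dact_eq_self_imp[of r] W_invertible by (metis (mono_tags, lifting) UNIV_I mem_Collect_eq)
    then show False
      using r mat_1_not_reflection by simp
  qed
  ultimately show ?thesis
    using assms by blast
qed

text \<open>
  The vector representing \<open>\<alpha>\<^sub>H\<close>: a form is orthogonal to \<open>\<alpha>\<^sub>H\<close> if and only if it vanishes there,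
  which is a linear condition on the form.
\<close>

definition coroot :: "'n cvec set \<Rightarrow> 'n cvec" where
  "coroot H = riesz I (\<alpha> H)"

text \<open>The character by which the stabilizer of \<open>H\<close> acts on \<open>\<alpha>\<^sub>H\<close>.\<close>

definition chi :: "'n cvec set \<Rightarrow> 'n cmat \<Rightarrow> complex" where
  "chi H g = form_app (dact g (\<alpha> H)) (coroot H)"

lemma dual_inner_eq_0_iff: "dual_inner I (\<alpha> H) \<beta> = 0 \<longleftrightarrow> form_app \<beta> (coroot H) = 0"
  using I_sym[of "riesz I \<beta>" "riesz I (\<alpha> H)"] by (simp add: dual_inner_def coroot_def riesz[symmetric])

lemma form_app_coroot [simp]: "H \<in> \<A> \<Longrightarrow> form_app (\<alpha> H) (coroot H) = 1"
  using normal by (simp add: normal_forms_def dual_inner_def coroot_def riesz)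

lemma hyperplane_eq: "H \<in> \<A> \<Longrightarrow> H = {v. form_app (\<alpha> H) v = 0}"
  using normal by (simp add: normal_forms_def)

lemma \<alpha>_nonzero [simp]: "H \<in> \<A> \<Longrightarrow> \<alpha> H \<noteq> 0"
  using form_app_coroot[of H] by (metis form_app_0(1) zero_neq_one)

lemma multiple_of_\<alpha>:
  assumes H: "H \<in> \<A>" and b: "\<And>v. v \<in> H \<Longrightarrow> form_app b v = 0"
  shows "b = form_app b (coroot H) *s \<alpha> H"
proof (rule form_app_eqI)
  fix v
  have "v - form_app (\<alpha> H) v *s coroot H \<in> H"
    by (subst hyperplane_eq[OF H]) (simp add: H form_app_diff_right form_app_scale_right)
  from b[OF this] show "form_app b v = form_app (form_app b (coroot H) *s \<alpha> H) v"
    by (simp add: form_app_diff_right form_app_scale_right form_app_scale mult.commute)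
qed

lemma stabilizer_W: "g \<in> stabilizer H \<Longrightarrow> g \<in> W"
  and stabilizer_fixes: "g \<in> stabilizer H \<Longrightarrow> v \<in> H \<Longrightarrow> g *v v = v"
  by (auto simp: stab_def)

lemma stabilizer_invertible [simp]: "g \<in> stabilizer H \<Longrightarrow> invertible g"
  by (simp add: stabilizer_W)

lemma finite_stabilizer [simp]: "finite (stabilizer H)"
  by (simp add: stab_def)

lemma matrix_inv_fixes:
  "invertible (g :: 'n cmat) \<Longrightarrow> g *v v = v \<Longrightarrow> matrix_inv g *v v = v"
  by (metis matrix_inv_left matrix_vector_mul_assoc matrix_vector_mul_lid)

lemma stabilizer_inv: "g \<in> stabilizer H \<Longrightarrow> matrix_inv g \<in> stabilizer H"
  using matrix_inv_fixes by (auto simp: stab_def)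

lemma stabilizer_mult: "g \<in> stabilizer H \<Longrightarrow> h \<in> stabilizer H \<Longrightarrow> g ** h \<in> stabilizer H"
  by (auto simp: stab_def simp flip: matrix_vector_mul_assoc)

lemma stabilizer_one: "mat 1 \<in> stabilizer H"
  by (simp add: stab_def)

text \<open>
  The pointwise stabilizer of \<open>H\<close> acts on \<open>V\<^sup>*\<close> by complex reflections: since it is unitary, it
  scales \<open>\<alpha>\<^sub>H\<close> and fixes its orthogonal complement.
\<close>

lemma dact_stabilizer_\<alpha>:
  assumes H: "H \<in> \<A>" and g: "g \<in> stabilizer H"
  shows "dact g (\<alpha> H) = chi H g *s \<alpha> H"
  unfolding chi_def
proof (rule multiple_of_\<alpha>[OF H])
  fix v assume v: "v \<in> H"
  then have "matrix_inv g *v v = v"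
    using stabilizer_fixes[OF g] g by (simp add: matrix_inv_fixes)
  then show "form_app (dact g (\<alpha> H)) v = 0"
    using v hyperplane_eq[OF H] by (auto simp: form_app_dact)
qed

lemma dact_stabilizer:
  assumes H: "H \<in> \<A>" and g: "g \<in> stabilizer H"
  shows "dact g a = a + ((chi H g - 1) * form_app a (coroot H)) *s \<alpha> H"
proof -
  have chi: "chi H g \<noteq> 0"
  proof
    assume "chi H g = 0"
    then have "dact (matrix_inv g) (dact g (\<alpha> H)) = 0"
      by (simp add: dact_stabilizer_\<alpha>[OF H g])
    then show False
      using g H by (simp add: dact_dact invertible_matrix_inv matrix_inv_left)
  qed
  have "g *v coroot H = cnj (chi H g) *s coroot H"
    using riesz_dact[OF stabilizer_W[OF g], of "\<alpha> H"]
    by (simp add: dact_stabilizer_\<alpha>[OF H g] riesz_scale coroot_def)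
  then have "matrix_inv g *v (cnj (chi H g) *s coroot H) = coroot H"
    using g by (metis matrix_inv_left matrix_vector_mul_assoc matrix_vector_mul_lid stabilizer_invertible)
  then have inv: "cnj (chi H g) *s (matrix_inv g *v coroot H) = coroot H"
    by (simp add: matrix_vector_mult_def vec_eq_iff sum_distrib_left mult_ac)
  have perp: "dact g b = b" if b: "form_app b (coroot H) = 0" for b
  proof -
    have "form_app (dact g b - b) v = 0" if "v \<in> H" for v
      using that g stabilizer_fixes[OF g that]
      by (simp add: form_app_diff form_app_dact matrix_inv_fixes)
    then have eq: "dact g b - b = form_app (dact g b - b) (coroot H) *s \<alpha> H"
      by (rule multiple_of_\<alpha>[OF H])
    have "cnj (chi H g) * form_app b (matrix_inv g *v coroot H) = form_app b (coroot H)"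
      by (simp flip: form_app_scale_right add: inv)
    then have "form_app (dact g b) (coroot H) = 0"
      using b chi by (simp add: form_app_dact)
    then have "form_app (dact g b - b) (coroot H) = 0"
      using b by (simp add: form_app_diff)
    then show ?thesis
      using eq by simp
  qed
  let ?c = "form_app a (coroot H)"
  have "dact g a = dact g (a - ?c *s \<alpha> H) + ?c *s dact g (\<alpha> H)"
    by (simp add: dact_diff dact_scale)
  also have "dact g (a - ?c *s \<alpha> H) = a - ?c *s \<alpha> H"
    by (rule perp) (simp add: form_app_diff form_app_scale H)
  finally show ?thesis
    by (simp add: dact_stabilizer_\<alpha>[OF H g] vec_eq_iff algebra_simps)
qed

lemma chi_mult:
  assumes H: "H \<in> \<A>" and "g \<in> stabilizer H" "h \<in> stabilizer H"
  shows "chi H (g ** h) = chi H g * chi H h"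
proof -
  have "dact (g ** h) (\<alpha> H) = (chi H g * chi H h) *s \<alpha> H"
    using assms by (simp flip: dact_dact add: dact_stabilizer_\<alpha> dact_scale mult.commute)
  then show ?thesis
    unfolding chi_def[of H "g ** h"] by (simp add: form_app_scale H)
qed

lemma chi_one [simp]: "H \<in> \<A> \<Longrightarrow> chi H (mat 1) = 1"
  by (simp add: chi_def)

lemma chi_nonzero:
  assumes "H \<in> \<A>" "g \<in> stabilizer H"
  shows "chi H g \<noteq> 0"
  using chi_mult[OF assms stabilizer_inv[OF assms(2)]] assms
  by (auto simp: matrix_inv_right)

lemma chi_inject:
  assumes H: "H \<in> \<A>" and g: "g \<in> stabilizer H" and h: "h \<in> stabilizer H" and eq: "chi H g = chi H h"
  shows "g = h"
proof -
  have "chi H (matrix_inv g ** h) = chi H (matrix_inv g ** g)"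
    using H g h eq by (simp only: chi_mult stabilizer_inv)
  then have "chi H (matrix_inv g ** h) = 1"
    using H g by (simp add: matrix_inv_left)
  then have "dact (matrix_inv g ** h) a = a" for a
    using dact_stabilizer[OF H stabilizer_mult[OF stabilizer_inv[OF g] h]] by simp
  then have "matrix_inv g ** h = mat 1"
    using g h by (intro dact_eq_self_imp) (auto simp: invertible_mult invertible_matrix_inv)
  then show ?thesis
    using g matrix_inv_unique[of "matrix_inv g" h] by (simp add: matrix_inv_matrix_inv)
qed

lemma stab_order_eq: "stab_order W H = card (stabilizer H)"
  by (simp add: stab_order_def stab_def)

lemma stab_order_ge_2:
  assumes "H \<in> \<A>"
  shows "stab_order W H \<ge> 2"
proof -
  obtain r where r: "r \<in> reflections W" "H = fixed_space r"
    using assms by (auto simp: arrangement_def)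
  then have "r \<in> stabilizer H" "r \<noteq> mat 1"
    using mat_1_not_reflection by (auto simp: stab_def reflections_def fixed_space_def)
  then have "card {mat 1, r} \<le> card (stabilizer H)"
    by (intro card_mono) (auto simp: stabilizer_one)
  then show ?thesis
    using \<open>r \<noteq> mat 1\<close> by (simp add: stab_order_eq)
qed

text \<open>Multiplication by \<open>g\<close> permutes the factors of the product of all values of the character.\<close>

lemma chi_power_order:
  assumes H: "H \<in> \<A>" and g: "g \<in> stabilizer H"
  shows "chi H g ^ stab_order W H = 1"
proof -
  have "bij_betw (\<lambda>h. g ** h) (stabilizer H) (stabilizer H)"
    by (rule bij_betwI[of _ _ _ "\<lambda>h. matrix_inv g ** h"])
       (use g in \<open>auto simp: stabilizer_mult stabilizer_inv matrix_mul_assoc matrix_inv_left matrix_inv_right\<close>)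
  then have "(\<Prod>h\<in>stabilizer H. chi H (g ** h)) = (\<Prod>h\<in>stabilizer H. chi H h)"
    by (rule prod.reindex_bij_betw)
  also have "(\<Prod>h\<in>stabilizer H. chi H (g ** h)) = (\<Prod>h\<in>stabilizer H. chi H g * chi H h)"
    by (rule prod.cong) (simp_all add: chi_mult[OF H g])
  finally have "chi H g ^ card (stabilizer H) * (\<Prod>h\<in>stabilizer H. chi H h) = (\<Prod>h\<in>stabilizer H. chi H h)"
    by (simp add: prod.distrib)
  moreover have "(\<Prod>h\<in>stabilizer H. chi H h) \<noteq> 0"
    by (simp add: chi_nonzero[OF H])
  ultimately show ?thesis
    by (simp add: stab_order_eq)
qed

text \<open>
  The character \<open>\<chi>\<close> embeds the stabilizer of order \<open>e\<close> into \<open>\<complex>\<^sup>*\<close>, and there are at most \<open>r\<close>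
  roots of unity whose order divides \<open>r\<close>.
\<close>

lemma order_dvd_if_chi_powi_eq_1:
  assumes H: "H \<in> \<A>" and n: "\<And>g. g \<in> stabilizer H \<Longrightarrow> chi H g powi n = 1"
  shows "int (stab_order W H) dvd n"
proof -
  let ?e = "stab_order W H"
  define r where "r = nat (n mod int ?e)"
  have e: "?e > 0"
    using stab_order_ge_2[OF H] by simp
  have r: "int r = n mod int ?e" "r < ?e"
    using e by (auto simp: r_def nat_less_iff)
  have pow: "chi H g ^ r = 1" if g: "g \<in> stabilizer H" for g
  proof -
    have "n = int r + int ?e * (n div int ?e)"
      using r(1) by simp
    then have "chi H g powi n = chi H g powi (int r) * (chi H g powi (int ?e)) powi (n div int ?e)"
      using chi_nonzero[OF H g] by (metis power_int_add power_int_mult)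
    then show ?thesis
      using n[OF g] chi_power_order[OF H g] by simp
  qed
  have "r = 0"
  proof (rule ccontr)
    assume "r \<noteq> 0"
    then have "card (stabilizer H) \<le> card {z :: complex. z ^ r = 1}"
      using pow by (intro card_inj_on_le[of "chi H"]) (auto simp: inj_on_def finite_roots_unity intro: chi_inject[OF H])
    also have "\<dots> \<le> r"
      using \<open>r \<noteq> 0\<close> by (intro card_roots_unity) simp
    finally show False
      using r(2) by (simp add: stab_order_eq)
  qed
  then show ?thesis
    using r(1) by (simp add: dvd_eq_mod_eq_0)
qed

subsection \<open>Spanning\<close>

text \<open>
  A reflection changes a form only by a multiple of some \<open>\<alpha>\<^sub>H\<close>, so that every subspace containing
  all \<open>\<alpha>\<^sub>H\<close> is stable under \<open>W\<close>.
\<close>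

lemma \<alpha>_span:
  assumes K: "vec.subspace K" and \<alpha>K: "\<And>H. H \<in> \<A> \<Longrightarrow> \<alpha> H \<in> K"
  shows "K = UNIV"
proof -
  have refl: "dact g a \<in> K" if "H \<in> \<A>" "g \<in> stabilizer H" "a \<in> K" for H g a
    unfolding dact_stabilizer[OF that(1,2)]
    using that by (intro vec.subspace_add[OF K] vec.subspace_scale[OF K] \<alpha>K)
  have in_stab: "r \<in> W" "fixed_space r \<in> \<A>" "r \<in> stabilizer (fixed_space r)" if "r \<in> reflections W" for r
    using that by (auto simp: stab_def reflections_def fixed_space_def arrangement_def)
  have "w \<in> W \<and> (\<forall>a\<in>K. dact w a \<in> K)" if "w \<in> generate GL (reflections W)" for w
    using that
  proof induction
    case one
    then show ?case by (simp add: GL_def)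
  next
    case (incl h)
    then show ?case using in_stab[of h] refl by blast
  next
    case (inv h)
    then show ?case
      using in_stab[of h] refl stabilizer_inv[of h] by (auto simp: inv_GL)
  next
    case (eng h1 h2)
    then show ?case
      by (auto simp: GL_def simp flip: dact_dact)
  qed
  then have "dact w a \<in> K" if "w \<in> W" "a \<in> K" for w a
    using that W_generated by blast
  then have "K = {0} \<or> K = UNIV"
    by (rule dual_irreducible[OF K])
  then show ?thesis
    using arrangement_nonempty \<alpha>K \<alpha>_nonzero by blast
qed

subsection \<open>Inertia groups\<close>

text \<open>The elements acting trivially on the coordinate ring of the hyperplane \<open>\<gamma> = 0\<close>.\<close>

definition inertia :: "'n cvec \<Rightarrow> 'n cmat set" where
  "inertia \<gamma> = {g \<in> W. \<forall>a. \<exists>c. dact g a - a = c *s \<gamma>}"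

lemma inertia_fixes:
  assumes "g \<in> inertia \<gamma>" "form_app \<gamma> v = 0"
  shows "g *v v = v"
proof -
  have gW: "g \<in> W"
    using assms by (simp add: inertia_def)
  have "form_app a (matrix_inv g *v v) = form_app a v" for a
  proof -
    obtain c where "dact g a - a = c *s \<gamma>"
      using assms(1) by (auto simp: inertia_def)
    then have "form_app (dact g a - a) v = 0"
      by (simp add: form_app_scale assms(2))
    then show ?thesis
      by (simp add: form_app_diff form_app_dact)
  qed
  then have "I (matrix_inv g *v v) (riesz I a) = I v (riesz I a)" for a
    by (simp add: riesz)
  then have eq: "I (matrix_inv g *v v) u = I v u" for u
    using riesz_surj[of u] by auto
  have "matrix_inv g *v v = v"
  proof (rule I_nondegenerate)
    fix u
    show "I u (matrix_inv g *v v) = I u v"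
      unfolding I_sym[of u "matrix_inv g *v v"] I_sym[of u v] by (simp add: eq)
  qed
  then show ?thesis
    using gW by (metis W_invertible matrix_inv_right matrix_vector_mul_assoc matrix_vector_mul_lid)
qed

lemma inertia_\<alpha>:
  assumes H: "H \<in> \<A>"
  shows "inertia (\<alpha> H) = stabilizer H"
proof (intro equalityI subsetI)
  fix g assume "g \<in> inertia (\<alpha> H)"
  moreover have "form_app (\<alpha> H) v = 0" if "v \<in> H" for v
    using that hyperplane_eq[OF H] by blast
  ultimately show "g \<in> stabilizer H"
    unfolding stab_def using inertia_fixes[of g "\<alpha> H"] by (auto simp: inertia_def)
next
  fix g assume g: "g \<in> stabilizer H"
  then show "g \<in> inertia (\<alpha> H)"
    using dact_stabilizer[OF H g] stabilizer_W[OF g] by (auto simp: inertia_def)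
qed

text \<open>
  A nontrivial element of the inertia group fixes the hyperplane \<open>\<gamma> = 0\<close> pointwise, hence is a
  reflection, and its reflecting hyperplane is \<open>\<gamma> = 0\<close>.
\<close>

lemma inertia_trivial:
  assumes \<gamma>: "\<gamma> \<noteq> 0" and not_root: "\<And>H c. H \<in> \<A> \<Longrightarrow> \<gamma> \<noteq> c *s \<alpha> H"
  shows "inertia \<gamma> = {mat 1}"
proof (intro equalityI subsetI)
  fix g assume g: "g \<in> inertia \<gamma>"
  then have gW: "g \<in> W" by (simp add: inertia_def)
  let ?K = "fixed_space g"
  have K: "vec.subspace ?K"
    by (rule vec.subspaceI)
       (auto simp: fixed_space_def matrix_vector_right_distrib vector_scalar_commute)
  have ker: "v \<in> ?K" if "form_app \<gamma> v = 0" for v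
    using inertia_fixes[OF g that] by (simp add: fixed_space_def)
  show "g \<in> {mat 1}"
  proof (rule ccontr)
    assume "g \<notin> {mat 1}"
    then have "?K \<noteq> UNIV"
      by (auto simp: fixed_space_def matrix_eq)
    have "\<exists>x0. form_app \<gamma> x0 = 1"
    proof -
      obtain x where "form_app \<gamma> x \<noteq> 0"
        using \<gamma> form_app_eqI[of \<gamma> 0] by auto
      then have "form_app \<gamma> (inverse (form_app \<gamma> x) *s x) = 1"
        by (simp add: form_app_scale_right)
      then show ?thesis by blast
    qed
    then obtain x0 where x0: "form_app \<gamma> x0 = 1" by blast
    have split: "y - form_app \<gamma> y *s x0 \<in> ?K" for y
      by (rule ker) (simp add: form_app_diff_right form_app_scale_right x0)
    have all: "y \<in> ?K" if "x0 \<in> ?K" for y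
      using vec.subspace_add[OF K split[of y] vec.subspace_scale[OF K that, of "form_app \<gamma> y"]] by simp
    then have "x0 \<notin> ?K"
      using \<open>?K \<noteq> UNIV\<close> by blast
    have "y \<in> vec.span (insert x0 ?K)" for y
    proof -
      have "(y - form_app \<gamma> y *s x0) + form_app \<gamma> y *s x0 \<in> vec.span (insert x0 ?K)"
        by (intro vec.span_add vec.span_scale vec.span_base) (auto intro: split)
      then show ?thesis by simp
    qed
    then have "vec.dim (insert x0 ?K) = CARD('n)"
      by (metis UNIV_eq_I vec.dim_span vec_dim_card)
    moreover have "x0 \<notin> vec.span ?K"
      using \<open>x0 \<notin> ?K\<close> K by (metis vec.span_eq_iff)
    ultimately have "g \<in> reflections W"
      using gW by (simp add: reflections_def vec.dim_insert)
    then have KA: "?K \<in> \<A>"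
      by (simp add: arrangement_def)
    have "form_app \<gamma> v = 0" if v: "v \<in> ?K" for v
    proof (rule ccontr)
      assume nz: "form_app \<gamma> v \<noteq> 0"
      have "v - (v - form_app \<gamma> v *s x0) \<in> ?K"
        by (rule vec.subspace_diff[OF K v split])
      then have x0_mult: "form_app \<gamma> v *s x0 \<in> ?K"
        by simp
      have "inverse (form_app \<gamma> v) *s (form_app \<gamma> v *s x0) \<in> ?K"
        by (rule vec.subspace_scale[OF K x0_mult])
      then have "x0 \<in> ?K"
        unfolding vec.scale_scale left_inverse[OF nz] vec.scale_one .
      then show False
        using \<open>x0 \<notin> ?K\<close> by blast
    qed
    then have "\<gamma> = form_app \<gamma> (coroot ?K) *s \<alpha> ?K"
      by (rule multiple_of_\<alpha>[OF KA])
    then show False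
      using not_root[OF KA] by blast
  qed
qed (auto simp: inertia_def intro: exI[of _ 0])

end

context reflection_setting
begin

section \<open>Orders of invariants along a reflecting hyperplane\<close>

lemma act_\<alpha>:
  "H \<in> \<A> \<Longrightarrow> g \<in> stabilizer H \<Longrightarrow> act g (lin (\<alpha> H)) = cst (chi H g) * lin (\<alpha> H)"
  by (simp add: act_lin dact_stabilizer_\<alpha> lin_scale)

lemma act_minus_lin_dvd:
  assumes H: "H \<in> \<A>" and g: "g \<in> stabilizer H" and p: "p \<in> polys"
  shows "lin_dvd (\<alpha> H) (act g p - p)"
proof -
  note h = is_hom_act[OF stabilizer_invertible[OF g]]
  let ?A = "{p \<in> polys. lin_dvd (\<alpha> H) (act g p - p)}"
  have "subalgebra ?A"
    unfolding subalgebra_def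
  proof (intro conjI allI ballI)
    show "cst c \<in> ?A" for c
      by (simp add: hom_cst[OF h] polys_closed)
    fix p q assume pq: "p \<in> ?A" "q \<in> ?A"
    then have "lin_dvd (\<alpha> H) ((act g p - p) + (act g q - q))"
      by (intro lin_dvd_add) auto
    then show "p + q \<in> ?A"
      using pq by (simp add: hom_add[OF h] polys_closed algebra_simps)
    have "lin_dvd (\<alpha> H) (act g p * (act g q - q) + (act g p - p) * q)"
      using pq g by (intro lin_dvd_add lin_dvd_mult lin_dvd_mult2) (auto intro: act_polys)
    then show "p * q \<in> ?A"
      using pq by (simp add: hom_mult[OF h] polys_closed algebra_simps)
  qed
  then have "polys \<subseteq> ?A"
  proof (rule polys_least)
    fix i
    let ?c = "(chi H g - 1) * form_app (axis i 1) (coroot H)"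
    have "act g (var i) - var i = lin (\<alpha> H) * cst ?c"
      unfolding lin_axis[symmetric] act_lin[OF stabilizer_invertible[OF g]] dact_stabilizer[OF H g]
      by (simp only: lin_add lin_scale add_diff_cancel_left' mult.commute)
    then show "var i \<in> ?A"
      by (auto simp: lin_dvd_def polys_closed)
  qed
  then show ?thesis
    using p by blast
qed

text \<open>
  Write \<open>f = \<alpha>\<^sup>n u\<close> with a unit \<open>u\<close> of the local ring of \<open>H\<close>.  An element \<open>g\<close> of the stabilizer acts
  trivially on the residue field, so that \<open>g f = f\<close> forces \<open>\<chi>(g)\<^sup>n = 1\<close>.
\<close>

lemma order_of_invariant:
  assumes H: "H \<in> \<A>" and f: "f \<noteq> 0" and inv: "\<And>g. g \<in> stabilizer H \<Longrightarrow> act g f = f"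
  shows "int (stab_order W H) dvd vord (\<alpha> H) f"
proof (rule order_dvd_if_chi_powi_eq_1[OF H])
  fix g assume g: "g \<in> stabilizer H"
  note h = is_hom_act[OF stabilizer_invertible[OF g]]
  let ?a = "\<alpha> H"
  define n where "n = vord ?a f"
  define c where "c = chi H g powi n"
  obtain u where "lunit ?a u" and u: "f = lin ?a powi n * u"
    using vord_decompose[OF \<alpha>_nonzero[OF H] f] unfolding n_def by metis
  then obtain p q where pq: "p \<in> polys" "q \<in> polys" "\<not> lin_dvd ?a p" "\<not> lin_dvd ?a q" "u = p / q"
    by (auto simp: lunit_def)
  have cst_powi: "cst z powi m = cst (z powi m)" for z m
    by (simp add: power_int_def cst_power cst_inverse)
  have "act g f = cst c * lin ?a powi n * (act g p / act g q)"
    unfolding u pq(5) hom_mult[OF h] hom_powi[OF h] act_\<alpha>[OF H g] hom_divide[OF h]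
    by (simp add: power_int_mult_distrib cst_powi c_def)
  then have "lin ?a powi n * (cst c * (act g p / act g q)) = lin ?a powi n * (p / q)"
    using inv[OF g] u pq(5) by (simp add: mult_ac)
  moreover have "lin ?a powi n \<noteq> 0"
    using H by simp
  ultimately have "cst c * (act g p / act g q) = p / q"
    using mult_left_cancel by blast
  moreover have "act g q \<noteq> 0" "q \<noteq> 0"
    using pq by (auto simp: hom_eq_0_iff[OF h])
  ultimately have "cst c * act g p * q = p * act g q"
    by (simp add: field_simps)
  then have "cst (c - 1) * p * q = p * (act g q - q) - cst c * (act g p - p) * q"
    by (simp add: cst_diff algebra_simps)
  also have "lin_dvd ?a \<dots>"
    by (rule lin_dvd_diff[OF lin_dvd_mult2[OF act_minus_lin_dvd[OF H g pq(2)] pq(1)]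
          lin_dvd_mult[OF lin_dvd_mult2[OF act_minus_lin_dvd[OF H g pq(1)] polys_closed(1)] pq(2)]])
  finally have dvd: "lin_dvd ?a (cst (c - 1) * p * q)" .
  have "c = 1"
  proof (rule ccontr)
    assume "c \<noteq> 1"
    then have "\<not> lin_dvd ?a (cst (c - 1))"
      using not_lin_dvd_1[of ?a] lin_dvd_mult[of ?a "cst (c - 1)" "cst (inverse (c - 1))"]
      by (auto simp: polys_closed simp flip: cst_mult)
    then show False
      using dvd lin_prime[OF \<alpha>_nonzero[OF H]] pq(1-4) by (meson polys_closed(1,3))
  qed
  then show "chi H g powi vord ?a f = 1"
    by (simp add: c_def n_def)
qed

lemma order_of_semi_invariant:
  assumes H: "H \<in> \<A>" and f: "f \<noteq> 0"
    and inv: "\<And>g. g \<in> stabilizer H \<Longrightarrow> act g f = cst (chi H g) * f"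
  shows "int (stab_order W H) dvd vord (\<alpha> H) f - 1"
proof -
  have "int (stab_order W H) dvd vord (\<alpha> H) (f / lin (\<alpha> H))"
  proof (rule order_of_invariant[OF H])
    fix g assume g: "g \<in> stabilizer H"
    show "act g (f / lin (\<alpha> H)) = f / lin (\<alpha> H)"
      unfolding hom_divide[OF is_hom_act[OF stabilizer_invertible[OF g]]] inv[OF g] act_\<alpha>[OF H g]
      using chi_nonzero[OF H g] by simp
  qed (use f H in simp)
  then show ?thesis
    using f H by (simp add: vord_divide)
qed

lemma order_step:
  fixes e k m :: int
  assumes "e dvd m - c" "m > c + (k - 1) * e" "e > 0"
  shows "m \<ge> c + k * e"
proof -
  obtain q where q: "m - c = e * q"
    using assms(1) by blast
  then have "e * (k - 1) < e * q"
    using assms(2) by (simp add: algebra_simps)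
  then have "k - 1 < q"
    using assms(3) by (simp add: mult_less_cancel_left_pos)
  then have "e * k \<le> e * q"
    using assms(3) by simp
  then show ?thesis
    using q by (simp add: algebra_simps)
qed

text \<open>
  Since orders of invariants are multiples of \<open>e\<^sub>H\<close>, a lower bound for the order can be rounded up;
  for functions that transform like \<open>\<alpha>\<^sub>H\<close> the orders are congruent to \<open>1\<close>.
\<close>

lemma vge_invariant:
  assumes H: "H \<in> \<A>" and inv: "\<And>g. g \<in> stabilizer H \<Longrightarrow> act g f = f"
    and f: "f \<in> vge (\<alpha> H) ((k - 1) * int (stab_order W H) + 1)"
  shows "f \<in> vge (\<alpha> H) (k * int (stab_order W H))"
proof (cases "f = 0")
  case False
  then show ?thesis
    using order_of_invariant[OF H False inv] f stab_order_ge_2[OF H]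
      order_step[of "int (stab_order W H)" "vord (\<alpha> H) f" 0 k]
    by (simp add: vge_def)
qed simp

lemma vge_semi_invariant:
  assumes H: "H \<in> \<A>" and inv: "\<And>g. g \<in> stabilizer H \<Longrightarrow> act g f = cst (chi H g) * f"
    and f: "f \<in> vge (\<alpha> H) ((k - 1) * int (stab_order W H) + 2)"
  shows "f \<in> vge (\<alpha> H) (k * int (stab_order W H) + 1)"
proof (cases "f = 0")
  case False
  then show ?thesis
    using order_of_semi_invariant[OF H False inv] f stab_order_ge_2[OF H]
      order_step[of "int (stab_order W H)" "vord (\<alpha> H) f" 1 k]
    by (simp add: vge_def)
qed simp

definition inv_der :: "'n derivation \<Rightarrow> bool" where
  "inv_der \<theta> \<longleftrightarrow> (\<forall>w\<in>W. act_der w \<theta> = \<theta>)"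

lemma inv_der_act: "inv_der \<theta> \<Longrightarrow> w \<in> W \<Longrightarrow> act w (der_app \<theta> f) = der_app \<theta> (act w f)"
  using act_der_eq_iff[of w \<theta>] by (simp add: inv_der_def)

lemma inv_der_perp:
  assumes "H \<in> \<A>" "inv_der \<theta>" "form_app \<beta> (coroot H) = 0" "g \<in> stabilizer H"
  shows "act g (der_app \<theta> (lin \<beta>)) = der_app \<theta> (lin \<beta>)"
  using assms by (simp add: inv_der_act stabilizer_W act_lin dact_stabilizer)

lemma inv_der_\<alpha>:
  assumes "H \<in> \<A>" "inv_der \<theta>" "g \<in> stabilizer H"
  shows "act g (der_app \<theta> (lin (\<alpha> H))) = cst (chi H g) * der_app \<theta> (lin (\<alpha> H))"
  using assms by (simp add: inv_der_act stabilizer_W act_\<alpha> der_app_scale)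

lemma subalgebra_inv_ring: "subalgebra (inv_ring W)"
  unfolding subalgebra_def inv_ring_def
  by (auto simp: polys_closed hom_cst[OF is_hom_act] hom_add[OF is_hom_act] hom_mult[OF is_hom_act])

lemma inv_ring_polys: "f \<in> inv_ring W \<Longrightarrow> f \<in> polys"
  and inv_ring_act: "f \<in> inv_ring W \<Longrightarrow> w \<in> W \<Longrightarrow> act w f = f"
  by (auto simp: inv_ring_def)

end

section \<open>Derivations of the invariant ring\<close>

lemma coeff_prod_in_subalgebra:
  assumes A: "subalgebra A" and "\<And>i n. i \<in> K \<Longrightarrow> poly.coeff (p i) n \<in> A"
  shows "poly.coeff (prod p K) n \<in> A"
  using assms(2)
proof (induction K arbitrary: n rule: infinite_finite_induct)
  case (insert x F)
  then show ?case
    by (simp add: coeff_mult) (intro subalgebra_sum[OF A] subalgebra_mult[OF A]; simp)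
qed (auto simp: subalgebra_0[OF A] subalgebra_1[OF A] one_pCons coeff_pCons split: nat.splits)

lemma coeff_prod_hom:
  assumes "is_hom \<phi>" "finite K"
  shows "poly.coeff (\<Prod>i\<in>K. [:- \<phi> (x i), 1:]) n = \<phi> (poly.coeff (\<Prod>i\<in>K. [:- x i, 1:]) n)"
  using assms(2)
proof (induction K arbitrary: n)
  case empty
  then show ?case
    by (simp add: hom_1[OF assms(1)] hom_0[OF assms(1)] one_pCons coeff_pCons split: nat.splits)
next
  case (insert i K)
  have "poly.coeff [:- \<phi> (x i), 1:] m = \<phi> (poly.coeff [:- x i, 1:] m)" for m
    by (cases m; cases "m - 1")
       (auto simp: hom_0[OF assms(1)] hom_1[OF assms(1)] hom_uminus[OF assms(1)] coeff_pCons split: nat.splits)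
  then show ?case
    using insert by (simp add: coeff_mult hom_sum[OF assms(1)] hom_mult[OF assms(1)] del: mult_pCons_left)
qed

lemma deriv_poly:
  assumes d: "is_deriv \<delta>"
  shows "\<delta> (poly p f) = poly (map_poly \<delta> p) f + poly (pderiv p) f * \<delta> f"
proof (induction p)
  case (pCons c p)
  then show ?case
    by (simp add: map_poly_pCons deriv_0[OF d] deriv_add[OF d] deriv_mult[OF d] pderiv_pCons algebra_simps)
qed (simp add: deriv_0[OF d])

lemma finite_line_inter_subspace:
  fixes V :: "('n::finite) cvec set"
  assumes V: "vec.subspace V" and fg: "f \<notin> V \<or> g \<notin> V"
  shows "finite {l. f + l *s g \<in> V}"
proof -
  have one: "l = l'" if l: "f + l *s g \<in> V" "f + l' *s g \<in> V" for l l'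
  proof (rule ccontr)
    assume ne: "l \<noteq> l'"
    have "(f + l *s g) - (f + l' *s g) \<in> V"
      by (rule vec.subspace_diff[OF V l])
    then have "(l - l') *s g \<in> V"
      by (simp add: vec.scale_left_diff_distrib)
    from vec.subspace_scale[OF V this, of "inverse (l - l')"] have g: "g \<in> V"
      using ne by simp
    from vec.subspace_diff[OF V l(1) vec.subspace_scale[OF V g, of l]] have "f \<in> V"
      by simp
    with g fg show False by blast
  qed
  then have "{l. f + l *s g \<in> V} \<subseteq> {SOME l. f + l *s g \<in> V}"
    by (metis (mono_tags, lifting) mem_Collect_eq singletonI someI subsetI)
  then show ?thesis
    by (rule finite_subset) simp
qed

text \<open>A vector space over an infinite field is not a finite union of proper subspaces.\<close>

lemma avoid_subspaces:
  fixes \<U> :: "('n::finite) cvec set set"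
  assumes "finite \<U>" "\<And>U. U \<in> \<U> \<Longrightarrow> vec.subspace U \<and> U \<noteq> UNIV"
  shows "\<exists>f. f \<notin> \<Union>\<U>"
  using assms
proof (induction \<U>)
  case (insert U \<U>)
  then obtain f where f: "f \<notin> \<Union>\<U>"
    by auto
  obtain g where g: "g \<notin> U"
    using insert.prems by blast
  have "finite {l. f + l *s g \<in> V}" if "V \<in> insert U \<U>" for V
    using that insert.prems f g by (intro finite_line_inter_subspace) auto
  then have "finite (\<Union>V\<in>insert U \<U>. {l. f + l *s g \<in> V})"
    using insert.hyps(1) by blast
  then have "(\<Union>V\<in>insert U \<U>. {l. f + l *s g \<in> V}) \<noteq> UNIV"
    using infinite_UNIV_char_0[where 'a = complex] by metis
  then show ?case by auto
qed auto

lemma avoid_subspaces_pair: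
  fixes \<U> :: "('n::finite) cvec set set"
  assumes "finite \<U>" "\<And>U. U \<in> \<U> \<Longrightarrow> vec.subspace U \<and> U \<noteq> UNIV"
  shows "\<exists>f. f \<notin> \<Union>\<U> \<and> x + f \<notin> \<Union>\<U>"
proof -
  obtain f where f: "f \<notin> \<Union>\<U>"
    using avoid_subspaces[OF assms] by blast
  have "finite {l. x + l *s f \<in> V}" if "V \<in> \<U>" for V
    using that assms(2) f by (intro finite_line_inter_subspace) auto
  then have "finite (insert 0 (\<Union>V\<in>\<U>. {l. x + l *s f \<in> V}))"
    using assms(1) by blast
  then have "insert 0 (\<Union>V\<in>\<U>. {l. x + l *s f \<in> V}) \<noteq> UNIV"
    using infinite_UNIV_char_0[where 'a = complex] by metis
  then obtain l where l: "l \<noteq> 0" "\<forall>V\<in>\<U>. x + l *s f \<notin> V"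
    by auto
  have "l *s f \<notin> V" if V: "V \<in> \<U>" for V
  proof
    assume "l *s f \<in> V"
    moreover have "vec.subspace V"
      using assms V by blast
    ultimately have "inverse l *s (l *s f) \<in> V"
      by (blast intro: vec.subspace_scale)
    then show False
      using l f V by simp
  qed
  then show ?thesis
    using l by auto
qed

context reflection_setting
begin

definition char_poly :: "'n ratfun \<Rightarrow> 'n ratfun poly" where
  "char_poly f = (\<Prod>g\<in>W. [:- act g f, 1:])"

definition diffprod :: "'n ratfun \<Rightarrow> 'n ratfun" where
  "diffprod f = (\<Prod>g\<in>W - {mat 1}. f - act g f)"

lemma char_poly_coeff:
  assumes f: "f \<in> polys"
  shows "poly.coeff (char_poly f) n \<in> inv_ring W"
proof -
  have "poly.coeff [:- act g f, 1:] m \<in> polys" if "g \<in> W" for g m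
    using f that by (auto simp: coeff_pCons polys_closed act_polys split: nat.splits)
  then have "poly.coeff (char_poly f) n \<in> polys"
    unfolding char_poly_def by (intro coeff_prod_in_subalgebra[OF subalgebra_polys])
  moreover have "act w (poly.coeff (char_poly f) n) = poly.coeff (char_poly f) n" if w: "w \<in> W" for w
  proof -
    have "bij_betw (\<lambda>h. w ** h) W W"
      by (rule bij_betwI[of _ _ _ "\<lambda>h. matrix_inv w ** h"])
         (use w in \<open>auto simp: matrix_mul_assoc matrix_inv_left matrix_inv_right\<close>)
    then have "char_poly f = (\<Prod>g\<in>W. [:- act (w ** g) f, 1:])"
      unfolding char_poly_def by (rule prod.reindex_bij_betw[symmetric])
    also have "\<dots> = (\<Prod>g\<in>W. [:- act w (act g f), 1:])"
      by (rule prod.cong) (simp_all add: act_act w)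
    finally show ?thesis
      using coeff_prod_hom[OF is_hom_act[OF W_invertible[OF w]] finite_W, of "\<lambda>g. act g f" n]
      by (simp add: char_poly_def)
  qed
  ultimately show ?thesis
    by (simp add: inv_ring_def)
qed

text \<open>
  Apply a derivation to \<open>P(f) = 0\<close>, where \<open>P(T) = \<Prod>\<^sub>g (T - g f)\<close> has invariant coefficients.
  The formal derivative \<open>P'(f)\<close> is the product of the differences \<open>f - g f\<close>.
\<close>

lemma diffprod_deriv:
  assumes d: "is_deriv \<delta>"
  shows "diffprod f * \<delta> f = - poly (map_poly \<delta> (char_poly f)) f"
proof -
  let ?Q = "\<Prod>g\<in>W - {mat 1}. [:- act g f, 1:]"
  have P: "char_poly f = [:- f, 1:] * ?Q"
    unfolding char_poly_def by (subst prod.remove[OF finite_W W_one]) simp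
  have root: "poly (char_poly f) f = 0"
    by (simp add: P)
  have "poly (pderiv (char_poly f)) f = poly ?Q f"
    unfolding P pderiv_mult by (simp add: pderiv_pCons)
  also have "\<dots> = diffprod f"
    by (simp add: poly_prod diffprod_def)
  finally show ?thesis
    using deriv_poly[OF d, of "char_poly f" f] root
    by (simp add: deriv_0[OF d] eq_neg_iff_add_eq_0 add.commute)
qed

text \<open>
  For generic \<open>f\<close>, the difference \<open>f - g f\<close> is nonzero, and it vanishes on \<open>\<gamma> = 0\<close> only if \<open>g\<close>
  belongs to the inertia group.
\<close>

definition generic :: "'n cvec \<Rightarrow> 'n cvec \<Rightarrow> bool" where
  "generic \<gamma> f \<longleftrightarrow> (\<forall>g\<in>W - {mat 1}. dact g f \<noteq> f \<and> (g \<notin> inertia \<gamma> \<longrightarrow> (\<nexists>c. f - dact g f = c *s \<gamma>)))"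

text \<open>
  Two generic forms differing by a given \<open>x\<close> allow to pass from generic forms to all linear forms.
\<close>

lemma exists_generic: "\<exists>f. generic \<gamma> f \<and> generic \<gamma> (x + f)"
proof -
  define U where "U g = (if g \<in> inertia \<gamma> then {f. dact g f = f} else {f. \<exists>c. f - dact g f = c *s \<gamma>})" for g
  have "vec.subspace (U g) \<and> U g \<noteq> UNIV" if g: "g \<in> W - {mat 1}" for g
  proof (cases "g \<in> inertia \<gamma>")
    case True
    have "{f. dact g f = f} \<noteq> UNIV"
      using dact_eq_self_imp[of g] g by auto
    then show ?thesis
      using True by (auto simp: U_def intro!: vec.subspaceI simp: dact_add dact_scale)
  next
    case False
    have "vec.subspace {f. \<exists>c. f - dact g f = c *s \<gamma>}"
    proof (rule vec.subspaceI)
      show "0 \<in> {f. \<exists>c. f - dact g f = c *s \<gamma>}"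
        by (auto intro: exI[of _ 0])
      fix x y assume "x \<in> {f. \<exists>c. f - dact g f = c *s \<gamma>}" "y \<in> {f. \<exists>c. f - dact g f = c *s \<gamma>}"
      then obtain c c' where "x - dact g x = c *s \<gamma>" "y - dact g y = c' *s \<gamma>"
        by auto
      moreover have "x + y - dact g (x + y) = (x - dact g x) + (y - dact g y)"
        by (simp add: dact_add)
      ultimately have "x + y - dact g (x + y) = (c + c') *s \<gamma>"
        by (simp only: vec.scale_left_distrib)
      then show "x + y \<in> {f. \<exists>c. f - dact g f = c *s \<gamma>}"
        by blast
    next
      fix b x assume "x \<in> {f. \<exists>c. f - dact g f = c *s \<gamma>}"
      then obtain c where "x - dact g x = c *s \<gamma>"
        by auto
      then have "b *s x - dact g (b *s x) = (b * c) *s \<gamma>"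
        by (simp add: dact_scale flip: vec.scale_right_diff_distrib)
      then show "b *s x \<in> {f. \<exists>c. f - dact g f = c *s \<gamma>}"
        by blast
    qed
    moreover have "{f. \<exists>c. f - dact g f = c *s \<gamma>} \<noteq> UNIV"
    proof
      assume "{f. \<exists>c. f - dact g f = c *s \<gamma>} = UNIV"
      then have "\<exists>c. a - dact g a = c *s \<gamma>" for a
        by blast
      then have "\<exists>c. dact g a - a = c *s \<gamma>" for a
        by (metis minus_diff_eq vec.scale_minus_left)
      then show False
        using False g by (auto simp: inertia_def)
    qed
    ultimately show ?thesis
      using False by (simp add: U_def)
  qed
  then obtain f where f: "f \<notin> \<Union>(U ` (W - {mat 1}))" "x + f \<notin> \<Union>(U ` (W - {mat 1}))"
    using avoid_subspaces_pair[of "U ` (W - {mat 1})" x] by auto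
  have "generic \<gamma> f" if f: "f \<notin> \<Union>(U ` (W - {mat 1}))" for f
    unfolding generic_def
  proof
    fix g assume g: "g \<in> W - {mat 1}"
    then have "f \<notin> U g"
      using f by blast
    moreover have "f - dact g f = 0 *s \<gamma>" if "dact g f = f"
      using that by simp
    ultimately show "dact g f \<noteq> f \<and> (g \<notin> inertia \<gamma> \<longrightarrow> (\<nexists>c. f - dact g f = c *s \<gamma>))"
      unfolding U_def by (metis (mono_tags, lifting) mem_Collect_eq)
  qed
  with f show ?thesis by blast
qed

lemma generic_nonzero: "generic \<gamma> f \<Longrightarrow> g \<in> W - {mat 1} \<Longrightarrow> f - dact g f \<noteq> 0"
  unfolding generic_def by (metis right_minus_eq)

lemma diffprod_lin: "diffprod (lin f) = (\<Prod>g\<in>W - {mat 1}. lin (f - dact g f))"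
  unfolding diffprod_def by (rule prod.cong) (simp_all add: act_lin lin_diff)

text \<open>Exactly the factors belonging to the inertia group vanish on \<open>\<gamma> = 0\<close>, each to first order.\<close>

lemma vord_diffprod:
  assumes \<gamma>: "\<gamma> \<noteq> 0" and f: "generic \<gamma> f"
  shows "diffprod (lin f) \<noteq> 0" "vord \<gamma> (diffprod (lin f)) = int (card (inertia \<gamma>)) - 1"
proof -
  have nz: "lin (f - dact g f) \<noteq> 0" if "g \<in> W - {mat 1}" for g
    using generic_nonzero[OF f that] by simp
  then show "diffprod (lin f) \<noteq> 0"
    by (simp add: diffprod_lin)
  have "vord \<gamma> (diffprod (lin f)) = (\<Sum>g\<in>W - {mat 1}. vord \<gamma> (lin (f - dact g f)))"
    unfolding diffprod_lin by (rule vord_prod[OF \<gamma> nz])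
  also have "\<dots> = (\<Sum>g\<in>W - {mat 1}. if g \<in> inertia \<gamma> then 1 else 0)"
  proof (rule sum.cong[OF refl])
    fix g assume g: "g \<in> W - {mat 1}"
    show "vord \<gamma> (lin (f - dact g f)) = (if g \<in> inertia \<gamma> then 1 else 0)"
    proof (cases "g \<in> inertia \<gamma>")
      case True
      then obtain c where c: "dact g f - f = c *s \<gamma>"
        by (auto simp: inertia_def)
      then have eq: "f - dact g f = (- c) *s \<gamma>"
        by (metis minus_diff_eq vec.scale_minus_left)
      have "c \<noteq> 0"
        using nz[OF g] unfolding eq by auto
      then have "vord \<gamma> (lin (f - dact g f)) = 1"
        unfolding eq lin_scale using \<gamma> by (subst vord_mult) auto
      then show ?thesis
        using True by simp
    next
      case False
      then show ?thesis
        using f g by (simp add: generic_def vord_lin_not_proportional[OF \<gamma>])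
    qed
  qed
  also have "\<dots> = int (card (inertia \<gamma> - {mat 1}))"
  proof -
    have "{g \<in> W - {mat 1}. g \<in> inertia \<gamma>} = inertia \<gamma> - {mat 1}"
      by (auto simp: inertia_def)
    then show ?thesis
      by (simp flip: sum.inter_filter)
  qed
  also have "\<dots> = int (card (inertia \<gamma>)) - 1"
  proof -
    have "mat 1 \<in> inertia \<gamma>"
      by (auto simp: inertia_def intro: exI[of _ 0])
    moreover have "finite (inertia \<gamma>)"
      by (simp add: inertia_def)
    ultimately show ?thesis
      by (simp add: card_Diff_singleton of_nat_diff Suc_leI card_gt_0_iff)
         (metis One_nat_def Suc_leI card_gt_0_iff empty_iff of_nat_1 of_nat_diff)
  qed
  finally show "vord \<gamma> (diffprod (lin f)) = int (card (inertia \<gamma>)) - 1" .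
qed

lemma diffprod_polys:
  assumes R: "\<And>r. r \<in> inv_ring W \<Longrightarrow> der_app \<theta> r \<in> polys" and f: "f \<in> polys"
  shows "diffprod f * der_app \<theta> f \<in> polys"
proof -
  have "poly (map_poly (der_app \<theta>) (char_poly f)) f \<in> polys"
    unfolding poly_altdef
    by (intro polys_closed f) (simp add: coeff_map_poly R char_poly_coeff[OF f])
  then show ?thesis
    by (simp add: diffprod_deriv[OF is_deriv_der_app] polys_closed)
qed

text \<open>
  For generic \<open>f\<close> the product \<open>P'(f) \<theta>(f)\<close> is a polynomial, and the order of \<open>P'(f)\<close> is known.  Away
  from the reflecting hyperplanes the inertia group is trivial, and then there is no pole.
\<close>

lemma pole_bound:
  assumes R: "\<And>r. r \<in> inv_ring W \<Longrightarrow> der_app \<theta> r \<in> polys" and \<gamma>: "\<gamma> \<noteq> 0"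
  shows "der_app \<theta> (lin x) \<in> vge \<gamma> (1 - int (card (inertia \<gamma>)))"
proof -
  have gen: "der_app \<theta> (lin f) \<in> vge \<gamma> (1 - int (card (inertia \<gamma>)))" if f: "generic \<gamma> f" for f
  proof (cases "der_app \<theta> (lin f) = 0")
    case False
    note v = vord_diffprod[OF \<gamma> f]
    have "diffprod (lin f) * der_app \<theta> (lin f) \<in> vge \<gamma> 0"
      by (intro vge_polys[OF \<gamma>] diffprod_polys R) auto
    then show ?thesis
      using False v \<gamma> by (simp add: vge_def vord_mult)
  qed simp
  obtain f where f: "generic \<gamma> f" "generic \<gamma> (x + f)"
    using exists_generic by blast
  have "der_app \<theta> (lin x) = der_app \<theta> (lin (x + f)) - der_app \<theta> (lin f)"
    by (simp add: lin_add der_app_add)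
  then show ?thesis
    using gen[OF f(1)] gen[OF f(2)] by (simp add: vge_diff[OF \<gamma>])
qed

lemma derivation_zero_if_zero_on_invariants:
  assumes R: "\<And>r. r \<in> inv_ring W \<Longrightarrow> der_app \<theta> r = 0"
  shows "\<theta> = 0"
proof (rule derivation_eqI)
  fix x
  obtain H where "H \<in> \<A>"
    using arrangement_nonempty by blast
  then have \<gamma>: "\<alpha> H \<noteq> 0"
    by simp
  have gen: "der_app \<theta> (lin f) = 0" if f: "generic (\<alpha> H) f" for f
  proof -
    have "map_poly (der_app \<theta>) (char_poly (lin f)) = 0"
      by (rule poly_eqI) (simp add: coeff_map_poly R char_poly_coeff)
    then have "diffprod (lin f) * der_app \<theta> (lin f) = 0"
      by (simp add: diffprod_deriv[OF is_deriv_der_app])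
    then show ?thesis
      using vord_diffprod(1)[OF \<gamma> f] by simp
  qed
  obtain f where f: "generic (\<alpha> H) f" "generic (\<alpha> H) (x + f)"
    using exists_generic by blast
  have "der_app \<theta> (lin x) = der_app \<theta> (lin (x + f)) - der_app \<theta> (lin f)"
    by (simp add: lin_add der_app_add)
  then show "der_app \<theta> (lin x) = der_app 0 (lin x)"
    using gen[OF f(1)] gen[OF f(2)] by simp
qed

subsection \<open>Clearing denominators\<close>

abbreviation "Q \<equiv> Q_arr W \<alpha>"

lemma Q_nonzero [simp]: "Q \<noteq> 0"
  by (simp add: Q_arr_def)

lemma Q_polys [simp]: "Q \<in> polys"
  by (simp add: Q_arr_def polys_closed)

text \<open>The ring \<open>S[Q\<^sup>-\<^sup>1]\<close>.\<close>

definition S' :: "'n ratfun set" where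
  "S' = {f. \<exists>n. Q ^ n * f \<in> polys}"

lemma DerS'_iff: "\<theta> \<in> DerS' W \<alpha> \<longleftrightarrow> (\<forall>i. \<theta> $ i \<in> S')"
proof -
  have "{f / Q ^ n | f n. f \<in> polys} = S'"
  proof (intro Set.set_eqI iffI)
    fix f assume "f \<in> {f / Q ^ n | f n. f \<in> polys}"
    then obtain p n where "p \<in> polys" "f = p / Q ^ n"
      by blast
    then have "Q ^ n * f \<in> polys"
      by simp
    then show "f \<in> S'"
      unfolding S'_def by blast
  next
    fix f assume "f \<in> S'"
    then obtain n where "Q ^ n * f \<in> polys"
      by (auto simp: S'_def)
    moreover have "f = Q ^ n * f / Q ^ n"
      by simp
    ultimately show "f \<in> {f / Q ^ n | f n. f \<in> polys}"
      by blast
  qed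
  then show ?thesis
    by (simp add: DerS'_def)
qed

lemma S'_raise: "Q ^ n * f \<in> polys \<Longrightarrow> n \<le> m \<Longrightarrow> Q ^ m * f \<in> polys"
  using polys_closed(3)[of "Q ^ (m - n)" "Q ^ n * f"]
  by (simp add: polys_closed flip: power_add mult.assoc)

lemma subalgebra_S': "subalgebra S'"
  unfolding subalgebra_def
proof (intro conjI allI ballI)
  show "cst c \<in> S'" for c
    unfolding S'_def by (rule CollectI, rule exI[of _ 0]) (simp add: polys_closed)
  fix f g assume "f \<in> S'" "g \<in> S'"
  then obtain m n where mn: "Q ^ m * f \<in> polys" "Q ^ n * g \<in> polys"
    by (auto simp: S'_def)
  have "Q ^ (m + n) * f + Q ^ (m + n) * g \<in> polys"
    by (intro polys_closed S'_raise[OF mn(1)] S'_raise[OF mn(2)]) auto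
  then show "f + g \<in> S'"
    unfolding S'_def by (auto simp: distrib_left)
  have "Q ^ (m + n) * (f * g) = (Q ^ m * f) * (Q ^ n * g)"
    by (simp only: power_add mult_ac)
  then have "Q ^ (m + n) * (f * g) \<in> polys"
    using polys_closed(3)[OF mn] by metis
  then show "f * g \<in> S'"
    unfolding S'_def by blast
qed

lemmas S'_closed =
  subalgebra_cst[OF subalgebra_S'] subalgebra_add[OF subalgebra_S']
  subalgebra_mult[OF subalgebra_S'] subalgebra_0[OF subalgebra_S']
  subalgebra_uminus[OF subalgebra_S'] subalgebra_diff[OF subalgebra_S']
  subalgebra_sum[OF subalgebra_S']

lemma polys_S': "f \<in> polys \<Longrightarrow> f \<in> S'"
  unfolding S'_def by (rule CollectI, rule exI[of _ 0]) simp

lemma pderiv_S':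
  assumes "f \<in> S'"
  shows "pderiv_rat i f \<in> S'"
proof -
  obtain n where n: "Q ^ n * f \<in> polys"
    using assms by (auto simp: S'_def)
  have "pderiv_rat i (Q ^ n * f) = pderiv_rat i (Q ^ n) * f + Q ^ n * pderiv_rat i f"
    by (rule deriv_mult[OF is_deriv_pderiv_rat])
  then have "Q ^ n * pderiv_rat i f = pderiv_rat i (Q ^ n * f) - pderiv_rat i (Q ^ n) * f"
    by simp
  also have "\<dots> \<in> S'"
    by (rule S'_closed(6)[OF polys_S'[OF pderiv_poly_in_polys[OF n]] S'_closed(3)[OF polys_S' assms]])
       (simp add: pderiv_poly_in_polys polys_closed)
  finally obtain m where "Q ^ m * (Q ^ n * pderiv_rat i f) \<in> polys"
    by (auto simp: S'_def)
  then show ?thesis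
    unfolding S'_def by (auto simp: mult.assoc simp flip: mult.assoc power_add)
qed

lemma DerS'_app: "\<theta> \<in> DerS' W \<alpha> \<Longrightarrow> f \<in> S' \<Longrightarrow> der_app \<theta> f \<in> S'"
  unfolding der_app_def by (intro S'_closed pderiv_S') (simp_all add: DerS'_iff)

text \<open>
  A factor proportional to some \<open>\<alpha>\<^sub>H\<close> is absorbed by a power of \<open>Q\<close>, any other one divides out.
\<close>

lemma clear_linear_factors:
  assumes "finite K" "f * (\<Prod>i\<in>K. lin (c i)) \<in> polys" "\<And>i. i \<in> K \<Longrightarrow> c i \<noteq> 0"
    and "\<And>\<gamma>. \<gamma> \<noteq> 0 \<Longrightarrow> (\<And>H c. H \<in> \<A> \<Longrightarrow> \<gamma> \<noteq> c *s \<alpha> H) \<Longrightarrow> f \<in> vge \<gamma> 0"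
  shows "f \<in> S'"
  using assms
proof (induction K arbitrary: f)
  case empty
  then show ?case by (simp add: polys_S')
next
  case (insert i K)
  let ?g = "f * lin (c i)"
  have "?g \<in> S'"
  proof (rule insert.IH)
    show "?g * (\<Prod>i\<in>K. lin (c i)) \<in> polys"
      using insert.prems(1) insert.hyps by (simp add: mult_ac)
    show "c j \<noteq> 0" if "j \<in> K" for j
      using insert.prems(2) that by blast
    fix \<gamma> :: "'n cvec"
    assume \<gamma>: "\<gamma> \<noteq> 0" "\<And>H c. H \<in> \<A> \<Longrightarrow> \<gamma> \<noteq> c *s \<alpha> H"
    then have "f \<in> vge \<gamma> 0"
      by (rule insert.prems(3))
    then show "f * lin (c i) \<in> vge \<gamma> 0"
      using vge_mult0[OF \<gamma>(1) vge_polys[OF \<gamma>(1) polys_lin]] by (subst mult.commute) blast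
  qed
  then obtain n where n: "Q ^ n * ?g \<in> polys"
    by (auto simp: S'_def)
  show "f \<in> S'"
  proof (cases "\<exists>H b. H \<in> \<A> \<and> c i = b *s \<alpha> H")
    case True
    then obtain H b where H: "H \<in> \<A>" "c i = b *s \<alpha> H"
      by blast
    then have b: "b \<noteq> 0"
      using insert.prems(2) by auto
    have "Q = lin (\<alpha> H) * (\<Prod>H\<in>\<A> - {H}. lin (\<alpha> H))"
      unfolding Q_arr_def by (rule prod.remove) (use H in auto)
    then have "Q ^ Suc n * f = cst (inverse b) * (Q ^ n * ?g) * (\<Prod>H\<in>\<A> - {H}. lin (\<alpha> H))"
      using b by (simp add: H(2) lin_scale cst_inverse mult_ac)
    also have "\<dots> \<in> polys"
      by (rule polys_closed(3)[OF polys_closed(3)[OF polys_closed(1) n] polys_closed(9)]) simp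
    finally show ?thesis
      unfolding S'_def by blast
  next
    case False
    have "Q ^ n * f \<in> polys"
    proof (rule polys_cancel_lin)
      show ci: "c i \<noteq> 0"
        using insert.prems(2) by blast
      have "f \<in> vge (c i) 0"
        using False by (intro insert.prems(3) ci) blast
      then show "Q ^ n * f \<in> vge (c i) 0"
        by (intro vge_mult0[OF ci vge_polys[OF ci]] polys_closed(10)) auto
      show "lin (c i) * (Q ^ n * f) \<in> polys"
        using n by (simp add: mult_ac)
    qed
    then show ?thesis
      unfolding S'_def by blast
  qed
qed

lemma S'_regular_imp_polys:
  assumes f: "f \<in> S'" and reg: "\<And>H. H \<in> \<A> \<Longrightarrow> f \<in> vge (\<alpha> H) 0"
  shows "f \<in> polys"
proof -
  have step: "f \<in> polys" if "finite K" "K \<subseteq> \<A>" "(\<Prod>H\<in>K. lin (\<alpha> H)) * f \<in> polys"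
    "\<And>H. H \<in> \<A> \<Longrightarrow> f \<in> vge (\<alpha> H) 0" for f K
    using that(1-3)
  proof (induction K)
    case (insert H K)
    have "(\<Prod>H\<in>K. lin (\<alpha> H)) * f \<in> polys"
    proof (rule polys_cancel_lin)
      show a: "\<alpha> H \<noteq> 0"
        using insert.prems by auto
      show "(\<Prod>H\<in>K. lin (\<alpha> H)) * f \<in> vge (\<alpha> H) 0"
        using insert.prems that(4) by (intro vge_mult0[OF a vge_polys[OF a]] polys_closed(9)) auto
      show "lin (\<alpha> H) * ((\<Prod>H\<in>K. lin (\<alpha> H)) * f) \<in> polys"
        using insert by (simp add: mult_ac)
    qed
    then show ?case
      using insert.prems by (intro insert.IH) auto
  qed simp
  obtain n where "Q ^ n * f \<in> polys"
    using f by (auto simp: S'_def)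
  then show ?thesis
  proof (induction n)
    case (Suc n)
    have "Q * (Q ^ n * f) \<in> polys"
      using Suc.prems by (simp add: mult_ac)
    moreover have "Q ^ n * f \<in> vge (\<alpha> H) 0" if "H \<in> \<A>" for H
      using that Suc.prems reg
      by (intro vge_mult0[OF \<alpha>_nonzero vge_polys[OF \<alpha>_nonzero]] polys_closed(10) reg) auto
    ultimately have "Q ^ n * f \<in> polys"
      using step[of \<A> "Q ^ n * f"] by (simp add: Q_arr_def)
    then show ?case
      by (rule Suc.IH)
  qed simp
qed

lemma in_DerS':
  assumes R: "\<And>r. r \<in> inv_ring W \<Longrightarrow> der_app \<theta> r \<in> polys"
  shows "\<theta> \<in> DerS' W \<alpha>"
  unfolding DerS'_iff
proof
  fix i
  obtain H where "H \<in> \<A>"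
    using arrangement_nonempty by blast
  obtain f where f: "generic (\<alpha> H) f" "generic (\<alpha> H) (axis i 1 + f)"
    using exists_generic by blast
  have "der_app \<theta> (lin x) \<in> S'" if x: "generic (\<alpha> H) x" for x
  proof (rule clear_linear_factors)
    show "der_app \<theta> (lin x) * (\<Prod>g\<in>W - {mat 1}. lin (x - dact g x)) \<in> polys"
      using diffprod_polys[OF R, of "lin x"] by (simp add: diffprod_lin mult.commute)
    show "x - dact g x \<noteq> 0" if "g \<in> W - {mat 1}" for g
      by (rule generic_nonzero[OF x that])
    fix \<gamma> :: "'n cvec"
    assume \<gamma>: "\<gamma> \<noteq> 0" "\<And>H c. H \<in> \<A> \<Longrightarrow> \<gamma> \<noteq> c *s \<alpha> H"
    show "der_app \<theta> (lin x) \<in> vge \<gamma> 0"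
      using pole_bound[OF R \<gamma>(1), of x] inertia_trivial[OF \<gamma>] by simp
  qed simp
  from this[OF f(1)] this[OF f(2)] show "\<theta> $ i \<in> S'"
    using S'_closed(6)[of "der_app \<theta> (lin (axis i 1 + f))" "der_app \<theta> (lin f)"]
    by (simp add: lin_add der_app_add)
qed

end

context reflection_setting
begin

section \<open>The modules of invariant logarithmic vector fields\<close>

definition regular_at :: "'n cvec set \<Rightarrow> 'n derivation \<Rightarrow> bool" where
  "regular_at H \<theta> \<longleftrightarrow> (\<forall>\<beta>. form_app \<beta> (coroot H) = 0 \<longrightarrow> der_app \<theta> (lin \<beta>) \<in> vge (\<alpha> H) 0)"

definition Dlog_inf :: "'n derivation set" where
  "Dlog_inf = inv_ders W (logD_inf W I \<alpha>)"

text \<open>The module \<open>\<D>(\<A>, -k\<omega> + 1)\<^sup>W\<close>.\<close>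

definition Dlog :: "int \<Rightarrow> 'n derivation set" where
  "Dlog k = inv_ders W (logD W I \<alpha> (\<lambda>H. - k * int (stab_order W H) + 1))"

lemma Dlog_inf_iff:
  "\<theta> \<in> Dlog_inf \<longleftrightarrow> inv_der \<theta> \<and> \<theta> \<in> DerS' W \<alpha> \<and> (\<forall>H\<in>\<A>. regular_at H \<theta>)"
  unfolding Dlog_inf_def inv_ders_def logD_inf_def inv_der_def regular_at_def dual_inner_eq_0_iff
  by (auto simp: localization_eq_vge)

lemma Dlog_iff:
  "\<theta> \<in> Dlog k \<longleftrightarrow> \<theta> \<in> Dlog_inf \<and>
     (\<forall>H\<in>\<A>. der_app \<theta> (lin (\<alpha> H)) \<in> vge (\<alpha> H) (- k * int (stab_order W H) + 1))"
  unfolding Dlog_def Dlog_inf_def inv_ders_def logD_def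
  by (auto simp: powi_localization_eq_vge simp del: mult_minus_left)

lemma Dlog_inf_inv: "\<theta> \<in> Dlog_inf \<Longrightarrow> inv_der \<theta>"
  and Dlog_inf_DerS': "\<theta> \<in> Dlog_inf \<Longrightarrow> \<theta> \<in> DerS' W \<alpha>"
  and Dlog_inf_perp: "\<theta> \<in> Dlog_inf \<Longrightarrow> H \<in> \<A> \<Longrightarrow> form_app \<beta> (coroot H) = 0 \<Longrightarrow> der_app \<theta> (lin \<beta>) \<in> vge (\<alpha> H) 0"
  and Dlog_imp_Dlog_inf: "\<theta> \<in> Dlog k \<Longrightarrow> \<theta> \<in> Dlog_inf"
  and Dlog_\<alpha>: "\<theta> \<in> Dlog k \<Longrightarrow> H \<in> \<A> \<Longrightarrow> der_app \<theta> (lin (\<alpha> H)) \<in> vge (\<alpha> H) (- k * int (stab_order W H) + 1)"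
  by (auto simp: Dlog_iff Dlog_inf_iff regular_at_def)

lemma Dlog_mono:
  assumes "k \<le> k'"
  shows "Dlog k \<subseteq> Dlog k'"
proof
  fix \<theta> assume \<theta>: "\<theta> \<in> Dlog k"
  have "- k' * int (stab_order W H) + 1 \<le> - k * int (stab_order W H) + 1" for H
    using assms by (simp add: mult_right_mono)
  then show "\<theta> \<in> Dlog k'"
    using \<theta> unfolding Dlog_iff by (blast intro: vge_mono)
qed

lemma Dlog_inf_eq_Union: "Dlog_inf = (\<Union>k. Dlog k)"
proof (intro equalityI subsetI)
  fix \<theta> assume \<theta>: "\<theta> \<in> Dlog_inf"
  \<comment> \<open>Larger than all pole orders, and so is its multiple by any \<open>e\<^sub>H\<close>.\<close>
  define k where "k = (\<Sum>H\<in>\<A>. \<bar>vord (\<alpha> H) (der_app \<theta> (lin (\<alpha> H)))\<bar> + 1)"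
  have "der_app \<theta> (lin (\<alpha> H)) \<in> vge (\<alpha> H) (- k * int (stab_order W H) + 1)" if H: "H \<in> \<A>" for H
  proof -
    let ?v = "vord (\<alpha> H) (der_app \<theta> (lin (\<alpha> H)))"
    have k: "\<bar>?v\<bar> + 1 \<le> k"
      unfolding k_def by (rule member_le_sum[OF H]) auto
    have "k * 1 \<le> k * int (stab_order W H)"
      using k stab_order_ge_2[OF H] by (intro mult_left_mono) auto
    then have "- k * int (stab_order W H) + 1 \<le> ?v"
      using k by simp
    then show ?thesis
      by (simp add: vge_def)
  qed
  then have "\<theta> \<in> Dlog k"
    using \<theta> by (simp add: Dlog_iff)
  then show "\<theta> \<in> (\<Union>k. Dlog k)"
    by blast
qed (auto simp: Dlog_imp_Dlog_inf)

lemma inv_derI: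
  "(\<And>w a. w \<in> W \<Longrightarrow> act w (der_app \<theta> (lin a)) = der_app \<theta> (lin (dact w a))) \<Longrightarrow> inv_der \<theta>"
  unfolding inv_der_def by (simp add: act_der_eqI)

lemma inv_der_act_lin: "inv_der \<theta> \<Longrightarrow> w \<in> W \<Longrightarrow> act w (der_app \<theta> (lin a)) = der_app \<theta> (lin (dact w a))"
  by (simp add: inv_der_act act_lin)

lemma Dlog_inf_0: "0 \<in> Dlog_inf"
  by (auto simp: Dlog_inf_iff regular_at_def DerS'_iff S'_closed hom_0[OF is_hom_act] intro!: inv_derI)

lemma Dlog_0: "0 \<in> Dlog k"
  by (simp add: Dlog_iff Dlog_inf_0)

lemma Dlog_inf_add:
  assumes "\<theta> \<in> Dlog_inf" "\<phi> \<in> Dlog_inf"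
  shows "\<theta> + \<phi> \<in> Dlog_inf"
  unfolding Dlog_inf_iff regular_at_def
proof (intro conjI ballI allI impI)
  show "inv_der (\<theta> + \<phi>)"
    using assms by (intro inv_derI) (simp add: der_app_plus_left hom_add[OF is_hom_act] inv_der_act_lin Dlog_inf_inv)
  show "\<theta> + \<phi> \<in> DerS' W \<alpha>"
    using assms by (simp add: Dlog_inf_iff DerS'_iff S'_closed)
  fix H \<beta> assume "H \<in> \<A>" "form_app \<beta> (coroot H) = 0"
  then show "der_app (\<theta> + \<phi>) (lin \<beta>) \<in> vge (\<alpha> H) 0"
    using assms by (simp add: der_app_plus_left vge_add Dlog_inf_perp)
qed

lemma Dlog_inf_scale:
  assumes "r \<in> inv_ring W" "\<theta> \<in> Dlog_inf"
  shows "r *s \<theta> \<in> Dlog_inf"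
  unfolding Dlog_inf_iff regular_at_def
proof (intro conjI ballI allI impI)
  show "inv_der (r *s \<theta>)"
    using assms by (intro inv_derI)
      (simp add: der_app_scale_left hom_mult[OF is_hom_act] inv_der_act_lin Dlog_inf_inv inv_ring_act)
  show "r *s \<theta> \<in> DerS' W \<alpha>"
    using assms by (simp add: Dlog_inf_iff DerS'_iff S'_closed polys_S' inv_ring_polys)
  fix H \<beta> assume "H \<in> \<A>" "form_app \<beta> (coroot H) = 0"
  then show "der_app (r *s \<theta>) (lin \<beta>) \<in> vge (\<alpha> H) 0"
    using assms by (simp add: der_app_scale_left vge_mult0 vge_polys inv_ring_polys Dlog_inf_perp)
qed

lemma Dlog_add: "\<theta> \<in> Dlog k \<Longrightarrow> \<phi> \<in> Dlog k \<Longrightarrow> \<theta> + \<phi> \<in> Dlog k"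
  by (simp add: Dlog_iff Dlog_inf_add der_app_plus_left vge_add)

lemma Dlog_scale: "r \<in> inv_ring W \<Longrightarrow> \<theta> \<in> Dlog k \<Longrightarrow> r *s \<theta> \<in> Dlog k"
  by (simp add: Dlog_iff Dlog_inf_scale der_app_scale_left vge_mult0 vge_polys inv_ring_polys)

lemma submodule_Dlog: "submodule (inv_ring W) (Dlog k)"
  by (simp add: submodule_def Dlog_0 Dlog_add Dlog_scale)

lemma submodule_Dlog_inf: "submodule (inv_ring W) Dlog_inf"
  by (simp add: submodule_def Dlog_inf_0 Dlog_inf_add Dlog_inf_scale)

lemma Dlog_sum: "(\<And>i. i \<in> K \<Longrightarrow> \<theta> i \<in> Dlog k) \<Longrightarrow> sum \<theta> K \<in> Dlog k"
  by (induction K rule: infinite_finite_induct) (auto intro: Dlog_0 Dlog_add)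

lemma Dlog_inf_diff: "\<theta> \<in> Dlog_inf \<Longrightarrow> \<phi> \<in> Dlog_inf \<Longrightarrow> \<theta> - \<phi> \<in> Dlog_inf"
  using Dlog_inf_add[of \<theta> "cst (-1) *s \<phi>"] Dlog_inf_scale[of "cst (-1)" \<phi>]
    subalgebra_cst[OF subalgebra_inv_ring, of "-1"]
  by (simp add: cst_minus)

lemma Dlog_diff: "\<theta> \<in> Dlog k \<Longrightarrow> \<phi> \<in> Dlog k \<Longrightarrow> \<theta> - \<phi> \<in> Dlog k"
  using Dlog_add[of \<theta> k "cst (-1) *s \<phi>"] Dlog_scale[of "cst (-1)" \<phi> k]
    subalgebra_cst[OF subalgebra_inv_ring, of "-1"]
  by (simp add: cst_minus)

lemma lin_split: "lin a = cst (form_app a (coroot H)) * lin (\<alpha> H) + lin (a - form_app a (coroot H) *s \<alpha> H)"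
  by (simp add: lin_diff lin_scale)

lemma perp_part: "H \<in> \<A> \<Longrightarrow> form_app (a - form_app a (coroot H) *s \<alpha> H) (coroot H) = 0"
  by (simp add: form_app_diff form_app_scale)

lemma regular_at_bound:
  assumes H: "H \<in> \<A>" and "regular_at H \<theta>" "der_app \<theta> (lin (\<alpha> H)) \<in> vge (\<alpha> H) m" "m \<le> 0"
  shows "der_app \<theta> (lin a) \<in> vge (\<alpha> H) m"
proof -
  have "der_app \<theta> (lin (a - form_app a (coroot H) *s \<alpha> H)) \<in> vge (\<alpha> H) 0"
    using assms(2) perp_part[OF H] by (simp add: regular_at_def)
  then have "der_app \<theta> (lin (a - form_app a (coroot H) *s \<alpha> H)) \<in> vge (\<alpha> H) m"
    using assms(4) by (rule vge_mono)
  then show ?thesis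
    using assms(3) H unfolding lin_split[of a H] der_app_add der_app_scale
    by (intro vge_add vge_scale) auto
qed

lemma derivation_zero_if_zero_on_\<alpha>:
  assumes "\<And>H. H \<in> \<A> \<Longrightarrow> der_app \<theta> (lin (\<alpha> H)) = 0"
  shows "\<theta> = 0"
proof (rule derivation_eqI)
  have "vec.subspace {a. der_app \<theta> (lin a) = 0}"
    by (rule vec.subspaceI) (auto simp: lin_add lin_scale der_app_add der_app_scale)
  then have "{a. der_app \<theta> (lin a) = 0} = UNIV"
    by (rule \<alpha>_span) (use assms in auto)
  then show "der_app \<theta> (lin a) = der_app 0 (lin a)" for a
    by auto
qed

text \<open>
  The constant vector field with value \<open>1\<close> on \<open>\<alpha>\<^sub>H\<close> and \<open>0\<close> on the orthogonal complement of \<open>\<alpha>\<^sub>H\<close>.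
\<close>

definition normal_der :: "'n cvec set \<Rightarrow> 'n derivation" where
  "normal_der H = (\<chi> i. cst (coroot H $ i))"

lemma normal_der_lin: "der_app (normal_der H) (lin a) = cst (form_app a (coroot H))"
proof -
  have "(\<Sum>i\<in>K. cst (f i)) = cst (\<Sum>i\<in>K. f i)" if "finite K" for K :: "'n set" and f
    using that by (induction K) (simp_all add: cst_add)
  from this[of UNIV] show ?thesis
    by (simp add: normal_der_def der_app_lin form_app_def flip: cst_mult)
qed

lemma normal_der_polys: "f \<in> polys \<Longrightarrow> der_app (normal_der H) f \<in> polys"
  unfolding der_app_def normal_der_def by (intro polys_closed) (simp_all add: polys_closed pderiv_poly_in_polys)

text \<open>
  For an invariant \<open>r\<close>, the function \<open>\<alpha>\<^sub>H \<partial>r\<close> is again invariant under the stabilizer and vanishes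
  on \<open>H\<close>, hence it vanishes there to order \<open>e\<^sub>H\<close>.
\<close>

lemma normal_der_invariant:
  assumes H: "H \<in> \<A>" and r: "r \<in> inv_ring W"
  shows "der_app (normal_der H) r \<in> vge (\<alpha> H) (int (stab_order W H) - 1)"
proof (cases "der_app (normal_der H) r = 0")
  case False
  let ?E = "lin (\<alpha> H) *s normal_der H"
  have "act g (der_app ?E r) = der_app ?E r" if g: "g \<in> stabilizer H" for g
  proof -
    have "act_der g ?E = ?E"
    proof (rule act_der_eqI)
      fix a
      have "form_app (dact g a) (coroot H) = chi H g * form_app a (coroot H)"
        by (simp add: dact_stabilizer[OF H g] form_app_add form_app_diff form_app_scale H algebra_simps)
      moreover note h = is_hom_act[OF stabilizer_invertible[OF g]]
      ultimately show "act g (der_app ?E (lin a)) = der_app ?E (lin (dact g a))"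
        unfolding der_app_scale_left normal_der_lin hom_mult[OF h] hom_cst[OF h] act_\<alpha>[OF H g]
        by (simp only: cst_mult mult_ac)
    qed (use g in simp)
    then show ?thesis
      using act_der_eq_iff[of g ?E] inv_ring_act[OF r stabilizer_W[OF g]] g by simp
  qed
  moreover have "der_app ?E r \<in> vge (\<alpha> H) ((1 - 1) * int (stab_order W H) + 1)"
    using vge_mult[of "\<alpha> H" "lin (\<alpha> H)" 1 "der_app (normal_der H) r" 0]
      normal_der_polys[OF inv_ring_polys[OF r]] vge_vord[of "lin (\<alpha> H)" "\<alpha> H"]
    by (simp add: der_app_scale_left H vge_polys)
  ultimately have "der_app ?E r \<in> vge (\<alpha> H) (1 * int (stab_order W H))"
    using H by (intro vge_invariant) auto
  then show ?thesis
    using False H by (simp add: der_app_scale_left vge_def vord_mult)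
qed simp

text \<open>
  Split \<open>\<theta>\<close> into a field that is regular along \<open>H\<close> and a multiple of the normal derivative; the pole
  of the latter is compensated by the order of the normal derivative of an invariant.
\<close>

lemma regular_on_invariants:
  assumes H: "H \<in> \<A>" and reg: "regular_at H \<theta>"
    and \<alpha>: "der_app \<theta> (lin (\<alpha> H)) \<in> vge (\<alpha> H) (1 - int (stab_order W H))" and r: "r \<in> inv_ring W"
  shows "der_app \<theta> r \<in> vge (\<alpha> H) 0"
proof -
  let ?f = "der_app \<theta> (lin (\<alpha> H))"
  let ?rest = "\<theta> - ?f *s normal_der H"
  have "der_app ?rest (lin a) \<in> vge (\<alpha> H) 0" for a
  proof -
    have "der_app ?rest (lin a) = der_app \<theta> (lin (a - form_app a (coroot H) *s \<alpha> H))"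
      by (simp add: der_app_minus_left der_app_scale_left normal_der_lin lin_diff lin_scale
          der_app_diff der_app_scale)
    then show ?thesis
      using reg perp_part[OF H] by (simp add: regular_at_def)
  qed
  then have "der_app ?rest (var i) \<in> vge (\<alpha> H) 0" for i
    by (metis lin_axis)
  then have 1: "der_app ?rest r \<in> vge (\<alpha> H) 0"
    by (rule deriv_localization[OF \<alpha>_nonzero[OF H] is_deriv_der_app _
          vge_polys[OF \<alpha>_nonzero[OF H] inv_ring_polys[OF r]]])
  have 2: "?f * der_app (normal_der H) r \<in> vge (\<alpha> H) 0"
    using vge_mult[OF \<alpha>_nonzero[OF H] \<alpha> normal_der_invariant[OF H r]] by simp
  have "der_app \<theta> r = der_app ?rest r + ?f * der_app (normal_der H) r"
    by (simp add: der_app_minus_left der_app_scale_left)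
  then show ?thesis
    using vge_add[OF \<alpha>_nonzero[OF H] 1 2] by simp
qed

end

section \<open>Coordinates given by basic invariants\<close>

locale flat_setting = reflection_setting W I \<alpha>
  for W :: "('n::{finite,linorder}) cmat set"
    and I :: "'n cvec \<Rightarrow> 'n cvec \<Rightarrow> complex"
    and \<alpha> :: "'n cvec set \<Rightarrow> 'n cvec" +
  fixes d e :: "nat \<Rightarrow> nat"
    and t :: "nat \<Rightarrow> 'n ratfun"
    and \<eta> :: "nat \<Rightarrow> 'n derivation"
  assumes flat: "flat_system W \<alpha> d e t \<eta>"
begin

abbreviation "R \<equiv> inv_ring W"
abbreviation "pt \<equiv> partial_t t"
abbreviation "D \<equiv> der_app (primitive t)"
abbreviation "nablaD \<equiv> nabla (primitive t)"

lemma basic: "basic_invariants W d t"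
  using flat by (simp add: flat_system_def)

lemma R_eq: "R = adjoin t {1..CARD('n)}"
  using basic by (simp add: basic_invariants_def)

lemma t_R: "i \<in> {1..CARD('n)} \<Longrightarrow> t i \<in> R"
  unfolding R_eq by (rule adjoin_generator)

lemmas R_closed =
  subalgebra_cst[OF subalgebra_inv_ring] subalgebra_add[OF subalgebra_inv_ring]
  subalgebra_mult[OF subalgebra_inv_ring] subalgebra_0[OF subalgebra_inv_ring]
  subalgebra_1[OF subalgebra_inv_ring] subalgebra_sum[OF subalgebra_inv_ring]

text \<open>A derivation that kills all \<open>t\<^sub>i\<close> kills \<open>R\<close>, over which \<open>S\<close> is algebraic.\<close>

lemma derivation_zero_if_zero_on_t:
  assumes "\<And>i. i \<in> {1..CARD('n)} \<Longrightarrow> der_app \<theta> (t i) = 0"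
  shows "\<theta> = 0"
proof (rule derivation_zero_if_zero_on_invariants)
  have "subalgebra {r. der_app \<theta> r = 0}"
    by (auto simp: subalgebra_def der_app_add der_app_mult)
  then have "adjoin t {1..CARD('n)} \<subseteq> {r. der_app \<theta> r = 0}"
    by (rule adjoin_least) (use assms in auto)
  then show "der_app \<theta> r = 0" if "r \<in> R" for r
    using that by (auto simp: R_eq)
qed

lemma derivation_eqI_t:
  assumes "\<And>i. i \<in> {1..CARD('n)} \<Longrightarrow> der_app \<theta> (t i) = der_app \<phi> (t i)"
  shows "\<theta> = \<phi>"
  using derivation_zero_if_zero_on_t[of "\<theta> - \<phi>"] assms by (simp add: der_app_minus_left)

text \<open>
  The Jacobian matrix of \<open>t\<close> has trivial kernel, so it is invertible and the derivations
  \<open>\<partial>\<^sub>t\<^sub>j\<close> exist.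
\<close>

lemma partial_t_app:
  assumes "i \<in> {1..CARD('n)}"
  shows "der_app (pt j) (t i) = (if i = j then 1 else 0)"
proof -
  obtain b :: "'n \<Rightarrow> nat" where b: "bij_betw b UNIV {1..CARD('n)}"
    using finite_same_card_bij[of "UNIV :: 'n set" "{1..CARD('n)}"] by auto
  have b_ex: "\<exists>k. i = b k" if "i \<in> {1..CARD('n)}" for i
    using bij_betw_imp_surj_on[OF b] that by blast
  define A where "A = (\<chi> i k. pderiv_rat k (t (b i)))"
  have A: "A *v \<theta> = (\<chi> i. der_app \<theta> (t (b i)))" for \<theta>
    by (simp add: A_def matrix_vector_mult_def der_app_def mult.commute)
  have "\<theta> = 0" if \<theta>: "A *v \<theta> = 0" for \<theta>
  proof (rule derivation_zero_if_zero_on_t)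
    fix i assume "i \<in> {1..CARD('n)}"
    then obtain k where "i = b k"
      using b_ex by blast
    then show "der_app \<theta> (t i) = 0"
      using \<theta> by (simp add: A vec_eq_iff)
  qed
  then obtain B where "B ** A = mat 1"
    using matrix_left_invertible_ker[of A] by auto
  then have AB: "A ** B = mat 1"
    using matrix_left_right_inverse by blast
  define \<theta> where "\<theta> = B *v (\<chi> k. if b k = j then 1 else 0)"
  have "A *v \<theta> = (\<chi> k. if b k = j then 1 else 0)"
    by (simp add: \<theta>_def matrix_vector_mul_assoc AB)
  then have \<theta>: "der_app \<theta> (t (b k)) = (if b k = j then 1 else 0)" for k
    by (simp add: A vec_eq_iff)
  have "\<exists>!\<theta>. \<forall>i\<in>{1..CARD('n)}. der_app \<theta> (t i) = (if i = j then 1 else 0)"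
  proof (rule ex1I[of _ \<theta>])
    show "\<forall>i\<in>{1..CARD('n)}. der_app \<theta> (t i) = (if i = j then 1 else 0)"
    proof
      fix i assume "i \<in> {1..CARD('n)}"
      then obtain k where "i = b k"
        using b_ex by blast
      then show "der_app \<theta> (t i) = (if i = j then 1 else 0)"
        using \<theta> by simp
    qed
    then show "\<phi> = \<theta>" if "\<forall>i\<in>{1..CARD('n)}. der_app \<phi> (t i) = (if i = j then 1 else 0)" for \<phi>
      using that by (intro derivation_eqI_t) auto
  qed
  from theI'[OF this] show ?thesis
    using assms by (simp add: partial_t_def)
qed

lemma expand_partial_t: "\<theta> = (\<Sum>j\<in>{1..CARD('n)}. der_app \<theta> (t j) *s pt j)"
proof (rule derivation_eqI_t)
  fix i assume i: "i \<in> {1..CARD('n)}"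
  have "der_app (\<Sum>j\<in>{1..CARD('n)}. der_app \<theta> (t j) *s pt j) (t i) = (\<Sum>j\<in>{1..CARD('n)}. if j = i then der_app \<theta> (t j) else 0)"
    unfolding der_app_sum_left
    by (rule sum.cong) (use i in \<open>auto simp: der_app_scale_left partial_t_app\<close>)
  then show "der_app \<theta> (t i) = der_app (\<Sum>j\<in>{1..CARD('n)}. der_app \<theta> (t j) *s pt j) (t i)"
    using i by simp
qed

lemma partial_t_R:
  assumes "r \<in> R"
  shows "der_app (pt j) r \<in> R"
proof -
  let ?A = "{r \<in> R. der_app (pt j) r \<in> R}"
  have "subalgebra ?A"
    by (auto simp: subalgebra_def der_app_add der_app_mult R_closed)
  then have "adjoin t {1..CARD('n)} \<subseteq> ?A"
    by (rule adjoin_least) (auto simp: t_R partial_t_app R_closed)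
  then show ?thesis
    using assms R_eq by blast
qed

lemma partial_t_inv: "inv_der (pt j)"
  unfolding inv_der_def
proof
  fix w assume w: "w \<in> W"
  show "act_der w (pt j) = pt j"
  proof (rule derivation_eqI_t)
    fix i assume i: "i \<in> {1..CARD('n)}"
    have "act w (if i = j then 1 else 0) = (if i = j then 1 else 0)"
      using w by (simp add: hom_0[OF is_hom_act] hom_1[OF is_hom_act])
    then show "der_app (act_der w (pt j)) (t i) = der_app (pt j) (t i)"
      using i w by (simp add: der_app_act_der inv_ring_act t_R partial_t_app)
  qed
qed

lemma partial_t_Dlog1: "pt j \<in> Dlog 1"
proof -
  have R: "der_app (pt j) r \<in> polys" if "r \<in> R" for r
    using partial_t_R[OF that] by (rule inv_ring_polys)
  have bound: "der_app (pt j) (lin x) \<in> vge (\<alpha> H) (1 - int (stab_order W H))" if "H \<in> \<A>" for H x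
    using pole_bound[OF R, of "\<alpha> H" x] that by (simp add: inertia_\<alpha> stab_order_eq)
  have "regular_at H (pt j)" if H: "H \<in> \<A>" for H
    unfolding regular_at_def
  proof (intro allI impI)
    fix \<beta> assume \<beta>: "form_app \<beta> (coroot H) = 0"
    have "der_app (pt j) (lin \<beta>) \<in> vge (\<alpha> H) (0 * int (stab_order W H))"
      using inv_der_perp[OF H partial_t_inv \<beta>] bound[OF H, of \<beta>]
      by (intro vge_invariant[OF H]) (auto simp: algebra_simps)
    then show "der_app (pt j) (lin \<beta>) \<in> vge (\<alpha> H) 0"
      by simp
  qed
  then show ?thesis
    using bound by (simp add: Dlog_iff Dlog_inf_iff partial_t_inv in_DerS'[OF R])
qed

text \<open>
  The coefficients \<open>\<theta>(t\<^sub>j)\<close> of \<open>\<theta>\<close> have no poles along any \<open>H\<close>, so they are invariant polynomials.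
\<close>

lemma Dlog1_eq_DerR: "Dlog 1 = DerR W t"
proof (intro equalityI subsetI)
  fix \<theta> assume \<theta>: "\<theta> \<in> Dlog 1"
  have "der_app \<theta> (t j) \<in> R" if j: "j \<in> {1..CARD('n)}" for j
  proof -
    have inv: "inv_der \<theta>" and D: "\<theta> \<in> DerS' W \<alpha>"
      using \<theta> Dlog_imp_Dlog_inf Dlog_inf_inv Dlog_inf_DerS' by blast+
    have "der_app \<theta> (t j) \<in> vge (\<alpha> H) 0" if "H \<in> \<A>" for H
      using \<theta> that by (intro regular_on_invariants t_R j) (auto simp: Dlog_iff Dlog_inf_iff)
    then have "der_app \<theta> (t j) \<in> polys"
      by (rule S'_regular_imp_polys[OF DerS'_app[OF D polys_S'[OF inv_ring_polys[OF t_R[OF j]]]]])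
    then show ?thesis
      using inv j by (simp add: inv_ring_def inv_der_act) (simp add: inv_ring_act t_R)
  qed
  then show "\<theta> \<in> DerR W t"
    unfolding DerR_def combinations_def
    using expand_partial_t[of \<theta>] by (intro CollectI exI[of _ "\<lambda>j. der_app \<theta> (t j)"]) auto
next
  fix \<theta> assume "\<theta> \<in> DerR W t"
  then show "\<theta> \<in> Dlog 1"
    by (auto simp: DerR_def combinations_def intro!: Dlog_sum Dlog_scale partial_t_Dlog1)
qed

lemma primitive_Dlog1: "primitive t \<in> Dlog 1"
  by (simp add: primitive_def partial_t_Dlog1)

lemma D_inv: "inv_der (primitive t)"
  by (simp add: primitive_def partial_t_inv)

lemma \<alpha>_not_proportional:
  assumes "H \<in> \<A>" "H' \<in> \<A>" "H \<noteq> H'"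
  shows "\<alpha> H' \<noteq> c *s \<alpha> H"
proof
  assume *: "\<alpha> H' = c *s \<alpha> H"
  then have "c \<noteq> 0"
    using \<alpha>_nonzero[OF assms(2)] by auto
  then show False
    using hyperplane_eq[OF assms(1)] hyperplane_eq[OF assms(2)] assms(3)
    by (simp add: * form_app_scale)
qed

text \<open>
  Comparing orders along \<open>H\<close> in \<open>\<theta>(\<Delta>) \<in> R \<Delta>\<close> with \<open>\<Delta> = \<alpha>\<^sub>H\<^sup>e \<Delta>'\<close> shows that \<open>\<theta>(\<alpha>\<^sub>H)\<close> cannot
  have the pole of order \<open>e\<^sub>H - 1\<close> that is allowed in \<open>Der\<^sub>R\<close>; then it vanishes on \<open>H\<close>.
\<close>

lemma DerR_log_subset_Dlog0: "DerR_log W \<alpha> t \<subseteq> Dlog 0"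
proof
  fix \<theta> assume \<theta>: "\<theta> \<in> DerR_log W \<alpha> t"
  then have \<theta>1: "\<theta> \<in> Dlog 1"
    by (simp add: DerR_log_def Dlog1_eq_DerR)
  obtain f where f: "f \<in> R" "der_app \<theta> (discriminant W \<alpha>) = f * discriminant W \<alpha>"
    using \<theta> by (auto simp: DerR_log_def)
  have "der_app \<theta> (lin (\<alpha> H)) \<in> vge (\<alpha> H) (0 * int (stab_order W H) + 1)" if H: "H \<in> \<A>" for H
  proof (rule vge_semi_invariant[OF H])
    let ?a = "\<alpha> H" and ?e = "stab_order W H" and ?b = "der_app \<theta> (lin (\<alpha> H))"
    note a = \<alpha>_nonzero[OF H]
    show "act g ?b = cst (chi H g) * ?b" if "g \<in> stabilizer H" for g
      by (rule inv_der_\<alpha>[OF H Dlog_inf_inv[OF Dlog_imp_Dlog_inf[OF \<theta>1]] that])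
    define \<Delta>' where "\<Delta>' = (\<Prod>H'\<in>\<A> - {H}. lin (\<alpha> H') ^ stab_order W H')"
    have \<Delta>: "discriminant W \<alpha> = lin ?a ^ ?e * \<Delta>'"
      unfolding discriminant_def \<Delta>'_def by (rule prod.remove) (use H in auto)
    have \<Delta>'_polys: "\<Delta>' \<in> polys"
      unfolding \<Delta>'_def by (intro polys_closed polys_lin)
    have \<Delta>'_unit: "\<Delta>' \<noteq> 0" "vord ?a \<Delta>' = 0"
    proof -
      show "\<Delta>' \<noteq> 0"
        by (auto simp: \<Delta>'_def)
      have "vord ?a \<Delta>' = (\<Sum>H'\<in>\<A> - {H}. vord ?a (lin (\<alpha> H') ^ stab_order W H'))"
        unfolding \<Delta>'_def by (rule vord_prod[OF a]) auto
      also have "\<dots> = 0"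
      proof (rule sum.neutral, rule ballI)
        fix H' assume H': "H' \<in> \<A> - {H}"
        then have "vord ?a (lin (\<alpha> H')) = 0"
          using \<alpha>_not_proportional[OF H, of H'] by (intro vord_lin_not_proportional[OF a]) auto
        then show "vord ?a (lin (\<alpha> H') ^ stab_order W H') = 0"
          using H' by (subst vord_power[OF a]) auto
      qed
      finally show "vord ?a \<Delta>' = 0" .
    qed
    have reg: "regular_at H \<theta>"
      using Dlog_imp_Dlog_inf[OF \<theta>1] H by (simp add: Dlog_inf_iff)
    have "?b \<in> vge ?a (1 - int ?e)"
      using Dlog_\<alpha>[OF \<theta>1 H] by simp
    then have "der_app \<theta> (lin x) \<in> vge ?a (1 - int ?e)" for x
      by (rule regular_at_bound[OF H reg]) (use stab_order_ge_2[OF H] in simp)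
    then have "der_app \<theta> (var i) \<in> vge ?a (1 - int ?e)" for i
      by (metis lin_axis)
    then have \<theta>\<Delta>': "der_app \<theta> \<Delta>' \<in> vge ?a (1 - int ?e)"
      by (rule deriv_localization[OF a is_deriv_der_app _ vge_polys[OF a \<Delta>'_polys]])
    have "of_nat ?e * lin ?a ^ (?e - 1) * ?b * \<Delta>' = f * (lin ?a ^ ?e * \<Delta>') - lin ?a ^ ?e * der_app \<theta> \<Delta>'"
      using f(2) unfolding \<Delta> der_app_mult der_app_power by (simp add: algebra_simps)
    also have "\<dots> \<in> vge ?a 1"
    proof (rule vge_diff[OF a])
      have pow: "lin ?a ^ ?e \<in> vge ?a (int ?e)"
        using a by (simp add: vge_def vord_power)
      have "f * \<Delta>' \<in> vge ?a 0"
        by (intro vge_polys[OF a] polys_closed(3) inv_ring_polys[OF f(1)] \<Delta>'_polys)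
      from vge_mult[OF a pow this] have "lin ?a ^ ?e * (f * \<Delta>') \<in> vge ?a 1"
        by (rule vge_mono) (use stab_order_ge_2[OF H] in simp)
      then show "f * (lin ?a ^ ?e * \<Delta>') \<in> vge ?a 1"
        by (simp add: mult_ac)
      show "lin ?a ^ ?e * der_app \<theta> \<Delta>' \<in> vge ?a 1"
        using vge_mult[OF a pow \<theta>\<Delta>'] by simp
    qed
    finally have ge: "of_nat ?e * lin ?a ^ (?e - 1) * ?b * \<Delta>' \<in> vge ?a 1" .
    show "?b \<in> vge ?a ((0 - 1) * int ?e + 2)"
    proof (cases "?b = 0")
      case False
      have nz: "(of_nat ?e :: 'n ratfun) \<noteq> 0"
        using stab_order_ge_2[OF H] by (simp add: of_nat_ratfun_eq_0_iff)
      have "vord ?a (of_nat ?e :: 'n ratfun) = 0"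
        using stab_order_ge_2[OF H] a by (simp flip: cst_of_nat)
      then have "vord ?a (of_nat ?e * lin ?a ^ (?e - 1) * ?b * \<Delta>') = int (?e - 1) + vord ?a ?b"
        using False a nz \<Delta>'_unit by (simp add: vord_mult vord_power)
      then show ?thesis
        using ge False a nz \<Delta>'_unit stab_order_ge_2[OF H] by (simp add: vge_def of_nat_diff)
    qed simp
  qed
  then show "\<theta> \<in> Dlog 0"
    using Dlog_imp_Dlog_inf[OF \<theta>1] by (simp add: Dlog_iff)
qed

end

context flat_setting
begin

section \<open>The primitive derivation along a reflecting hyperplane\<close>

lemma D_is_deriv: "is_deriv D"
  by (rule is_deriv_der_app)

lemma D_lin_bound: "H \<in> \<A> \<Longrightarrow> D (lin a) \<in> vge (\<alpha> H) (1 - int (stab_order W H))"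
  by (rule regular_at_bound)
    (use Dlog_\<alpha>[OF primitive_Dlog1, of H] Dlog_imp_Dlog_inf[OF primitive_Dlog1] stab_order_ge_2[of H] in
      \<open>auto simp: Dlog_inf_iff\<close>)

lemma D_perp: "H \<in> \<A> \<Longrightarrow> form_app \<beta> (coroot H) = 0 \<Longrightarrow> D (lin \<beta>) \<in> vge (\<alpha> H) 0"
  by (rule Dlog_inf_perp[OF Dlog_imp_Dlog_inf[OF primitive_Dlog1]])

lemma D_act: "w \<in> W \<Longrightarrow> act w (D f) = D (act w f)"
  by (rule inv_der_act[OF D_inv])

text \<open>
  \<open>D\<close> creates poles of order at most \<open>e\<^sub>H - 1\<close>, and a function invariant under the stabilizer with
  such a bound on its pole is regular.
\<close>

lemma D_regular_invariant:
  assumes H: "H \<in> \<A>" and f: "f \<in> vge (\<alpha> H) 0" and inv: "\<And>g. g \<in> stabilizer H \<Longrightarrow> act g f = f"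
  shows "D f \<in> vge (\<alpha> H) 0"
proof -
  have "D (var i) \<in> vge (\<alpha> H) (1 - int (stab_order W H))" for i
    using D_lin_bound[OF H, of "axis i 1"] by simp
  from deriv_localization[OF \<alpha>_nonzero[OF H] D_is_deriv this f]
  have "D f \<in> vge (\<alpha> H) (0 * int (stab_order W H))"
    using inv by (intro vge_invariant[OF H]) (auto simp: D_act stabilizer_W)
  then show ?thesis by simp
qed

lemma nablaD_bij: "bij_betw nablaD (DerR_log W \<alpha> t) (Dlog 1)"
  using flat by (simp add: flat_system_def module_iso_def Dlog1_eq_DerR)

text \<open>
  If the pole of \<open>D \<alpha>\<^sub>H\<close> had smaller order, then by semi-invariance there would be none, and \<open>D\<close>
  would map the local ring of \<open>H\<close> into itself.  All \<open>\<partial>\<^sub>t\<^sub>j = \<nabla>\<^sub>D \<theta>\<^sub>j\<close>, with logarithmic and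
  therefore regular \<open>\<theta>\<^sub>j\<close>, would be regular along \<open>H\<close>, and again by semi-invariance they would be
  tangent to \<open>H\<close>.  But the constant field normal to \<open>H\<close> is a combination of them with polynomial
  coefficients.
\<close>

lemma D_\<alpha>_exact:
  assumes H: "H \<in> \<A>"
  shows "D (lin (\<alpha> H)) \<noteq> 0 \<and> vord (\<alpha> H) (D (lin (\<alpha> H))) = 1 - int (stab_order W H)"
proof (rule ccontr)
  let ?a = "\<alpha> H" and ?e = "int (stab_order W H)"
  note a = \<alpha>_nonzero[OF H]
  have e2: "?e \<ge> 2"
    using stab_order_ge_2[OF H] by simp
  assume "\<not> (D (lin ?a) \<noteq> 0 \<and> vord ?a (D (lin ?a)) = 1 - ?e)"
  then have "D (lin ?a) \<in> vge ?a ((0 - 1) * ?e + 2)"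
    using D_lin_bound[OF H, of ?a] by (auto simp: vge_def)
  then have "D (lin ?a) \<in> vge ?a (0 * ?e + 1)"
    using inv_der_\<alpha>[OF H D_inv] by (intro vge_semi_invariant[OF H]) auto
  then have "D (lin ?a) \<in> vge ?a 0"
    by (rule vge_mono) simp
  moreover have "regular_at H (primitive t)"
    using D_perp[OF H] by (simp add: regular_at_def)
  ultimately have "D (lin b) \<in> vge ?a 0" for b
    using regular_at_bound[OF H, of "primitive t" 0 b] by simp
  then have "D (var i) \<in> vge ?a 0" for i
    by (metis lin_axis)
  then have D_reg: "D f \<in> vge ?a 0" if "f \<in> vge ?a 0" for f
    by (rule deriv_localization[OF a D_is_deriv _ that])
  have tangent: "der_app (pt j) (lin ?a) \<in> vge ?a 1" for j
  proof -
    obtain \<theta> where \<theta>: "\<theta> \<in> DerR_log W \<alpha> t" "pt j = nablaD \<theta>"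
      using nablaD_bij partial_t_Dlog1[of j] unfolding bij_betw_def by blast
    have "\<theta> \<in> Dlog 0"
      using \<theta>(1) DerR_log_subset_Dlog0 by blast
    from Dlog_\<alpha>[OF this H] have "der_app \<theta> (lin ?a) \<in> vge ?a 1"
      by simp
    then have "der_app \<theta> (lin ?a) \<in> vge ?a 0"
      by (rule vge_mono) simp
    from D_reg[OF this] have "der_app (pt j) (lin ?a) \<in> vge ?a 0"
      by (simp add: \<theta>(2) der_app_nabla_lin)
    then have "der_app (pt j) (lin ?a) \<in> vge ?a ((0 - 1) * ?e + 2)"
      by (rule vge_mono) (use e2 in simp)
    then have "der_app (pt j) (lin ?a) \<in> vge ?a (0 * ?e + 1)"
      using inv_der_\<alpha>[OF H partial_t_inv] by (intro vge_semi_invariant[OF H]) auto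
    then show ?thesis
      by simp
  qed
  have "der_app (normal_der H) (lin ?a) =
      (\<Sum>j\<in>{1..CARD('n)}. der_app (normal_der H) (t j) * der_app (pt j) (lin ?a))"
    by (subst expand_partial_t[of "normal_der H"]) (simp add: der_app_sum_left der_app_scale_left)
  also have "\<dots> \<in> vge ?a 1"
    by (intro vge_sum[OF a] vge_mult0[OF a vge_polys[OF a normal_der_polys]] tangent inv_ring_polys t_R)
  finally have "(1 :: 'n ratfun) \<in> vge ?a 1"
    by (simp add: normal_der_lin H)
  then show False
    using a by (simp add: vge_def)
qed

text \<open>
  \<open>D\<close> lowers the order of semi-invariants by exactly \<open>e\<^sub>H\<close>: for \<open>f = \<alpha>\<^sup>m u\<close> the leading term of
  \<open>D f\<close> is \<open>m \<alpha>\<^sup>m\<^sup>-\<^sup>1 (D \<alpha>) u\<close>, where \<open>m \<noteq> 0\<close> because \<open>m\<close> is congruent to \<open>1\<close> modulo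
  \<open>e\<^sub>H \<ge> 2\<close>.
\<close>

lemma D_semi_invariant_exact:
  assumes H: "H \<in> \<A>" and f: "f \<noteq> 0"
    and inv: "\<And>g. g \<in> stabilizer H \<Longrightarrow> act g f = cst (chi H g) * f"
  shows "D f \<noteq> 0" "vord (\<alpha> H) (D f) = vord (\<alpha> H) f - int (stab_order W H)"
proof -
  let ?a = "\<alpha> H" and ?e = "int (stab_order W H)"
  note a = \<alpha>_nonzero[OF H]
  have la: "lin ?a \<noteq> 0"
    using a by simp
  define m where "m = vord ?a f"
  have e2: "?e \<ge> 2"
    using stab_order_ge_2[OF H] by simp
  have dvd: "?e dvd m - 1"
    unfolding m_def by (rule order_of_semi_invariant[OF H f inv])
  then obtain q where q: "m = 1 + ?e * q"
    by (metis add.commute diff_add_cancel dvdE)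
  have m0: "m \<noteq> 0"
  proof
    assume "m = 0"
    then have "?e dvd 1"
      using dvd by (metis diff_0 dvd_minus_iff)
    then show False
      using e2 by (simp add: zdvd1_eq)
  qed
  define u where "u = f / lin ?a powi m"
  have f_eq: "f = lin ?a powi m * u"
    using la by (simp add: u_def)
  have u: "u \<noteq> 0" "vord ?a u = 0"
    using f la a by (simp_all add: u_def vord_divide vord_powi m_def)
  have u_inv: "act g u = u" if g: "g \<in> stabilizer H" for g
  proof -
    note h = is_hom_act[OF stabilizer_invertible[OF g]]
    have cst_powi: "cst z powi m = cst (z powi m)" for z
      by (simp add: power_int_def cst_power cst_inverse)
    have "chi H g powi m = chi H g * (chi H g ^ stab_order W H) powi q"
      using chi_nonzero[OF H g] by (simp add: q power_int_add power_int_mult)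
    then have chi_m: "chi H g powi m = chi H g"
      by (simp add: chi_power_order[OF H g])
    have "act g u = (cst (chi H g) * f) / (cst (chi H g powi m) * lin ?a powi m)"
      unfolding u_def hom_divide[OF h] hom_powi[OF h] act_\<alpha>[OF H g] inv[OF g] power_int_mult_distrib cst_powi ..
    then show ?thesis
      using chi_nonzero[OF H g] by (simp add: chi_m u_def)
  qed
  have Du: "D u \<in> vge ?a 0"
    by (rule D_regular_invariant[OF H _ u_inv]) (simp add: vge_def u)
  define x where "x = of_int m * lin ?a powi (m - 1) * D (lin ?a) * u"
  define y where "y = lin ?a powi m * D u"
  have Df: "D f = x + y"
    by (subst f_eq) (simp add: x_def y_def der_app_mult der_app_powi[OF la])
  note D\<alpha> = D_\<alpha>_exact[OF H]
  have mF: "(of_int m :: 'n ratfun) \<noteq> 0" "vord ?a (of_int m :: 'n ratfun) = 0"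
    using m0 a by (simp_all flip: cst_of_int)
  have x: "x \<noteq> 0" "vord ?a x = m - ?e"
    using D\<alpha> mF u la a by (simp_all add: x_def vord_mult vord_powi)
  have "lin ?a powi m \<in> vge ?a m"
    using la a by (simp add: vge_def vord_powi)
  from vge_mult[OF a this Du] have "y \<in> vge ?a m"
    by (simp add: y_def)
  then have "y \<in> vge ?a (vord ?a x + 1)"
    by (rule vge_mono) (use x e2 in simp)
  from vord_add_eq[OF a x(1) this] show "D f \<noteq> 0" "vord ?a (D f) = vord ?a f - ?e"
    using x by (simp_all add: Df m_def)
qed

section \<open>The operator \<open>\<nabla>\<^sub>D\<close> on logarithmic vector fields\<close>

lemma nablaD_Dlog_inf:
  assumes "\<theta> \<in> Dlog_inf"
  shows "nablaD \<theta> \<in> Dlog_inf"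
  unfolding Dlog_inf_iff regular_at_def
proof (intro conjI ballI allI impI)
  show "inv_der (nablaD \<theta>)"
    by (rule inv_derI) (simp add: der_app_nabla_lin D_act inv_der_act_lin Dlog_inf_inv[OF assms])
  show "nablaD \<theta> \<in> DerS' W \<alpha>"
    using Dlog_inf_DerS'[OF assms] DerS'_app[OF Dlog_inf_DerS'[OF Dlog_imp_Dlog_inf[OF primitive_Dlog1]]]
    by (simp add: DerS'_iff nabla_def)
  fix H \<beta> assume H: "H \<in> \<A>" and \<beta>: "form_app \<beta> (coroot H) = 0"
  show "der_app (nablaD \<theta>) (lin \<beta>) \<in> vge (\<alpha> H) 0"
    unfolding der_app_nabla_lin
    using Dlog_inf_perp[OF assms H \<beta>] inv_der_perp[OF H Dlog_inf_inv[OF assms] \<beta>]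
    by (rule D_regular_invariant[OF H])
qed

lemma nablaD_exact:
  assumes H: "H \<in> \<A>" and \<theta>: "\<theta> \<in> Dlog_inf"
  shows "der_app (nablaD \<theta>) (lin (\<alpha> H)) \<in> vge (\<alpha> H) (m - int (stab_order W H)) \<longleftrightarrow>
    der_app \<theta> (lin (\<alpha> H)) \<in> vge (\<alpha> H) m"
proof (cases "der_app \<theta> (lin (\<alpha> H)) = 0")
  case False
  from D_semi_invariant_exact[OF H this inv_der_\<alpha>[OF H Dlog_inf_inv[OF \<theta>]]] False
  show ?thesis
    by (simp add: der_app_nabla_lin vge_def)
qed (simp add: der_app_nabla_lin)

lemma nablaD_Dlog_iff:
  assumes \<theta>: "\<theta> \<in> Dlog_inf"
  shows "nablaD \<theta> \<in> Dlog (k + 1) \<longleftrightarrow> \<theta> \<in> Dlog k"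
proof -
  have "- (k + 1) * int (stab_order W H) + 1 = (- k * int (stab_order W H) + 1) - int (stab_order W H)" for H
    by (simp add: algebra_simps)
  then show ?thesis
    unfolding Dlog_iff using nablaD_exact[OF _ \<theta>] nablaD_Dlog_inf[OF \<theta>] \<theta> by metis
qed

lemma nablaD_inj: "inj_on nablaD Dlog_inf"
proof (rule inj_onI)
  fix \<theta> \<phi> assume *: "\<theta> \<in> Dlog_inf" "\<phi> \<in> Dlog_inf" "nablaD \<theta> = nablaD \<phi>"
  have diff: "\<theta> - \<phi> \<in> Dlog_inf"
    by (rule Dlog_inf_diff[OF *(1,2)])
  have "\<theta> - \<phi> = 0"
  proof (rule derivation_zero_if_zero_on_\<alpha>)
    fix H assume H: "H \<in> \<A>"
    have "D (der_app (\<theta> - \<phi>) (lin (\<alpha> H))) = 0"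
      using *(3) by (simp flip: der_app_nabla_lin add: nabla_diff)
    then show "der_app (\<theta> - \<phi>) (lin (\<alpha> H)) = 0"
      using D_semi_invariant_exact(1)[OF H _ inv_der_\<alpha>[OF H Dlog_inf_inv[OF diff]]] by blast
  qed
  then show "\<theta> = \<phi>" by simp
qed

text \<open>
  A field in \<open>\<D>(\<A>, 1)\<^sup>W\<close> has its image under \<open>\<nabla>\<^sub>D\<close> in \<open>Der\<^sub>R\<close>; this image also comes from a
  logarithmic field, and \<open>\<nabla>\<^sub>D\<close> is injective.
\<close>

lemma DerR_log_eq_Dlog0: "DerR_log W \<alpha> t = Dlog 0"
proof
  show "Dlog 0 \<subseteq> DerR_log W \<alpha> t"
  proof
    fix \<theta> assume \<theta>: "\<theta> \<in> Dlog 0"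
    have "nablaD \<theta> \<in> Dlog 1"
      using nablaD_Dlog_iff[OF Dlog_imp_Dlog_inf[OF \<theta>], of 0] \<theta> by simp
    then obtain \<phi> where \<phi>: "\<phi> \<in> DerR_log W \<alpha> t" "nablaD \<theta> = nablaD \<phi>"
      using nablaD_bij unfolding bij_betw_def by blast
    then have "\<phi> \<in> Dlog_inf"
      using DerR_log_subset_Dlog0 Dlog_imp_Dlog_inf by blast
    then have "\<theta> = \<phi>"
      using nablaD_inj \<phi>(2) Dlog_imp_Dlog_inf[OF \<theta>] by (auto simp: inj_on_def)
    then show "\<theta> \<in> DerR_log W \<alpha> t"
      using \<phi> by simp
  qed
qed (rule DerR_log_subset_Dlog0)

lemma nablaD_Dlog_nonpos:
  assumes "k \<le> 0"
  shows "nablaD ` Dlog k = Dlog (k + 1)"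
proof (intro equalityI subsetI)
  show "\<psi> \<in> Dlog (k + 1)" if "\<psi> \<in> nablaD ` Dlog k" for \<psi>
    using that nablaD_Dlog_iff Dlog_imp_Dlog_inf by blast
  fix \<psi> assume \<psi>: "\<psi> \<in> Dlog (k + 1)"
  then have "\<psi> \<in> Dlog 1"
    using Dlog_mono[of "k + 1" 1] assms by auto
  then obtain \<theta> where \<theta>: "\<theta> \<in> Dlog 0" "\<psi> = nablaD \<theta>"
    using nablaD_bij unfolding bij_betw_def DerR_log_eq_Dlog0 by blast
  then show "\<psi> \<in> nablaD ` Dlog k"
    using \<psi> nablaD_Dlog_iff[OF Dlog_imp_Dlog_inf[OF \<theta>(1)]] by blast
qed

end

context flat_setting
begin

section \<open>The flat structure\<close>

abbreviation "T \<equiv> T_ring t"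
abbreviation "M \<equiv> M_mat t \<eta>"
abbreviation "b \<equiv> B_inf W d"
abbreviation "t_last \<equiv> t CARD('n)"
abbreviation "nabla_inverse \<equiv> nabla_inv W \<alpha> t"

lemma subalgebra_T: "subalgebra T"
  unfolding T_ring_def by (rule subalgebra_adjoin)

lemmas T_closed =
  subalgebra_cst[OF subalgebra_T] subalgebra_add[OF subalgebra_T]
  subalgebra_mult[OF subalgebra_T] subalgebra_0[OF subalgebra_T]
  subalgebra_1[OF subalgebra_T]

lemma T_subset_R: "T \<subseteq> R"
  unfolding T_ring_def by (rule adjoin_least[OF subalgebra_inv_ring]) (auto intro: t_R)

lemma last_in: "CARD('n) \<in> {1..CARD('n)}"
  by (simp add: Suc_leI)

lemma t_last_R: "t_last \<in> R"
  by (rule t_R[OF last_in])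

lemma D_t: "i \<in> {1..CARD('n)} \<Longrightarrow> D (t i) = (if i = CARD('n) then 1 else 0)"
  by (simp add: primitive_def partial_t_app)

lemma D_t_last: "D t_last = 1"
  using D_t[OF last_in] by simp

lemma D_T: "f \<in> T \<Longrightarrow> D f = 0"
proof -
  assume "f \<in> T"
  have "subalgebra {f. D f = 0}"
    by (auto simp: subalgebra_def der_app_add der_app_mult)
  then have "T \<subseteq> {f. D f = 0}"
    unfolding T_ring_def by (rule adjoin_least) (auto simp: D_t)
  with \<open>f \<in> T\<close> show ?thesis by blast
qed

definition M0 :: "nat \<Rightarrow> nat \<Rightarrow> 'n ratfun" where
  "M0 i j = M i j - (if i = j then t_last else 0)"

lemma M0_T: "i \<in> {1..CARD('n)} \<Longrightarrow> j \<in> {1..CARD('n)} \<Longrightarrow> M0 i j \<in> T"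
  using flat unfolding M0_def flat_system_def by blast

lemma M_eq: "M i j = M0 i j + (if i = j then t_last else 0)"
  by (simp add: M0_def)

lemma M_R: "i \<in> {1..CARD('n)} \<Longrightarrow> j \<in> {1..CARD('n)} \<Longrightarrow> M i j \<in> R"
  unfolding M_eq using M0_T T_subset_R t_last_R by (auto intro!: R_closed)

lemma D_M: "i \<in> {1..CARD('n)} \<Longrightarrow> j \<in> {1..CARD('n)} \<Longrightarrow> D (M i j) = (if i = j then 1 else 0)"
  unfolding M_eq by (simp add: der_app_add D_T[OF M0_T] D_t_last)

lemma nabla_inverse_Dlog1:
  assumes "\<psi> \<in> Dlog 1"
  shows "nabla_inverse \<psi> \<in> Dlog 0" "nablaD (nabla_inverse \<psi>) = \<psi>"
proof -
  have "\<psi> \<in> nablaD ` Dlog 0"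
    using assms nablaD_bij by (simp add: bij_betw_def DerR_log_eq_Dlog0)
  then show "nabla_inverse \<psi> \<in> Dlog 0" "nablaD (nabla_inverse \<psi>) = \<psi>"
    unfolding nabla_inv_def DerR_log_eq_Dlog0 by (auto intro: inv_into_into f_inv_into_f)
qed

lemma partial_t_nonzero: "i \<in> {1..CARD('n)} \<Longrightarrow> pt i \<noteq> 0"
  using partial_t_app[of i i] by auto

lemma nabla_inverse_partial_t:
  "i \<in> {1..CARD('n)} \<Longrightarrow>
    nabla_inverse (pt i) = (\<Sum>j=1..CARD('n). (- cst (inverse (b i)) * M i j) *s pt j)"
  using flat unfolding flat_system_def by blast

text \<open>
  For \<open>b\<^sub>i = 0\<close> the convention \<open>inverse 0 = 0\<close> would turn the formula for \<open>\<nabla>\<^sub>D\<^sup>-\<^sup>1 \<partial>\<^sub>t\<^sub>i\<close> into \<open>0\<close>,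
  although \<open>\<partial>\<^sub>t\<^sub>i\<close> is not the image of \<open>0\<close>.
\<close>

lemma b_nonzero:
  assumes "i \<in> {1..CARD('n)}"
  shows "b i \<noteq> 0"
proof
  assume "b i = 0"
  then have "nabla_inverse (pt i) = 0"
    by (simp add: nabla_inverse_partial_t[OF assms])
  then have "pt i = 0"
    using nabla_inverse_Dlog1(2)[OF partial_t_Dlog1[of i]] by simp
  then show False
    using partial_t_nonzero[OF assms] by simp
qed

lemma M_row:
  assumes i: "i \<in> {1..CARD('n)}"
  shows "(\<Sum>j=1..CARD('n). M i j *s pt j) = cst (- b i) *s nabla_inverse (pt i)"
proof -
  have "cst (- b i) * (- cst (inverse (b i)) * M i j) = M i j" for j
    using b_nonzero[OF i] by (simp add: cst_minus cst_inverse)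
  then show ?thesis
    by (simp only: nabla_inverse_partial_t[OF i] vec.scale_sum_right vec.scale_scale)
qed

subsection \<open>Iterates of the primitive derivative\<close>

text \<open>The fields \<open>\<nabla>\<^sub>D\<^sup>k \<partial>\<^sub>t\<^sub>j\<close>, which turn out to be bases of the modules with poles.\<close>

definition \<phi> :: "nat \<Rightarrow> nat \<Rightarrow> 'n derivation" where
  "\<phi> k j = (nablaD ^^ k) (pt j)"

lemma \<phi>_0 [simp]: "\<phi> 0 j = pt j"
  and \<phi>_Suc: "\<phi> (Suc k) j = nablaD (\<phi> k j)"
  by (simp_all add: \<phi>_def)

lemma nablaD_M_row:
  assumes i: "i \<in> {1..CARD('n)}"
  shows "nablaD (\<Sum>j=1..CARD('n). M i j *s \<phi> k j) = \<phi> k i + (\<Sum>j=1..CARD('n). M i j *s \<phi> (Suc k) j)"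
proof -
  have "(\<Sum>j=1..CARD('n). D (M i j) *s \<phi> k j) = (\<Sum>j=1..CARD('n). if j = i then \<phi> k i else 0)"
    by (rule sum.cong) (use i in \<open>auto simp: D_M\<close>)
  also have "\<dots> = \<phi> k i"
    using i by simp
  finally show ?thesis
    by (simp add: nabla_sum nabla_scale sum.distrib \<phi>_Suc)
qed

lemma eq_diff_if_add_eq: "x + y = z \<Longrightarrow> y = z - x" for x y z :: "'n derivation"
  by auto

text \<open>
  Differentiate \<open>M \<partial>\<^sub>t = - B \<nabla>\<^sub>D\<^sup>-\<^sup>1 \<partial>\<^sub>t\<close> repeatedly: since \<open>D M\<close> is the identity matrix, each step
  adds \<open>1\<close> to the constants.
\<close>

lemma M_\<phi>:
  assumes i: "i \<in> {1..CARD('n)}"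
  shows "(\<Sum>j=1..CARD('n). M i j *s \<phi> (Suc k) j) = cst (- (b i + of_nat (Suc k))) *s \<phi> k i"
proof (induction k)
  case 0
  have "\<phi> 0 i + (\<Sum>j=1..CARD('n). M i j *s \<phi> (Suc 0) j) = nablaD (cst (- b i) *s nabla_inverse (pt i))"
    using nablaD_M_row[OF i, of 0] M_row[OF i] by simp
  also have "\<dots> = cst (- b i) *s pt i"
    by (simp add: nabla_scale nabla_inverse_Dlog1 partial_t_Dlog1)
  finally have "(\<Sum>j=1..CARD('n). M i j *s \<phi> (Suc 0) j) = cst (- b i) *s pt i - \<phi> 0 i"
    by (rule eq_diff_if_add_eq)
  also have "\<dots> = (cst (- b i) - 1) *s pt i"
    by (simp add: vec.scale_left_diff_distrib)
  also have "cst (- b i) - 1 = cst (- (b i + of_nat (Suc 0)))"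
    by (simp add: cst_minus cst_diff cst_add)
  finally show ?case by simp
next
  case (Suc k)
  have "\<phi> (Suc k) i + (\<Sum>j=1..CARD('n). M i j *s \<phi> (Suc (Suc k)) j)
      = nablaD (cst (- (b i + of_nat (Suc k))) *s \<phi> k i)"
    using nablaD_M_row[OF i, of "Suc k"] Suc.IH by simp
  also have "\<dots> = cst (- (b i + of_nat (Suc k))) *s \<phi> (Suc k) i"
    by (simp add: nabla_scale \<phi>_Suc)
  finally have "(\<Sum>j=1..CARD('n). M i j *s \<phi> (Suc (Suc k)) j) =
      cst (- (b i + of_nat (Suc k))) *s \<phi> (Suc k) i - \<phi> (Suc k) i"
    by (rule eq_diff_if_add_eq)
  also have "\<dots> = (cst (- (b i + of_nat (Suc k))) - 1) *s \<phi> (Suc k) i"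
    by (simp add: vec.scale_left_diff_distrib)
  also have "cst (- (b i + of_nat (Suc k))) - 1 = (cst (- (b i + of_nat (Suc k)) - 1) :: 'n ratfun)"
    by (simp only: cst_diff cst_1)
  also have "- (b i + of_nat (Suc k)) - 1 = - (b i + of_nat (Suc (Suc k)))"
    by simp
  finally show ?case .
qed

lemma \<phi>_Dlog: "\<phi> k j \<in> Dlog (int k + 1)"
proof (induction k)
  case (Suc k)
  then show ?case
    using nablaD_Dlog_iff[OF Dlog_imp_Dlog_inf[OF Suc.IH], of "int k + 1"] by (simp add: \<phi>_Suc add_ac)
qed (simp add: partial_t_Dlog1)

lemma \<phi>_Dlog_inf: "\<phi> k j \<in> Dlog_inf"
  by (rule Dlog_imp_Dlog_inf[OF \<phi>_Dlog])

subsection \<open>No basic invariant has degree less than two\<close>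

lemma homogeneous_0_cst:
  assumes "homogeneous 0 f"
  obtains c where "f = cst c"
proof -
  obtain p where p: "f = to_F p" "\<forall>m\<in>Poly_Mapping.keys p. (\<Sum>i\<in>UNIV. Poly_Mapping.lookup m i) = 0"
    using assms by (auto simp: homogeneous_def)
  have "m = 0" if "m \<in> Poly_Mapping.keys p" for m
    using p(2) that by (intro poly_mapping_eqI) auto
  then have "p = Poly_Mapping.single 0 (Poly_Mapping.lookup p 0)"
    by (intro poly_mapping_eqI) (auto simp: lookup_single when_def in_keys_iff)
  then have "f = cst (Poly_Mapping.lookup p 0)"
    using p(1) by (simp add: cst_def)
  then show ?thesis by (rule that)
qed

lemma homogeneous_1_lin:
  fixes f :: "'n ratfun"
  assumes "homogeneous 1 f"
  obtains a where "f = lin a"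
proof -
  obtain p where p: "f = to_F p" "\<forall>m\<in>Poly_Mapping.keys p. (\<Sum>i\<in>UNIV. Poly_Mapping.lookup m i) = 1"
    using assms by (auto simp: homogeneous_def)
  have mono: "\<exists>a. to_F (Poly_Mapping.single m c) = lin a" if m: "(\<Sum>i\<in>UNIV. Poly_Mapping.lookup m i) = 1"
    for m :: "'n \<Rightarrow>\<^sub>0 nat" and c
  proof -
    obtain i where i: "Poly_Mapping.lookup m i \<noteq> 0"
      using m by (metis sum.neutral zero_neq_one)
    have "Poly_Mapping.lookup m i + (\<Sum>j\<in>UNIV - {i}. Poly_Mapping.lookup m j) = 1"
      using m by (simp add: sum.remove[of UNIV i])
    then have one: "Poly_Mapping.lookup m i = 1" and "(\<Sum>j\<in>UNIV - {i}. Poly_Mapping.lookup m j) = 0"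
      using i by linarith+
    then have "Poly_Mapping.lookup m j = 0" if "j \<noteq> i" for j
      using that by simp
    with one have "m = Poly_Mapping.single i 1"
      by (intro poly_mapping_eqI) (auto simp: lookup_single when_def)
    then have "to_F (Poly_Mapping.single m c) = lin (c *s axis i 1)"
      by (simp add: to_F_single lin_scale eval_monom_def del: One_nat_def)
    then show ?thesis by blast
  qed
  have "\<exists>a. to_F (\<Sum>m\<in>K. Poly_Mapping.single m (c m)) = lin a"
    if "finite K" "\<forall>m\<in>K. (\<Sum>i\<in>UNIV. Poly_Mapping.lookup m i) = 1" for K :: "('n \<Rightarrow>\<^sub>0 nat) set" and c
    using that
  proof (induction K)
    case empty
    show ?case by (rule exI[of _ 0]) simp
  next
    case (insert m K)
    then obtain a a' where "to_F (\<Sum>m\<in>K. Poly_Mapping.single m (c m)) = lin a"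
      "to_F (Poly_Mapping.single m (c m)) = lin a'"
      using mono by blast
    then have "to_F (\<Sum>m\<in>insert m K. Poly_Mapping.single m (c m)) = lin (a' + a)"
      using insert.hyps by (simp add: to_F_add lin_add)
    then show ?case by blast
  qed
  from this[of "Poly_Mapping.keys p" "Poly_Mapping.lookup p"] p(2)
  have "\<exists>a. f = lin a"
    unfolding p(1) mpoly_sum_monomials by simp
  then show ?thesis
    using that by blast
qed

text \<open>Constants are killed by \<open>\<partial>\<^sub>t\<^sub>i\<close>, and an irreducible group has no invariant linear form.\<close>

lemma degree_ge_2:
  assumes i: "i \<in> {1..CARD('n)}"
  shows "d i \<ge> 2"
proof (rule ccontr)
  assume "\<not> d i \<ge> 2"
  then consider "d i = 0" | "d i = 1"
    by linarith
  then show False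
  proof cases
    case 1
    then obtain c where "t i = cst c"
      using basic i homogeneous_0_cst by (metis basic_invariants_def)
    then show False
      using partial_t_app[OF i, of i] by simp
  next
    case 2
    then obtain a where a: "t i = lin a"
      using basic i homogeneous_1_lin by (metis basic_invariants_def)
    have "dact w a = a" if w: "w \<in> W" for w
    proof -
      have "lin (dact w a) = lin a"
        using inv_ring_act[OF t_R[OF i] w] w by (simp add: a act_lin)
      then have "lin (dact w a - a) = 0"
        by (simp add: lin_diff)
      then show ?thesis by simp
    qed
    then have "a = 0"
      by (rule no_invariant_form)
    then show False
      using partial_t_app[OF i, of i] by (simp add: a)
  qed
qed

text \<open>The number is \<open>(d\<^sub>i - 1) / h + k\<close>, where \<open>h > 0\<close>.\<close>

lemma b_shift_nonzero:
  assumes i: "i \<in> {1..CARD('n)}"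
  shows "b i + of_nat (Suc k) \<noteq> 0"
proof -
  define h where "h = (\<Sum>H\<in>\<A>. real (stab_order W H)) / real CARD('n)"
  have h: "coxeter_number W = complex_of_real h"
    by (simp add: coxeter_number_def h_def)
  have "(\<Sum>H\<in>\<A>. real (stab_order W H)) > 0"
    using arrangement_nonempty stab_order_ge_2 by (intro sum_pos) fastforce+
  then have "h > 0"
    by (simp add: h_def)
  have "b i + of_nat (Suc k) = complex_of_real ((real (d i) - 1) / h + real k)"
    by (simp add: B_inf_def h)
  moreover have "(real (d i) - 1) / h + real k > 0"
    using degree_ge_2[OF i] \<open>h > 0\<close> by (intro add_pos_nonneg divide_pos_pos) auto
  ultimately show ?thesis
    by (metis less_irrefl of_real_eq_0_iff)
qed

subsection \<open>Bases of the modules with poles\<close>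

lemma \<phi>_eq_M_\<phi>:
  assumes i: "i \<in> {1..CARD('n)}"
  shows "\<phi> k i = (\<Sum>j=1..CARD('n). (cst (inverse (- (b i + of_nat (Suc k)))) * M i j) *s \<phi> (Suc k) j)"
proof -
  let ?c = "- (b i + of_nat (Suc k))"
  have "(\<Sum>j=1..CARD('n). (cst (inverse ?c) * M i j) *s \<phi> (Suc k) j) =
      cst (inverse ?c) *s (\<Sum>j=1..CARD('n). M i j *s \<phi> (Suc k) j)"
    by (simp add: vec.scale_sum_right)
  also have "\<dots> = (cst (inverse ?c) * cst ?c) *s \<phi> k i"
    unfolding M_\<phi>[OF i] by (simp only: vec.scale_scale)
  also have "cst (inverse ?c) * cst ?c = (1 :: 'n ratfun)"
  proof -
    have "?c \<noteq> 0"
      using b_shift_nonzero[OF i, of k] by (simp only: neg_equal_0_iff_equal not_False_eq_True)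
    then show ?thesis
      unfolding cst_mult[symmetric] by (simp only: left_inverse cst_1 not_False_eq_True)
  qed
  finally show ?thesis by simp
qed

lemma combination_step:
  assumes A: "subalgebra A" and R: "R \<subseteq> A" and c: "\<forall>i\<in>{1..CARD('n)}. c i \<in> A"
  shows "\<exists>c'. (\<forall>j\<in>{1..CARD('n)}. c' j \<in> A) \<and>
    (\<Sum>i=1..CARD('n). c i *s \<phi> k i) = (\<Sum>j=1..CARD('n). c' j *s \<phi> (Suc k) j)"
proof -
  let ?m = "\<lambda>i j. cst (inverse (- (b i + of_nat (Suc k)))) * M i j"
  have "(\<Sum>i=1..CARD('n). c i *s \<phi> k i) = (\<Sum>i=1..CARD('n). \<Sum>j=1..CARD('n). (c i * ?m i j) *s \<phi> (Suc k) j)"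
  proof (rule sum.cong[OF refl])
    fix i assume i: "i \<in> {1..CARD('n)}"
    show "c i *s \<phi> k i = (\<Sum>j=1..CARD('n). (c i * ?m i j) *s \<phi> (Suc k) j)"
      by (subst \<phi>_eq_M_\<phi>[OF i]) (simp only: vec.scale_sum_right vec.scale_scale)
  qed
  also have "\<dots> = (\<Sum>j=1..CARD('n). (\<Sum>i=1..CARD('n). c i * ?m i j) *s \<phi> (Suc k) j)"
    by (subst sum.swap) (simp only: vec.scale_sum_left)
  moreover have "(\<Sum>i=1..CARD('n). c i * ?m i j) \<in> A" if "j \<in> {1..CARD('n)}" for j
  proof (rule subalgebra_sum[OF A])
    fix i assume i: "i \<in> {1..CARD('n)}"
    have "M i j \<in> A"
      using M_R[OF i that] R by blast
    then show "c i * ?m i j \<in> A"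
      using c i by (intro subalgebra_mult[OF A] subalgebra_cst[OF A]) auto
  qed
  ultimately show ?thesis by (intro exI[of _ "\<lambda>j. \<Sum>i=1..CARD('n). c i * ?m i j"]) simp
qed

lemma \<phi>_independent:
  assumes "(\<Sum>j=1..CARD('n). c j *s \<phi> k j) = 0" "j \<in> {1..CARD('n)}"
  shows "c j = 0"
  using assms
proof (induction k arbitrary: c j)
  case 0
  have "der_app (\<Sum>i=1..CARD('n). c i *s pt i) (t j) = (\<Sum>i=1..CARD('n). if i = j then c i else 0)"
    unfolding der_app_sum_left
    by (rule sum.cong) (use 0 in \<open>auto simp: der_app_scale_left partial_t_app\<close>)
  also have "\<dots> = c j"
    using 0(2) by simp
  finally show ?case
    using 0(1) by simp
next
  case (Suc k)
  obtain N where "inverse_matrices M N"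
    using flat by (auto simp: flat_system_def)
  then have NM: "(\<Sum>l=1..CARD('n). N i l * M l j) = (if i = j then 1 else 0)"
    if "i \<in> {1..CARD('n)}" "j \<in> {1..CARD('n)}" for i j
    using that unfolding inverse_matrices_def by blast
  define a where "a l = (\<Sum>i=1..CARD('n). c i * N i l)" for l
  have c: "c j = (\<Sum>l=1..CARD('n). a l * M l j)" if j: "j \<in> {1..CARD('n)}" for j
  proof -
    have "(\<Sum>l=1..CARD('n). a l * M l j) = (\<Sum>i=1..CARD('n). c i * (\<Sum>l=1..CARD('n). N i l * M l j))"
      unfolding a_def sum_distrib_right sum_distrib_left by (subst sum.swap) (simp only: mult.assoc)
    also have "\<dots> = (\<Sum>i=1..CARD('n). if i = j then c i else 0)"
      by (rule sum.cong) (use j NM in auto)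
    finally show ?thesis
      using j by simp
  qed
  have "(\<Sum>l=1..CARD('n). (a l * cst (- (b l + of_nat (Suc k)))) *s \<phi> k l)
      = (\<Sum>l=1..CARD('n). \<Sum>j=1..CARD('n). (a l * M l j) *s \<phi> (Suc k) j)"
  proof (rule sum.cong[OF refl])
    fix l assume l: "l \<in> {1..CARD('n)}"
    show "(a l * cst (- (b l + of_nat (Suc k)))) *s \<phi> k l = (\<Sum>j=1..CARD('n). (a l * M l j) *s \<phi> (Suc k) j)"
      unfolding vec.scale_scale[symmetric] vec.scale_sum_right[symmetric] M_\<phi>[OF l] ..
  qed
  also have "\<dots> = (\<Sum>j=1..CARD('n). (\<Sum>l=1..CARD('n). a l * M l j) *s \<phi> (Suc k) j)"
    by (subst sum.swap) (simp only: vec.scale_sum_left)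
  also have "\<dots> = (\<Sum>j=1..CARD('n). c j *s \<phi> (Suc k) j)"
    by (rule sum.cong) (simp_all add: c)
  also have "\<dots> = 0"
    by (rule Suc.prems(1))
  finally have "a l * cst (- (b l + of_nat (Suc k))) = 0" if "l \<in> {1..CARD('n)}" for l
    using Suc.IH[of "\<lambda>l. a l * cst (- (b l + of_nat (Suc k)))" l] that by blast
  then have "a l = 0" if "l \<in> {1..CARD('n)}" for l
    using that b_shift_nonzero[OF that, of k] by (metis cst_eq_0_iff mult_eq_0_iff neg_equal_0_iff_equal)
  then show ?case
    using c[OF Suc.prems(2)] by simp
qed

lemma \<phi>_span_S':
  assumes "\<theta> \<in> DerS' W \<alpha>"
  shows "\<exists>c. (\<forall>j\<in>{1..CARD('n)}. c j \<in> S') \<and> \<theta> = (\<Sum>j=1..CARD('n). c j *s \<phi> k j)"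
proof (induction k)
  case 0
  show ?case
    using expand_partial_t[of \<theta>] DerS'_app[OF assms polys_S'[OF inv_ring_polys[OF t_R]]]
    by (intro exI[of _ "\<lambda>j. der_app \<theta> (t j)"]) simp
next
  case (Suc k)
  have "R \<subseteq> S'"
    using polys_S' inv_ring_polys by blast
  moreover obtain c where c: "\<forall>j\<in>{1..CARD('n)}. c j \<in> S'" "\<theta> = (\<Sum>j=1..CARD('n). c j *s \<phi> k j)"
    using Suc by blast
  ultimately show ?case
    unfolding c(2) by (intro combination_step[OF subalgebra_S' _ c(1)])
qed

text \<open>
  Passing from \<open>k\<close> to \<open>k + 1\<close>, the local module of fields with the larger pole order exceeds the
  smaller one by a single direction.  Some \<open>\<nabla>\<^sub>D \<phi>\<^sub>j\<close> attains that pole order, because \<open>\<nabla>\<^sub>D\<close> raises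
  pole orders exactly; the smaller module is spanned by the \<open>\<nabla>\<^sub>D \<phi>\<^sub>j\<close> through the relation with \<open>M\<close>.
\<close>

lemma \<phi>_span_local:
  assumes H: "H \<in> \<A>" and "regular_at H \<theta>"
    and "der_app \<theta> (lin (\<alpha> H)) \<in> vge (\<alpha> H) (1 - (int k + 1) * int (stab_order W H))"
  shows "\<exists>c. (\<forall>j\<in>{1..CARD('n)}. c j \<in> vge (\<alpha> H) 0) \<and> \<theta> = (\<Sum>j=1..CARD('n). c j *s \<phi> k j)"
  using assms(2,3)
proof (induction k arbitrary: \<theta>)
  case 0
  then show ?case
    using expand_partial_t[of \<theta>] regular_on_invariants[OF H _ _ t_R]
    by (intro exI[of _ "\<lambda>j. der_app \<theta> (t j)"]) simp
next
  case (Suc k)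
  let ?a = "\<alpha> H" and ?e = "int (stab_order W H)"
  note a = \<alpha>_nonzero[OF H]
  define m where "m = 1 - (int k + 1) * ?e"
  \<comment> \<open>Otherwise the \<open>\<phi> k j\<close> could not span the normal field multiplied by \<open>\<alpha>\<^sub>H\<^sup>m\<close>.\<close>
  have "\<exists>j\<in>{1..CARD('n)}. der_app (\<phi> k j) (lin ?a) \<notin> vge ?a (m + 1)"
  proof (rule ccontr)
    assume "\<not> ?thesis"
    then have all: "der_app (\<phi> k j) (lin ?a) \<in> vge ?a (m + 1)" if "j \<in> {1..CARD('n)}" for j
      using that by blast
    let ?n = "lin ?a powi m *s normal_der H"
    have n_lin: "der_app ?n (lin \<beta>) = lin ?a powi m * cst (form_app \<beta> (coroot H))" for \<beta>
      by (simp add: der_app_scale_left normal_der_lin)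
    then have "regular_at H ?n"
      by (simp add: regular_at_def)
    moreover have n_\<alpha>: "der_app ?n (lin ?a) = lin ?a powi m"
      by (simp add: n_lin H)
    ultimately have "\<exists>c. (\<forall>j\<in>{1..CARD('n)}. c j \<in> vge ?a 0) \<and> ?n = (\<Sum>j=1..CARD('n). c j *s \<phi> k j)"
      using a by (intro Suc.IH) (simp_all add: vge_def vord_powi m_def)
    then obtain c where c: "\<forall>j\<in>{1..CARD('n)}. c j \<in> vge ?a 0" "?n = (\<Sum>j=1..CARD('n). c j *s \<phi> k j)"
      by blast
    have "lin ?a powi m = (\<Sum>j=1..CARD('n). c j * der_app (\<phi> k j) (lin ?a))"
      using arg_cong[OF c(2), of "\<lambda>\<theta>. der_app \<theta> (lin ?a)"]
      unfolding n_\<alpha> by (simp add: der_app_sum_left der_app_scale_left)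
    also have "\<dots> \<in> vge ?a (m + 1)"
      using c(1) all by (intro vge_sum[OF a] vge_mult0[OF a]) auto
    finally show False
      using a by (simp add: vge_def vord_powi)
  qed
  then obtain j0 where j0: "j0 \<in> {1..CARD('n)}" "der_app (\<phi> k j0) (lin ?a) \<notin> vge ?a (m + 1)"
    by blast
  let ?p = "der_app (\<phi> (Suc k) j0) (lin ?a)"
  have "?p \<notin> vge ?a (m + 1 - ?e)"
    using nablaD_exact[OF H \<phi>_Dlog_inf, of k j0 "m + 1"] j0(2) by (simp add: \<phi>_Suc)
  then have p: "?p \<noteq> 0" "vord ?a ?p \<le> m - ?e"
    by (auto simp: vge_def)
  define c0 where "c0 = der_app \<theta> (lin ?a) / ?p"
  have "der_app \<theta> (lin ?a) \<in> vge ?a (m - ?e)"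
    using Suc.prems(2) by (simp add: m_def algebra_simps)
  then have c0: "c0 \<in> vge ?a 0"
    using p a by (cases "der_app \<theta> (lin ?a) = 0") (auto simp: vge_def c0_def vord_divide)
  let ?rest = "\<theta> - c0 *s \<phi> (Suc k) j0"
  have "regular_at H ?rest"
    using Suc.prems(1) Dlog_inf_perp[OF \<phi>_Dlog_inf H, of _ "Suc k" j0] c0
    by (simp add: regular_at_def der_app_minus_left der_app_scale_left vge_diff[OF a] vge_mult0[OF a])
  moreover have "der_app ?rest (lin ?a) = 0"
    using p by (simp add: der_app_minus_left der_app_scale_left c0_def)
  ultimately have "\<exists>c. (\<forall>j\<in>{1..CARD('n)}. c j \<in> vge ?a 0) \<and> ?rest = (\<Sum>j=1..CARD('n). c j *s \<phi> k j)"
    by (intro Suc.IH) simp_all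
  moreover have "R \<subseteq> vge ?a 0"
    using vge_polys[OF a] inv_ring_polys by blast
  ultimately obtain c' where "R \<subseteq> vge ?a 0"
    "\<forall>j\<in>{1..CARD('n)}. c' j \<in> vge ?a 0" and c': "?rest = (\<Sum>j=1..CARD('n). c' j *s \<phi> k j)"
    by blast
  from combination_step[OF subalgebra_vge_0[OF a] this(1,2), of k]
  obtain c where c: "\<forall>j\<in>{1..CARD('n)}. c j \<in> vge ?a 0" "?rest = (\<Sum>j=1..CARD('n). c j *s \<phi> (Suc k) j)"
    unfolding c'[symmetric] by blast
  let ?c = "\<lambda>j. c j + (if j = j0 then c0 else 0)"
  have "(\<Sum>j=1..CARD('n). ?c j *s \<phi> (Suc k) j) = (\<Sum>j=1..CARD('n). c j *s \<phi> (Suc k) j) +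
      (\<Sum>j=1..CARD('n). if j = j0 then c0 *s \<phi> (Suc k) j else 0)"
    by (simp add: vec.scale_left_distrib sum.distrib if_distrib[of "\<lambda>x. x *s _"] cong: if_cong)
  also have "\<dots> = \<theta>"
    unfolding c(2)[symmetric] using j0(1) by simp
  finally have "\<theta> = (\<Sum>j=1..CARD('n). ?c j *s \<phi> (Suc k) j)" ..
  moreover have "\<forall>j\<in>{1..CARD('n)}. ?c j \<in> vge ?a 0"
    using c(1) c0 by (auto intro!: vge_add[OF a])
  ultimately show ?case
    by (intro exI[of _ ?c] conjI)
qed

text \<open>
  By independence, the expansion over \<open>S'\<close> agrees with all local ones and with its images under \<open>W\<close>;
  so the coefficients are polynomials and invariant.
\<close>

lemma Dlog_basis:
  assumes \<psi>: "\<psi> \<in> Dlog (int k + 1)"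
  shows "\<exists>c. (\<forall>j\<in>{1..CARD('n)}. c j \<in> R) \<and> \<psi> = (\<Sum>j=1..CARD('n). c j *s \<phi> k j)"
proof -
  obtain c where c: "\<forall>j\<in>{1..CARD('n)}. c j \<in> S'" "\<psi> = (\<Sum>j=1..CARD('n). c j *s \<phi> k j)"
    using \<phi>_span_S'[OF Dlog_inf_DerS'[OF Dlog_imp_Dlog_inf[OF \<psi>]]] by blast
  have unique: "c j = c' j" if "\<psi> = (\<Sum>j=1..CARD('n). c' j *s \<phi> k j)" "j \<in> {1..CARD('n)}" for c' j
  proof -
    have "(\<Sum>j=1..CARD('n). (c j - c' j) *s \<phi> k j) = 0"
      using that(1) c(2) by (simp add: vec.scale_left_diff_distrib sum_subtractf)
    from \<phi>_independent[OF this that(2)] show ?thesis by simp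
  qed
  have "c j \<in> polys" if j: "j \<in> {1..CARD('n)}" for j
  proof (rule S'_regular_imp_polys)
    show "c j \<in> S'"
      using c(1) j by blast
    fix H assume H: "H \<in> \<A>"
    have "regular_at H \<psi>"
      using Dlog_imp_Dlog_inf[OF \<psi>] H by (simp add: Dlog_inf_iff)
    moreover have "der_app \<psi> (lin (\<alpha> H)) \<in> vge (\<alpha> H) (1 - (int k + 1) * int (stab_order W H))"
      using Dlog_\<alpha>[OF \<psi> H] by (simp add: algebra_simps)
    ultimately obtain c' where c': "\<forall>j\<in>{1..CARD('n)}. c' j \<in> vge (\<alpha> H) 0" "\<psi> = (\<Sum>j=1..CARD('n). c' j *s \<phi> k j)"
      using \<phi>_span_local[OF H] by blast
    show "c j \<in> vge (\<alpha> H) 0"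
      using c'(1) j unfolding unique[OF c'(2) j] by blast
  qed
  moreover have "act w (c j) = c j" if w: "w \<in> W" and j: "j \<in> {1..CARD('n)}" for w j
  proof -
    note h = is_hom_act[OF W_invertible[OF w]]
    have "\<psi> = (\<Sum>j=1..CARD('n). act w (c j) *s \<phi> k j)"
    proof (rule derivation_eqI)
      fix a
      let ?a = "dact (matrix_inv w) a"
      have a: "dact w ?a = a"
        using w by (simp add: dact_dact invertible_matrix_inv matrix_inv_right)
      have "der_app \<psi> (lin a) = act w (der_app \<psi> (lin ?a))"
        using inv_der_act_lin[OF Dlog_inf_inv[OF Dlog_imp_Dlog_inf[OF \<psi>]] w, of ?a] by (simp add: a)
      also have "\<dots> = (\<Sum>j=1..CARD('n). act w (c j) * act w (der_app (\<phi> k j) (lin ?a)))"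
        by (simp add: c(2) der_app_sum_left der_app_scale_left hom_sum[OF h] hom_mult[OF h])
      also have "\<dots> = der_app (\<Sum>j=1..CARD('n). act w (c j) *s \<phi> k j) (lin a)"
        by (simp add: inv_der_act_lin[OF Dlog_inf_inv[OF \<phi>_Dlog_inf] w] a der_app_sum_left der_app_scale_left)
      finally show "der_app \<psi> (lin a) = der_app (\<Sum>j=1..CARD('n). act w (c j) *s \<phi> k j) (lin a)" .
    qed
    from unique[OF this j] show ?thesis by simp
  qed
  ultimately have "\<forall>j\<in>{1..CARD('n)}. c j \<in> R"
    by (simp add: inv_ring_def)
  with c(2) show ?thesis by blast
qed

subsection \<open>Polynomials in the last basic invariant\<close>

text \<open>Polynomials of degree less than \<open>n\<close> in \<open>t\<^sub>\<ell>\<close> over \<open>T\<close>, in Horner form.\<close>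

primrec Tpoly :: "nat \<Rightarrow> 'n ratfun set" where
  "Tpoly 0 = {0}"
| "Tpoly (Suc n) = {c + t_last * g | c g. c \<in> T \<and> g \<in> Tpoly n}"

lemma Tpoly_0: "0 \<in> Tpoly n"
proof (induction n)
  case (Suc n)
  then show ?case
    using T_closed(4) by force
qed simp

lemma Tpoly_Suc_cases:
  assumes "f \<in> Tpoly (Suc n)"
  obtains c g where "c \<in> T" "g \<in> Tpoly n" "f = c + t_last * g"
  using assms by auto

lemma Tpoly_SucI: "c \<in> T \<Longrightarrow> g \<in> Tpoly n \<Longrightarrow> c + t_last * g \<in> Tpoly (Suc n)"
  by auto

lemma Tpoly_add: "f \<in> Tpoly n \<Longrightarrow> g \<in> Tpoly n \<Longrightarrow> f + g \<in> Tpoly n"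
proof (induction n arbitrary: f g)
  case (Suc n)
  then obtain c f' c' g' where *: "c \<in> T" "f' \<in> Tpoly n" "f = c + t_last * f'"
    "c' \<in> T" "g' \<in> Tpoly n" "g = c' + t_last * g'"
    by (metis Tpoly_Suc_cases)
  then have "f + g = (c + c') + t_last * (f' + g')"
    by (simp add: algebra_simps)
  then show ?case
    using Tpoly_SucI[OF T_closed(2)[OF *(1,4)] Suc.IH[OF *(2,5)]] by simp
qed simp

lemma Tpoly_scale: "c \<in> T \<Longrightarrow> f \<in> Tpoly n \<Longrightarrow> c * f \<in> Tpoly n"
proof (induction n arbitrary: f)
  case (Suc n)
  then obtain c' g where *: "c' \<in> T" "g \<in> Tpoly n" "f = c' + t_last * g"
    by (metis Tpoly_Suc_cases)
  then have "c * f = c * c' + t_last * (c * g)"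
    by (simp add: algebra_simps)
  then show ?case
    using Tpoly_SucI[OF T_closed(3)[OF Suc.prems(1) *(1)] Suc.IH[OF Suc.prems(1) *(2)]] by simp
qed simp

lemma Tpoly_Suc: "f \<in> Tpoly n \<Longrightarrow> f \<in> Tpoly (Suc n)"
proof (induction n arbitrary: f)
  case 0
  then show ?case using Tpoly_SucI[OF T_closed(4), of 0 0] by simp
next
  case (Suc n)
  then obtain c g where *: "c \<in> T" "g \<in> Tpoly n" "f = c + t_last * g"
    by (metis Tpoly_Suc_cases)
  then show ?case
    using Tpoly_SucI[OF *(1) Suc.IH[OF *(2)]] by simp
qed

lemma Tpoly_mono: "m \<le> n \<Longrightarrow> f \<in> Tpoly m \<Longrightarrow> f \<in> Tpoly n"
  by (induction n rule: dec_induct) (auto intro: Tpoly_Suc simp del: Tpoly.simps)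

lemma Tpoly_t_last: "f \<in> Tpoly n \<Longrightarrow> t_last * f \<in> Tpoly (Suc n)"
  using Tpoly_SucI[OF T_closed(4)] by simp

lemma Tpoly_sum: "(\<And>i. i \<in> K \<Longrightarrow> f i \<in> Tpoly n) \<Longrightarrow> sum f K \<in> Tpoly n"
  by (induction K rule: infinite_finite_induct) (auto intro: Tpoly_0 Tpoly_add)

lemma Tpoly_R: "f \<in> Tpoly n \<Longrightarrow> f \<in> R"
proof (induction n arbitrary: f)
  case (Suc n)
  then obtain c g where *: "c \<in> T" "g \<in> Tpoly n" "f = c + t_last * g"
    by (metis Tpoly_Suc_cases)
  then show ?case
    using Suc.IH[OF *(2)] T_subset_R t_last_R by (auto intro!: R_closed)
qed (simp add: R_closed)

lemma Tpoly_mult: "f \<in> Tpoly m \<Longrightarrow> g \<in> Tpoly n \<Longrightarrow> f * g \<in> Tpoly (m + n)"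
proof (induction m arbitrary: f)
  case (Suc m)
  then obtain c h where *: "c \<in> T" "h \<in> Tpoly m" "f = c + t_last * h"
    by (metis Tpoly_Suc_cases)
  have "c * g \<in> Tpoly (Suc m + n)"
    by (rule Tpoly_mono[OF _ Tpoly_scale[OF *(1) Suc.prems(2)]]) simp
  moreover have "t_last * (h * g) \<in> Tpoly (Suc m + n)"
    using Tpoly_t_last[OF Suc.IH[OF *(2) Suc.prems(2)]] by simp
  ultimately have "c * g + t_last * (h * g) \<in> Tpoly (Suc m + n)"
    by (rule Tpoly_add)
  then show ?case
    by (simp add: *(3) algebra_simps del: Tpoly.simps)
qed (simp add: Tpoly_0)

lemma D_Tpoly: "f \<in> Tpoly (Suc n) \<Longrightarrow> D f \<in> Tpoly n"
proof (induction n arbitrary: f)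
  case 0
  then show ?case by (auto simp: D_T)
next
  case (Suc n)
  obtain c g where *: "c \<in> T" "g \<in> Tpoly (Suc n)" "f = c + t_last * g"
    by (rule Tpoly_Suc_cases[OF Suc.prems])
  then have "D f = g + t_last * D g"
    by (simp add: der_app_add der_app_mult D_T D_t_last)
  then show ?case
    using Tpoly_add[OF *(2) Tpoly_t_last[OF Suc.IH[OF *(2)]]] by simp
qed

lemma R_eq_Union_Tpoly: "R = (\<Union>n. Tpoly n)"
proof
  have T: "c \<in> Tpoly (Suc 0)" if "c \<in> T" for c
    using Tpoly_SucI[OF that Tpoly_0[of 0]] by simp
  have "subalgebra (\<Union>n. Tpoly n)"
    unfolding subalgebra_def
  proof (intro conjI allI ballI)
    show "cst c \<in> (\<Union>n. Tpoly n)" for c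
      using T[OF T_closed(1)] by blast
    fix f g assume "f \<in> (\<Union>n. Tpoly n)" "g \<in> (\<Union>n. Tpoly n)"
    then obtain m n where mn: "f \<in> Tpoly m" "g \<in> Tpoly n"
      by blast
    have "f + g \<in> Tpoly (m + n)"
      using mn by (intro Tpoly_add) (auto elim: Tpoly_mono[rotated])
    then show "f + g \<in> (\<Union>n. Tpoly n)"
      by blast
    show "f * g \<in> (\<Union>n. Tpoly n)"
      using Tpoly_mult[OF mn] by blast
  qed
  moreover have "t i \<in> (\<Union>n. Tpoly n)" if i: "i \<in> {1..CARD('n)}" for i
  proof (cases "i = CARD('n)")
    case True
    have "t_last \<in> Tpoly (Suc (Suc 0))"
      using Tpoly_t_last[OF T[OF T_closed(5)]] by simp
    then show ?thesis
      using True by blast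
  next
    case False
    then have "t i \<in> T"
      using i unfolding T_ring_def by (intro adjoin_generator) auto
    then show ?thesis
      using T by blast
  qed
  ultimately show "R \<subseteq> (\<Union>n. Tpoly n)"
    unfolding R_eq by (rule adjoin_least)
qed (auto dest: Tpoly_R)

subsection \<open>Surjectivity\<close>

lemma M_row_split:
  assumes j: "j \<in> {1..CARD('n)}"
  shows "(\<Sum>i=1..CARD('n). M j i *s v i) = (\<Sum>i=1..CARD('n). M0 j i *s v i) + t_last *s v j"
proof -
  have "(\<Sum>i=1..CARD('n). M j i *s v i) =
      (\<Sum>i=1..CARD('n). M0 j i *s v i) + (\<Sum>i=1..CARD('n). if i = j then t_last *s v i else 0)"
    by (simp add: M_eq vec.scale_left_distrib sum.distrib if_distrib[of "\<lambda>x. x *s _"] eq_commute[of j] cong: if_cong)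
  also have "(\<Sum>i=1..CARD('n). if i = j then t_last *s v i else 0) = t_last *s v j"
    using j by simp
  finally show ?thesis .
qed

lemma t_last_\<phi>:
  assumes j: "j \<in> {1..CARD('n)}"
  shows "t_last *s \<phi> (Suc k) j = cst (- (b j + of_nat (Suc k))) *s \<phi> k j - (\<Sum>i=1..CARD('n). M0 j i *s \<phi> (Suc k) i)"
  using M_row_split[OF j, of "\<phi> (Suc k)"] unfolding M_\<phi>[OF j] by (simp add: algebra_simps)

text \<open>
  The fields \<open>f \<nabla>\<^sub>D \<phi>\<^sub>j\<close> with \<open>f \<in> T\<close> are images.  A factor \<open>t\<^sub>\<ell>\<close> is absorbed with the help of the
  relation between \<open>M \<nabla>\<^sub>D \<phi>\<close> and \<open>\<phi>\<close>, which lowers either the degree in \<open>t\<^sub>\<ell>\<close> or the pole order.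
\<close>

lemma nablaD_Dlog_nat: "nablaD ` Dlog (int k) = Dlog (int k + 1)"
proof (induction k)
  case 0
  show ?case using nablaD_Dlog_nonpos[of 0] by simp
next
  case (Suc k)
  let ?Y = "nablaD ` Dlog (int k + 1)"
  have Y_add: "x + y \<in> ?Y" if "x \<in> ?Y" "y \<in> ?Y" for x y
    using that by (auto simp flip: nabla_add intro: Dlog_add)
  have Y_diff: "x - y \<in> ?Y" if "x \<in> ?Y" "y \<in> ?Y" for x y
    using that by (auto simp flip: nabla_diff intro: Dlog_diff)
  have Y_sum: "sum f K \<in> ?Y" if "\<And>i. i \<in> K \<Longrightarrow> f i \<in> ?Y" for f and K :: "nat set"
    using that
  proof (induction K rule: infinite_finite_induct)
    case (insert x F)
    then show ?case by (simp add: Y_add)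
  qed (use Dlog_0[of "int k + 1"] in \<open>auto simp: image_iff intro!: bexI[of _ 0]\<close>)
  have Dlog_sub: "Dlog (int k + 1) \<subseteq> ?Y"
    using Suc.IH Dlog_mono[of "int k" "int k + 1"] by auto
  have "f *s \<phi> (Suc k) j \<in> ?Y" if "f \<in> Tpoly n" "j \<in> {1..CARD('n)}" for f n j
    using that
  proof (induction n arbitrary: f j)
    case 0
    then show ?case
      using Y_sum[of "{}"] by simp
  next
    case (Suc n)
    obtain c g where cg: "c \<in> T" "g \<in> Tpoly n" "f = c + t_last * g"
      by (rule Tpoly_Suc_cases[OF Suc.prems(1)])
    have "f *s \<phi> (Suc k) j = c *s \<phi> (Suc k) j + g *s (t_last *s \<phi> (Suc k) j)"
      by (simp add: cg(3) vec.scale_left_distrib mult.commute)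
    also have "\<dots> = c *s \<phi> (Suc k) j + ((g * cst (- (b j + of_nat (Suc k)))) *s \<phi> k j
        - (\<Sum>i=1..CARD('n). (M0 j i * g) *s \<phi> (Suc k) i))"
      unfolding t_last_\<phi>[OF Suc.prems(2)]
      by (simp only: vec.scale_right_diff_distrib vec.scale_scale vec.scale_sum_right mult.commute[of "M0 _ _"])
    also have "\<dots> \<in> ?Y"
    proof (intro Y_add Y_diff Y_sum)
      have "c *s \<phi> (Suc k) j = nablaD (c *s \<phi> k j)"
        by (simp add: nabla_scale D_T[OF cg(1)] \<phi>_Suc)
      moreover have "c *s \<phi> k j \<in> Dlog (int k + 1)"
        using cg(1) T_subset_R by (intro Dlog_scale \<phi>_Dlog) auto
      ultimately show "c *s \<phi> (Suc k) j \<in> ?Y"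
        by blast
      have "(g * cst (- (b j + of_nat (Suc k)))) *s \<phi> k j \<in> Dlog (int k + 1)"
        by (intro Dlog_scale \<phi>_Dlog R_closed Tpoly_R[OF cg(2)])
      then show "(g * cst (- (b j + of_nat (Suc k)))) *s \<phi> k j \<in> ?Y"
        using Dlog_sub by blast
      fix i assume i: "i \<in> {1..CARD('n)}"
      show "(M0 j i * g) *s \<phi> (Suc k) i \<in> ?Y"
        by (rule Suc.IH[OF Tpoly_scale[OF M0_T[OF Suc.prems(2) i] cg(2)] i])
    qed
    finally show ?case .
  qed
  then have prod_Y: "f *s \<phi> (Suc k) j \<in> ?Y" if "f \<in> R" "j \<in> {1..CARD('n)}" for f j
    using that R_eq_Union_Tpoly by auto
  have "Dlog (int (Suc k) + 1) \<subseteq> ?Y"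
  proof
    fix \<psi> assume "\<psi> \<in> Dlog (int (Suc k) + 1)"
    then obtain c where "\<forall>j\<in>{1..CARD('n)}. c j \<in> R" "\<psi> = (\<Sum>j=1..CARD('n). c j *s \<phi> (Suc k) j)"
      using Dlog_basis by blast
    then show "\<psi> \<in> ?Y"
      using prod_Y by (auto intro: Y_sum)
  qed
  moreover have "nablaD ` Dlog (int k + 1) \<subseteq> Dlog (int k + 1 + 1)"
    using nablaD_Dlog_iff Dlog_imp_Dlog_inf by blast
  ultimately show ?case
    by (auto simp: add_ac)
qed

lemma nablaD_Dlog: "nablaD ` Dlog k = Dlog (k + 1)"
proof (cases "k \<le> 0")
  case False
  then show ?thesis
    using nablaD_Dlog_nat[of "nat k"] by simp
qed (rule nablaD_Dlog_nonpos)

end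

context flat_setting
begin

section \<open>The pieces of the decomposition\<close>

abbreviation "G \<equiv> G_piece W \<alpha> t"

lemma submodule_T: "submodule R A \<Longrightarrow> submodule T A"
  using T_subset_R by (auto simp: submodule_def)

lemma G_0: "G 0 = combinations T pt"
  by (simp add: G_piece_def G_zero_def)

lemma G_0_subset_Dlog: "G 0 \<subseteq> Dlog 1"
  using T_subset_R by (auto simp: G_0 combinations_def intro!: Dlog_sum Dlog_scale partial_t_Dlog1)

lemma G_nonneg: "G (int (Suc i)) = nabla_inverse ` G (int i)"
  unfolding G_piece_def by (simp add: image_comp nat_add_distrib)

lemma G_neg: "G (- int (Suc i)) = nablaD ` G (- int i)"
  unfolding G_piece_def by (cases i) (simp_all add: image_comp nat_add_distrib)

lemma nablaD_nabla_inverse_image: "A \<subseteq> Dlog 1 \<Longrightarrow> nablaD ` nabla_inverse ` A = A"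
  using nabla_inverse_Dlog1(2) by (force simp: image_image subset_iff)

lemma G_nonneg_subset: "G (int i) \<subseteq> Dlog (1 - int i) \<and> nablaD ` G (int (Suc i)) = G (int i)"
proof (induction i)
  case 0
  then show ?case
    using G_0_subset_Dlog nablaD_nabla_inverse_image[OF G_0_subset_Dlog] G_nonneg[of 0] by simp
next
  case (Suc i)
  have sub: "G (int i) \<subseteq> Dlog 1"
    using Suc Dlog_mono[of "1 - int i" 1] by auto
  have "G (int (Suc i)) \<subseteq> Dlog (- int i)"
  proof
    fix \<theta> assume "\<theta> \<in> G (int (Suc i))"
    then obtain \<psi> where \<psi>: "\<psi> \<in> G (int i)" "\<theta> = nabla_inverse \<psi>"
      unfolding G_nonneg by blast
    then have "\<theta> \<in> Dlog 0" "nablaD \<theta> = \<psi>"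
      using nabla_inverse_Dlog1 sub by auto
    then show "\<theta> \<in> Dlog (- int i)"
      using nablaD_Dlog_iff[OF Dlog_imp_Dlog_inf, of \<theta> 0 "- int i"] \<psi>(1) Suc by (auto simp: add.commute)
  qed
  moreover from this have "G (int (Suc i)) \<subseteq> Dlog 1"
    using Dlog_mono[of "- int i" 1] by auto
  then have "nablaD ` G (int (Suc (Suc i))) = G (int (Suc i))"
    unfolding G_nonneg[of "Suc i"] by (rule nablaD_nabla_inverse_image)
  ultimately show ?case by simp
qed

lemma G_neg_subset: "G (- int i) \<subseteq> Dlog (1 + int i)"
proof (induction i)
  case (Suc i)
  then have "nablaD ` G (- int i) \<subseteq> nablaD ` Dlog (1 + int i)"
    by blast
  then show ?case
    unfolding G_neg nablaD_Dlog by (simp add: add_ac)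
qed (simp add: G_0_subset_Dlog)

lemma nablaD_G: "nablaD ` G (i + 1) = G i"
proof (cases "i \<ge> 0")
  case True
  then show ?thesis
    using G_nonneg_subset[of "nat i"] by (simp add: add.commute)
next
  case False
  then show ?thesis
    using G_neg[of "nat (- i - 1)"] by (simp add: add.commute)
qed

lemma G_subset_Dlog: "G i \<subseteq> Dlog (1 - i)"
proof (cases "i \<ge> 0")
  case True
  then show ?thesis
    using G_nonneg_subset[of "nat i"] by simp
next
  case False
  then show ?thesis
    using G_neg_subset[of "nat (- i)"] by simp
qed

lemma G_subset_Dlog_inf: "G i \<subseteq> Dlog_inf"
  using G_subset_Dlog Dlog_imp_Dlog_inf by blast

lemma nablaD_T_linear: "c \<in> T \<Longrightarrow> nablaD (c *s \<theta>) = c *s nablaD \<theta>"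
  by (simp add: nabla_scale D_T)

lemma submodule_G: "submodule T (G i)"
proof (induction i rule: int_induct[of _ 0])
  case base
  show ?case
    unfolding submodule_def
  proof (intro conjI ballI)
    show "0 \<in> G 0"
      unfolding G_0 combinations_def by (intro CollectI exI[of _ "\<lambda>_. 0"]) (simp add: T_closed)
    fix \<theta> assume "\<theta> \<in> G 0"
    then obtain c where c: "\<forall>j\<in>{1..CARD('n)}. c j \<in> T" "\<theta> = (\<Sum>j=1..CARD('n). c j *s pt j)"
      by (auto simp: G_0 combinations_def)
    show "a *s \<theta> \<in> G 0" if "a \<in> T" for a
      unfolding G_0 combinations_def using that c
      by (intro CollectI exI[of _ "\<lambda>j. a * c j"]) (simp add: T_closed vec.scale_sum_right)
    fix \<psi> assume "\<psi> \<in> G 0"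
    then obtain c' where c': "\<forall>j\<in>{1..CARD('n)}. c' j \<in> T" "\<psi> = (\<Sum>j=1..CARD('n). c' j *s pt j)"
      by (auto simp: G_0 combinations_def)
    show "\<theta> + \<psi> \<in> G 0"
      unfolding G_0 combinations_def using c c'
      by (intro CollectI exI[of _ "\<lambda>j. c j + c' j"]) (simp add: T_closed vec.scale_left_distrib sum.distrib)
  qed
next
  case (step1 i)
  have lift: "\<theta> \<in> G (i + 1)" if \<theta>Dlog: "\<theta> \<in> Dlog_inf" and \<theta>G: "nablaD \<theta> \<in> G i" for \<theta>
  proof -
    obtain \<psi> where \<psi>: "\<psi> \<in> G (i + 1)" "nablaD \<theta> = nablaD \<psi>"
      using \<theta>G nablaD_G[of i] by blast
    then have "\<theta> = \<psi>"
      using nablaD_inj \<theta>Dlog G_subset_Dlog_inf[of "i + 1"] unfolding inj_on_def by blast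
    then show ?thesis
      using \<psi>(1) by simp
  qed
  have down: "nablaD \<theta> \<in> G i" if "\<theta> \<in> G (i + 1)" for \<theta>
    using that nablaD_G[of i] by blast
  show ?case
    unfolding submodule_def
  proof (intro conjI ballI)
    show "0 \<in> G (i + 1)"
      using step1 by (intro lift) (simp_all add: Dlog_inf_0 submodule_def)
    fix \<theta> assume \<theta>: "\<theta> \<in> G (i + 1)"
    have \<theta>Dlog: "\<theta> \<in> Dlog_inf"
      using \<theta> G_subset_Dlog_inf by blast
    show "a *s \<theta> \<in> G (i + 1)" if a: "a \<in> T" for a
      using step1 down[OF \<theta>] a T_subset_R \<theta>Dlog
      by (intro lift Dlog_inf_scale) (auto simp: nablaD_T_linear submodule_def)
    fix \<psi> assume \<psi>: "\<psi> \<in> G (i + 1)"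
    show "\<theta> + \<psi> \<in> G (i + 1)"
      using step1 down[OF \<theta>] down[OF \<psi>] \<theta>Dlog \<psi> G_subset_Dlog_inf
      by (intro lift Dlog_inf_add) (auto simp: nabla_add submodule_def)
  qed
next
  case (step2 i)
  have eq: "G (i - 1) = nablaD ` G i"
    using nablaD_G[of "i - 1"] by simp
  show ?case
    unfolding eq submodule_def
  proof (intro conjI ballI)
    show "0 \<in> nablaD ` G i"
      using step2 by (auto simp: submodule_def image_iff intro!: bexI[of _ 0])
    fix \<theta> assume "\<theta> \<in> nablaD ` G i"
    then obtain \<theta>' where \<theta>': "\<theta>' \<in> G i" "\<theta> = nablaD \<theta>'"
      by blast
    show "a *s \<theta> \<in> nablaD ` G i" if "a \<in> T" for a
      using step2 \<theta>' that by (auto simp: submodule_def simp flip: nablaD_T_linear)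
    fix \<psi> assume "\<psi> \<in> nablaD ` G i"
    then obtain \<psi>' where "\<psi>' \<in> G i" "\<psi> = nablaD \<psi>'"
      by blast
    then show "\<theta> + \<psi> \<in> nablaD ` G i"
      using step2 \<theta>' by (auto simp: submodule_def simp flip: nabla_add)
  qed
qed

lemma G_0_mem: "0 \<in> G i"
  and G_add: "\<theta> \<in> G i \<Longrightarrow> \<psi> \<in> G i \<Longrightarrow> \<theta> + \<psi> \<in> G i"
  using submodule_G[of i] by (auto simp: submodule_def)

subsection \<open>Directness\<close>

text \<open>Only two terms of the Leibniz rule survive, because \<open>D M\<close> is the identity matrix.\<close>

lemma D_iterate_M_row:
  assumes j: "j \<in> {1..CARD('n)}"
  shows "(D ^^ Suc m) (\<Sum>i=1..CARD('n). a i * M i j) =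
    (\<Sum>i=1..CARD('n). (D ^^ Suc m) (a i) * M i j) + of_nat (Suc m) * (D ^^ m) (a j)"
proof (induction m)
  have step: "D (\<Sum>i=1..CARD('n). x i * M i j) = (\<Sum>i=1..CARD('n). D (x i) * M i j) + x j" for x
  proof -
    have "(\<Sum>i=1..CARD('n). x i * D (M i j)) = (\<Sum>i=1..CARD('n). if i = j then x i else 0)"
      by (rule sum.cong) (use j in \<open>auto simp: D_M\<close>)
    also have "\<dots> = x j"
      using j by simp
    finally show ?thesis
      by (simp add: der_app_sum der_app_mult sum.distrib)
  qed
  case 0
  show ?case
    using step[of a] by simp
  case (Suc m)
  have nat: "D (of_nat k * f) = of_nat k * D f" for k f
    by (simp add: der_app_scale flip: cst_of_nat)
  have "(D ^^ Suc (Suc m)) (\<Sum>i=1..CARD('n). a i * M i j) =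
      D (\<Sum>i=1..CARD('n). (D ^^ Suc m) (a i) * M i j) + D (of_nat (Suc m) * (D ^^ m) (a j))"
    using Suc by (simp only: funpow.simps(2) o_apply der_app_add)
  then show ?case
    unfolding step nat by (simp add: algebra_simps)
qed

lemma D_iterate_Tpoly: "f \<in> Tpoly n \<Longrightarrow> (D ^^ n) f = 0"
proof (induction n arbitrary: f)
  case (Suc n)
  then show ?case
    using Suc.IH[OF D_Tpoly[OF Suc.prems]] by (simp add: funpow_swap1)
qed simp

text \<open>
  A row vector \<open>a\<close> over \<open>R\<close> whose product with \<open>M = t\<^sub>\<ell> + M\<^sub>0\<close> has entries in \<open>T\<close> vanishes, since the
  product has larger degree in \<open>t\<^sub>\<ell>\<close>.  Degrees are measured by the powers of \<open>D\<close> that annihilate.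
\<close>

lemma M_combination_in_T:
  assumes a: "\<And>i. i \<in> {1..CARD('n)} \<Longrightarrow> a i \<in> R"
    and T: "\<And>j. j \<in> {1..CARD('n)} \<Longrightarrow> (\<Sum>i=1..CARD('n). a i * M i j) \<in> T"
    and j: "j \<in> {1..CARD('n)}"
  shows "a j = 0"
proof -
  have "\<exists>n. a i \<in> Tpoly n" if "i \<in> {1..CARD('n)}" for i
    using a[OF that] R_eq_Union_Tpoly by blast
  then obtain n where n: "\<And>i. i \<in> {1..CARD('n)} \<Longrightarrow> a i \<in> Tpoly (n i)"
    by metis
  define m where "m = (\<Sum>i=1..CARD('n). n i)"
  have "(D ^^ m) (a i) = 0" if i: "i \<in> {1..CARD('n)}" for i
  proof -
    have "n i \<le> m"
      unfolding m_def by (rule member_le_sum[OF i]) auto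
    then show ?thesis
      using Tpoly_mono n[OF i] D_iterate_Tpoly by blast
  qed
  then have "\<forall>i\<in>{1..CARD('n)}. (D ^^ 0) (a i) = 0"
  proof (induction m)
    case (Suc m)
    have "(D ^^ m) (a i) = 0" if i: "i \<in> {1..CARD('n)}" for i
    proof -
      have zero: "(D ^^ k) 0 = 0" for k
        by (induction k) simp_all
      have "(D ^^ Suc m) (\<Sum>l=1..CARD('n). a l * M l i) = 0"
        unfolding funpow_Suc_right o_apply D_T[OF T[OF i]] by (rule zero)
      moreover have "(\<Sum>l=1..CARD('n). (D ^^ Suc m) (a l) * M l i) = 0"
        by (rule sum.neutral) (use Suc.prems in \<open>simp del: funpow.simps\<close>)
      ultimately have "of_nat (Suc m) * (D ^^ m) (a i) = 0"
        using D_iterate_M_row[OF i, of m a] by simp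
      then show ?thesis
        using of_nat_ratfun_eq_0_iff[of "Suc m"] by (metis mult_eq_0_iff nat.distinct(2))
    qed
    then show ?case
      by (rule Suc.IH)
  qed simp
  then show ?thesis
    using j by simp
qed

text \<open>
  For \<open>\<theta>\<close> in the intersection, compare the two expansions of \<open>\<nabla>\<^sub>D \<theta>\<close>: the one in \<open>\<nabla>\<^sub>D \<partial>\<^sub>t\<close> with
  coefficients in \<open>T\<close>, and the one in \<open>\<partial>\<^sub>t\<close>, rewritten in \<open>\<nabla>\<^sub>D \<partial>\<^sub>t\<close> by means of \<open>M\<close>.
\<close>

lemma G_0_inter_Dlog: "G 0 \<inter> Dlog 0 \<subseteq> {0}"
proof
  fix \<theta> assume "\<theta> \<in> G 0 \<inter> Dlog 0"
  then obtain c where c: "\<forall>j\<in>{1..CARD('n)}. c j \<in> T" "\<theta> = (\<Sum>j=1..CARD('n). c j *s pt j)"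
    and \<theta>: "\<theta> \<in> Dlog 0"
    by (auto simp: G_0 combinations_def)
  have "nablaD \<theta> = (\<Sum>j=1..CARD('n). nablaD (c j *s \<phi> 0 j))"
    by (simp add: c(2) nabla_sum)
  also have "\<dots> = (\<Sum>j=1..CARD('n). c j *s \<phi> (Suc 0) j)"
    by (rule sum.cong) (use c(1) in \<open>simp_all only: nablaD_T_linear \<phi>_Suc\<close>)
  finally have 1: "nablaD \<theta> = (\<Sum>j=1..CARD('n). c j *s \<phi> (Suc 0) j)" .
  have "nablaD \<theta> \<in> Dlog (int 0 + 1)"
    using nablaD_Dlog_iff[OF Dlog_imp_Dlog_inf[OF \<theta>], of 0] \<theta> by simp
  then obtain f where f: "\<forall>j\<in>{1..CARD('n)}. f j \<in> R" "nablaD \<theta> = (\<Sum>i=1..CARD('n). f i *s \<phi> 0 i)"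
    using Dlog_basis by blast
  define a where "a i = f i * cst (inverse (- (b i + of_nat (Suc 0))))" for i
  have "(\<Sum>i=1..CARD('n). f i *s \<phi> 0 i) = (\<Sum>i=1..CARD('n). \<Sum>j=1..CARD('n). (a i * M i j) *s \<phi> (Suc 0) j)"
  proof (rule sum.cong[OF refl])
    fix i assume i: "i \<in> {1..CARD('n)}"
    show "f i *s \<phi> 0 i = (\<Sum>j=1..CARD('n). (a i * M i j) *s \<phi> (Suc 0) j)"
      by (subst \<phi>_eq_M_\<phi>[OF i]) (simp only: vec.scale_sum_right vec.scale_scale a_def mult.assoc)
  qed
  also have "\<dots> = (\<Sum>j=1..CARD('n). (\<Sum>i=1..CARD('n). a i * M i j) *s \<phi> (Suc 0) j)"
    by (subst sum.swap) (simp only: vec.scale_sum_left)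
  finally have "(\<Sum>j=1..CARD('n). (c j - (\<Sum>i=1..CARD('n). a i * M i j)) *s \<phi> (Suc 0) j) = 0"
    using 1 f(2) by (simp add: vec.scale_left_diff_distrib sum_subtractf)
  from \<phi>_independent[OF this]
  have cM: "c j = (\<Sum>i=1..CARD('n). a i * M i j)" if "j \<in> {1..CARD('n)}" for j
    using that by simp
  have "a i = 0" if "i \<in> {1..CARD('n)}" for i
  proof (rule M_combination_in_T[OF _ _ that])
    show "a i \<in> R" if "i \<in> {1..CARD('n)}" for i
      unfolding a_def using f(1) that by (intro R_closed) auto
    show "(\<Sum>i=1..CARD('n). a i * M i j) \<in> T" if "j \<in> {1..CARD('n)}" for j
      using c(1) cM[OF that] that by metis
  qed
  then have "c j = 0" if "j \<in> {1..CARD('n)}" for j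
    using cM[OF that] by simp
  then show "\<theta> \<in> {0}"
    by (simp add: c(2))
qed

lemma G_inter_Dlog: "G i \<inter> Dlog (- i) \<subseteq> {0}"
proof (induction i rule: int_induct[of _ 0])
  case base
  then show ?case using G_0_inter_Dlog by simp
next
  case (step1 i)
  show ?case
  proof
    fix \<theta> assume \<theta>: "\<theta> \<in> G (i + 1) \<inter> Dlog (- (i + 1))"
    then have "nablaD \<theta> \<in> G i"
      using nablaD_G[of i] by blast
    moreover have "nablaD \<theta> \<in> Dlog (- i)"
      using \<theta> nablaD_Dlog_iff[OF Dlog_imp_Dlog_inf, of \<theta> "- (i + 1)" "- (i + 1)"] by simp
    ultimately have "nablaD \<theta> = nablaD 0"
      using step1 by auto
    then show "\<theta> \<in> {0}"
      using nablaD_inj \<theta> Dlog_inf_0 Dlog_imp_Dlog_inf by (auto simp: inj_on_def)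
  qed
next
  case (step2 i)
  show ?case
  proof
    fix \<theta> assume \<theta>: "\<theta> \<in> G (i - 1) \<inter> Dlog (- (i - 1))"
    then obtain \<psi> where \<psi>: "\<psi> \<in> G i" "\<theta> = nablaD \<psi>"
      using nablaD_G[of "i - 1"] by auto
    then have "\<psi> \<in> Dlog (- i)"
      using \<theta> nablaD_Dlog_iff[of \<psi> "- i"] G_subset_Dlog_inf by (auto simp: add.commute)
    then show "\<theta> \<in> {0}"
      using \<psi> step2 by auto
  qed
qed

text \<open>
  In a relation, the terms of larger index all lie in the next smaller module \<open>\<D>(\<A>, -k\<omega> + 1)\<^sup>W\<close>,
  which meets the piece of lowest index only in \<open>0\<close>.
\<close>

lemma G_direct:
  assumes "finite K" "\<And>i. i \<in> K \<Longrightarrow> g i \<in> G i" "(\<Sum>i\<in>K. g i) = 0"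
  shows "\<forall>i\<in>K. g i = 0"
  using assms
proof (induction K rule: finite_linorder_min_induct)
  case (insert i0 K)
  have "(\<Sum>i\<in>K. g i) \<in> Dlog (- i0)"
  proof (rule Dlog_sum)
    fix i assume i: "i \<in> K"
    then have "g i \<in> Dlog (1 - i)"
      using insert.prems(1) G_subset_Dlog by blast
    moreover have "1 - i \<le> - i0"
      using insert.hyps(2) i by auto
    ultimately show "g i \<in> Dlog (- i0)"
      using Dlog_mono by blast
  qed
  moreover have "i0 \<notin> K"
    using insert.hyps(2) by auto
  then have sum: "g i0 = 0 - (\<Sum>i\<in>K. g i)"
    using insert.prems(2) insert.hyps(1) by (simp add: eq_neg_iff_add_eq_0)
  ultimately have "g i0 \<in> Dlog (- i0)"
    using Dlog_diff[OF Dlog_0] by metis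
  then have "g i0 = 0"
    using G_inter_Dlog[of i0] insert.prems(1) by blast
  moreover from this sum have "(\<Sum>i\<in>K. g i) = 0"
    by simp
  ultimately show ?case
    using insert.IH insert.prems(1) by blast
qed simp

subsection \<open>Exhaustion\<close>

abbreviation "FS J \<equiv> family_sum J G"

lemma FS_I: "finite K \<Longrightarrow> K \<subseteq> J \<Longrightarrow> (\<And>i. i \<in> K \<Longrightarrow> g i \<in> G i) \<Longrightarrow> (\<Sum>i\<in>K. g i) \<in> FS J"
  unfolding family_sum_def by blast

lemma FS_E:
  assumes "\<theta> \<in> FS J"
  obtains K g where "finite K" "K \<subseteq> J" "\<And>i. i \<in> K \<Longrightarrow> g i \<in> G i" "\<theta> = (\<Sum>i\<in>K. g i)"
  using assms unfolding family_sum_def by blast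

lemma FS_add:
  assumes "\<theta> \<in> FS J" "\<psi> \<in> FS J"
  shows "\<theta> + \<psi> \<in> FS J"
proof -
  obtain K g where 1: "finite K" "K \<subseteq> J" "\<And>i. i \<in> K \<Longrightarrow> g i \<in> G i" "\<theta> = (\<Sum>i\<in>K. g i)"
    using FS_E[OF assms(1)] by metis
  obtain K' g' where 2: "finite K'" "K' \<subseteq> J" "\<And>i. i \<in> K' \<Longrightarrow> g' i \<in> G i" "\<psi> = (\<Sum>i\<in>K'. g' i)"
    using FS_E[OF assms(2)] by metis
  have "\<theta> = (\<Sum>i\<in>K \<union> K'. if i \<in> K then g i else 0)" "\<psi> = (\<Sum>i\<in>K \<union> K'. if i \<in> K' then g' i else 0)"
    unfolding 1(4) 2(4) using 1(1) 2(1) by (auto intro!: sum.mono_neutral_cong_left)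
  then have "\<theta> + \<psi> = (\<Sum>i\<in>K \<union> K'. (if i \<in> K then g i else 0) + (if i \<in> K' then g' i else 0))"
    by (simp add: sum.distrib)
  also have "\<dots> \<in> FS J"
    using 1 2 by (intro FS_I G_add) (auto simp: G_0_mem)
  finally show ?thesis .
qed

lemma FS_single: "i \<in> J \<Longrightarrow> \<theta> \<in> G i \<Longrightarrow> \<theta> \<in> FS J"
  using FS_I[of "{i}" J "\<lambda>_. \<theta>"] by simp

lemma FS_mono: "J \<subseteq> J' \<Longrightarrow> FS J \<subseteq> FS J'"
  unfolding family_sum_def by blast

lemma FS_subset_Dlog_inf: "FS J \<subseteq> Dlog_inf"
proof
  fix \<theta> assume "\<theta> \<in> FS J"
  then obtain K g where "finite K" "\<And>i. i \<in> K \<Longrightarrow> g i \<in> G i" "\<theta> = (\<Sum>i\<in>K. g i)"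
    using FS_E by metis
  moreover have "(\<Sum>i\<in>K. g i) \<in> Dlog_inf" if "\<And>i. i \<in> K \<Longrightarrow> g i \<in> G i" for K :: "int set" and g
    using that
  proof (induction K rule: infinite_finite_induct)
    case (insert x K)
    then have "g x \<in> Dlog_inf" "(\<Sum>i\<in>K. g i) \<in> Dlog_inf"
      using G_subset_Dlog_inf by blast+
    then show ?case
      using insert.hyps by (simp add: Dlog_inf_add)
  qed (simp_all add: Dlog_inf_0)
  ultimately show "\<theta> \<in> Dlog_inf"
    by simp
qed

lemma nablaD_FS: "nablaD ` FS {m + 1..} = FS {m..}"
proof (intro equalityI subsetI)
  fix \<psi> assume "\<psi> \<in> nablaD ` FS {m + 1..}"
  then obtain K g where K: "finite K" "K \<subseteq> {m + 1..}" "\<And>i. i \<in> K \<Longrightarrow> g i \<in> G i" "\<psi> = nablaD (\<Sum>i\<in>K. g i)"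
    by (auto elim!: FS_E)
  have "\<psi> = (\<Sum>i\<in>K. nablaD (g i))"
    by (simp add: K(4) nabla_sum)
  also have "\<dots> = (\<Sum>i\<in>(\<lambda>i. i - 1) ` K. nablaD (g (i + 1)))"
    by (subst sum.reindex) (auto simp: inj_on_def)
  also have "\<dots> \<in> FS {m..}"
  proof (rule FS_I)
    show "nablaD (g (i + 1)) \<in> G i" if "i \<in> (\<lambda>i. i - 1) ` K" for i
      using that K(3) nablaD_G[of i] by auto
  qed (use K in auto)
  finally show "\<psi> \<in> FS {m..}" .
next
  fix \<psi> assume "\<psi> \<in> FS {m..}"
  then obtain K g where K: "finite K" "K \<subseteq> {m..}" "\<And>i. i \<in> K \<Longrightarrow> g i \<in> G i" "\<psi> = (\<Sum>i\<in>K. g i)"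
    using FS_E by metis
  have "\<forall>i\<in>K. \<exists>x. x \<in> G (i + 1) \<and> g i = nablaD x"
    using K(3) nablaD_G by (metis imageE)
  then obtain x where x: "\<And>i. i \<in> K \<Longrightarrow> x i \<in> G (i + 1)" "\<And>i. i \<in> K \<Longrightarrow> g i = nablaD (x i)"
    by metis
  have "\<psi> = nablaD (\<Sum>i\<in>K. x i)"
    unfolding K(4) nabla_sum by (rule sum.cong) (simp_all add: x)
  also have "(\<Sum>i\<in>K. x i) = (\<Sum>i\<in>(\<lambda>i. i + 1) ` K. x (i - 1))"
    by (subst sum.reindex) (auto simp: inj_on_def)
  finally show "\<psi> \<in> nablaD ` FS {m + 1..}"
    using K x by (auto intro!: imageI FS_I)
qed

lemma D_Tpoly_same: "f \<in> Tpoly n \<Longrightarrow> D f \<in> Tpoly n"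
  and t_last_D_Tpoly: "f \<in> Tpoly n \<Longrightarrow> t_last * D f \<in> Tpoly n"
proof -
  assume f: "f \<in> Tpoly n"
  show "D f \<in> Tpoly n"
    by (rule D_Tpoly[OF Tpoly_Suc[OF f]])
  show "t_last * D f \<in> Tpoly n"
  proof (cases n)
    case (Suc k)
    then show ?thesis
      using Tpoly_t_last[OF D_Tpoly] f by simp
  qed (use f in simp)
qed

text \<open>
  Modulo the rows of \<open>M\<close>, which are logarithmic, every element of \<open>Der\<^sub>R\<close> reduces to \<open>\<G>\<^sub>0\<close>;
  and \<open>\<nabla>\<^sub>D\<close> lowers the degree in \<open>t\<^sub>\<ell>\<close> of the logarithmic remainder.
\<close>

lemma Tpoly_combination_in_FS:
  assumes "\<And>j. j \<in> {1..CARD('n)} \<Longrightarrow> f j \<in> Tpoly n"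
  shows "(\<Sum>j=1..CARD('n). f j *s pt j) \<in> FS {0..}"
  using assms
proof (induction n arbitrary: f)
  case 0
  then have "(\<Sum>j=1..CARD('n). f j *s pt j) = 0"
    by simp
  then show ?case
    using FS_single[of 0 "{0..}" 0] G_0_mem by simp
next
  case (Suc n)
  have "\<forall>j\<in>{1..CARD('n)}. \<exists>c g. c \<in> T \<and> g \<in> Tpoly n \<and> f j = c + t_last * g"
    using Suc.prems by (metis Tpoly_Suc_cases)
  then obtain c g where cg: "\<And>j. j \<in> {1..CARD('n)} \<Longrightarrow> c j \<in> T"
    "\<And>j. j \<in> {1..CARD('n)} \<Longrightarrow> g j \<in> Tpoly n"
    "\<And>j. j \<in> {1..CARD('n)} \<Longrightarrow> f j = c j + t_last * g j"
    by metis
  \<comment> \<open>The remainder: \<open>t\<^sub>\<ell> \<partial>\<^sub>t\<^sub>j\<close> differs from the \<open>j\<close>-th row of \<open>M\<close> by a combination over \<open>T\<close>.\<close>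
  define \<rho> where "\<rho> = (\<Sum>j=1..CARD('n). g j *s (\<Sum>i=1..CARD('n). M j i *s pt i))"
  define r where "r i = - (\<Sum>j=1..CARD('n). M0 j i * g j)" for i
  have \<rho>_Dlog: "\<rho> \<in> Dlog 0"
    unfolding \<rho>_def
  proof (rule Dlog_sum)
    fix j assume j: "j \<in> {1..CARD('n)}"
    show "g j *s (\<Sum>i=1..CARD('n). M j i *s pt i) \<in> Dlog 0"
      unfolding M_row[OF j]
      by (intro Dlog_scale Tpoly_R[OF cg(2)[OF j]] R_closed nabla_inverse_Dlog1 partial_t_Dlog1)
  qed
  have swap: "(\<Sum>j=1..CARD('n). x j *s (\<Sum>i=1..CARD('n). y j i *s pt i)) =
      (\<Sum>i=1..CARD('n). (\<Sum>j=1..CARD('n). y j i * x j) *s pt i)" for x y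
  proof -
    have "(\<Sum>j=1..CARD('n). x j *s (\<Sum>i=1..CARD('n). y j i *s pt i)) =
        (\<Sum>j=1..CARD('n). \<Sum>i=1..CARD('n). (y j i * x j) *s pt i)"
      by (simp only: vec.scale_sum_right vec.scale_scale mult.commute)
    also have "\<dots> = (\<Sum>i=1..CARD('n). (\<Sum>j=1..CARD('n). y j i * x j) *s pt i)"
      by (subst sum.swap) (simp only: vec.scale_sum_left)
    finally show ?thesis .
  qed
  have "(\<Sum>j=1..CARD('n). f j *s pt j) =
      (\<Sum>j=1..CARD('n). c j *s pt j) + (\<Sum>j=1..CARD('n). g j *s (t_last *s pt j))"
    unfolding sum.distrib[symmetric]
    by (rule sum.cong) (simp_all add: cg(3) vec.scale_left_distrib mult.commute)
  also have "(\<Sum>j=1..CARD('n). g j *s (t_last *s pt j)) =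
      \<rho> - (\<Sum>j=1..CARD('n). g j *s (\<Sum>i=1..CARD('n). M0 j i *s pt i))"
    unfolding \<rho>_def sum_subtractf[symmetric]
    by (rule sum.cong) (simp_all only: M_row_split vec.scale_right_distrib add_diff_cancel_left')
  also have "\<dots> = \<rho> + (\<Sum>i=1..CARD('n). r i *s pt i)"
    unfolding swap r_def by (simp add: sum_negf)
  finally have split: "(\<Sum>j=1..CARD('n). f j *s pt j) =
      (\<Sum>j=1..CARD('n). c j *s pt j) + (\<rho> + (\<Sum>i=1..CARD('n). r i *s pt i))" .
  have "(\<Sum>j=1..CARD('n). c j *s pt j) \<in> G 0"
    unfolding G_0 combinations_def using cg(1) by blast
  then have 1: "(\<Sum>j=1..CARD('n). c j *s pt j) \<in> FS {0..}"
    by (intro FS_single[of 0]) auto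
  have M0_sum: "(\<Sum>j=1..CARD('n). M0 j i * x j) \<in> Tpoly n"
    if "i \<in> {1..CARD('n)}" "\<And>j. j \<in> {1..CARD('n)} \<Longrightarrow> x j \<in> Tpoly n" for i x
    using that by (intro Tpoly_sum Tpoly_scale M0_T) auto
  have neg: "- x \<in> Tpoly n" if "x \<in> Tpoly n" for x
    using Tpoly_scale[OF T_closed(1)[of "-1"] that] by (simp add: cst_minus)
  have 2: "(\<Sum>i=1..CARD('n). r i *s pt i) \<in> FS {0..}"
    unfolding r_def by (intro Suc.IH neg M0_sum cg(2))
  define s where "s i = (\<Sum>j=1..CARD('n). M0 j i * D (g j)) + (t_last * D (g i) + cst (- b i) * g i)" for i
  have "nablaD \<rho> = (\<Sum>j=1..CARD('n). D (g j) *s (\<Sum>i=1..CARD('n). M j i *s pt i)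
      + g j *s (cst (- b j) *s pt j))"
    unfolding \<rho>_def nabla_sum
  proof (rule sum.cong[OF refl])
    fix j assume j: "j \<in> {1..CARD('n)}"
    have "nablaD (\<Sum>i=1..CARD('n). M j i *s pt i) = cst (- b j) *s pt j"
      unfolding M_row[OF j] by (simp add: nabla_scale nabla_inverse_Dlog1 partial_t_Dlog1)
    then show "nablaD (g j *s (\<Sum>i=1..CARD('n). M j i *s pt i)) =
        D (g j) *s (\<Sum>i=1..CARD('n). M j i *s pt i) + g j *s (cst (- b j) *s pt j)"
      by (simp only: nabla_scale)
  qed
  also have "\<dots> = (\<Sum>j=1..CARD('n). D (g j) *s (\<Sum>i=1..CARD('n). M0 j i *s pt i) +
      (t_last * D (g j) + cst (- b j) * g j) *s pt j)"
  proof (rule sum.cong[OF refl])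
    fix j assume j: "j \<in> {1..CARD('n)}"
    show "D (g j) *s (\<Sum>i=1..CARD('n). M j i *s pt i) + g j *s (cst (- b j) *s pt j) =
      D (g j) *s (\<Sum>i=1..CARD('n). M0 j i *s pt i) + (t_last * D (g j) + cst (- b j) * g j) *s pt j"
      unfolding M_row_split[OF j]
      by (simp only: vec.scale_right_distrib vec.scale_left_distrib vec.scale_scale mult.commute add.assoc)
  qed
  also have "\<dots> = (\<Sum>i=1..CARD('n). s i *s pt i)"
    unfolding s_def vec.scale_left_distrib[of "sum _ _"] sum.distrib swap ..
  finally have \<rho>s: "nablaD \<rho> = (\<Sum>i=1..CARD('n). s i *s pt i)" .
  have "(\<Sum>i=1..CARD('n). s i *s pt i) \<in> FS {0..}"
    unfolding s_def
    by (intro Suc.IH Tpoly_add M0_sum D_Tpoly_same t_last_D_Tpoly Tpoly_scale T_closed(1) cg(2))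
  then have "nablaD \<rho> \<in> nablaD ` FS {1..}"
    using nablaD_FS[of 0] \<rho>s by simp
  then obtain \<rho>' where \<rho>': "\<rho>' \<in> FS {1..}" "nablaD \<rho> = nablaD \<rho>'"
    by blast
  then have "\<rho> = \<rho>'"
    using nablaD_inj Dlog_imp_Dlog_inf[OF \<rho>_Dlog] FS_subset_Dlog_inf by (auto simp: inj_on_def)
  then have "\<rho> \<in> FS {0..}"
    using \<rho>'(1) FS_mono[of "{1..}" "{0..}"] by auto
  then show ?case
    unfolding split by (intro FS_add 1 2)
qed

lemma FS_0: "FS {0..} = Dlog 1"
proof
  show "FS {0..} \<subseteq> Dlog 1"
  proof
    fix \<theta> assume "\<theta> \<in> FS {0..}"
    then obtain K g where K: "finite K" "K \<subseteq> {0..}" "\<And>i. i \<in> K \<Longrightarrow> g i \<in> G i" "\<theta> = (\<Sum>i\<in>K. g i)"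
      using FS_E by metis
    have "g i \<in> Dlog 1" if "i \<in> K" for i
      using K(2) K(3)[OF that] that G_subset_Dlog[of i] Dlog_mono[of "1 - i" 1] by auto
    then show "\<theta> \<in> Dlog 1"
      unfolding K(4) by (rule Dlog_sum)
  qed
  show "Dlog 1 \<subseteq> FS {0..}"
  proof
    fix \<theta> assume "\<theta> \<in> Dlog 1"
    then obtain f where f: "\<forall>j\<in>{1..CARD('n)}. f j \<in> R" "\<theta> = (\<Sum>j=1..CARD('n). f j *s pt j)"
      unfolding Dlog1_eq_DerR DerR_def combinations_def by blast
    have "\<exists>n. f i \<in> Tpoly n" if "i \<in> {1..CARD('n)}" for i
      using f(1) that R_eq_Union_Tpoly by blast
    then obtain n where n: "\<And>i. i \<in> {1..CARD('n)} \<Longrightarrow> f i \<in> Tpoly (n i)"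
      by metis
    define m where "m = (\<Sum>i=1..CARD('n). n i)"
    have "f i \<in> Tpoly m" if i: "i \<in> {1..CARD('n)}" for i
    proof -
      have "n i \<le> m"
        unfolding m_def by (rule member_le_sum[OF i]) auto
      then show ?thesis
        using Tpoly_mono n[OF i] by blast
    qed
    then show "\<theta> \<in> FS {0..}"
      unfolding f(2) by (rule Tpoly_combination_in_FS)
  qed
qed

lemma FS_eq_Dlog: "FS {1 - k..} = Dlog k"
proof (induction k rule: int_induct[of _ 1])
  case base
  then show ?case using FS_0 by simp
next
  case (step1 k)
  have "FS {1 - (k + 1)..} = nablaD ` FS {1 - k..}"
    using nablaD_FS[of "- k"] by (simp add: add.commute)
  then show ?case
    using step1 nablaD_Dlog by simp
next
  case (step2 k)
  have "nablaD ` FS {1 - (k - 1)..} = nablaD ` Dlog (k - 1)"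
    using nablaD_FS[of "1 - k"] nablaD_Dlog[of "k - 1"] step2 by (simp add: algebra_simps)
  then show ?case
    using inj_on_image_eq_iff[OF nablaD_inj FS_subset_Dlog_inf, of "Dlog (k - 1)"] Dlog_imp_Dlog_inf by blast
qed

lemma FS_UNIV: "FS UNIV = Dlog_inf"
proof
  show "Dlog_inf \<subseteq> FS UNIV"
    unfolding Dlog_inf_eq_Union using FS_eq_Dlog FS_mono[of "{1 - k..}" UNIV for k] by blast
qed (rule FS_subset_Dlog_inf)

lemma direct_sum: "internal_direct_sum T J G (FS J)"
  unfolding internal_direct_sum_def using submodule_G G_direct by blast

lemma nablaD_iso_Dlog: "module_iso T nablaD (Dlog k) (Dlog (k + 1))"
  unfolding module_iso_def
proof (intro conjI ballI)
  show "bij_betw nablaD (Dlog k) (Dlog (k + 1))"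
    unfolding bij_betw_def using nablaD_Dlog inj_on_subset[OF nablaD_inj] Dlog_imp_Dlog_inf by blast
qed (simp_all add: submodule_T submodule_Dlog nabla_add nablaD_T_linear)

lemma nablaD_iso_Dlog_inf: "module_iso T nablaD Dlog_inf Dlog_inf"
  unfolding module_iso_def
proof (intro conjI ballI)
  have "nablaD ` Dlog_inf = (\<Union>k. Dlog (k + 1))"
    unfolding Dlog_inf_eq_Union image_UN nablaD_Dlog ..
  also have "\<dots> = Dlog_inf"
    unfolding Dlog_inf_eq_Union by (metis (no_types) surj_plus_right surj_def UN_extend_simps(10) diff_add_cancel)
  finally show "bij_betw nablaD Dlog_inf Dlog_inf"
    using nablaD_inj by (simp add: bij_betw_def)
qed (simp_all add: submodule_T submodule_Dlog_inf nabla_add nablaD_T_linear)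

end

theorem corollary4p3:
  fixes W :: "('n::{finite,linorder}) cmat set"
    and I :: "'n cvec \<Rightarrow> 'n cvec \<Rightarrow> complex"
    and \<alpha> :: "'n cvec set \<Rightarrow> 'n cvec"
    and d e :: "nat \<Rightarrow> nat"
    and t :: "nat \<Rightarrow> 'n ratfun"
    and \<eta> :: "nat \<Rightarrow> 'n derivation"
  assumes "irreducible_reflection_group W" and "well_generated W"
    and "invariant_inner W I" and "normal_forms W I \<alpha>"
    and "degrees W d" and "coexponents W e"
    and "flat_system W \<alpha> d e t \<eta>"
  shows "(\<forall>k. internal_direct_sum (T_ring t) {1 - k..} (G_piece W \<alpha> t) (H_filt W \<alpha> t k)) \<and>
    (\<forall>k. inv_ders W (logD W I \<alpha> (\<lambda>H. - k * int (stab_order W H) + 1)) = H_filt W \<alpha> t k) \<and>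
    internal_direct_sum (T_ring t) UNIV (G_piece W \<alpha> t) (inv_ders W (logD_inf W I \<alpha>)) \<and>
    (\<forall>k. module_iso (T_ring t) (nabla (primitive t)) (H_filt W \<alpha> t k) (H_filt W \<alpha> t (k + 1))) \<and>
    module_iso (T_ring t) (nabla (primitive t))
      (inv_ders W (logD_inf W I \<alpha>)) (inv_ders W (logD_inf W I \<alpha>))"
proof -
  interpret flat_setting W I \<alpha> d e t \<eta>
    using assms by unfold_locales
  have H: "H_filt W \<alpha> t k = Dlog k" for k
    unfolding H_filt_def by (rule FS_eq_Dlog)
  show ?thesis
    unfolding Dlog_def[symmetric] Dlog_inf_def[symmetric]
  proof (intro conjI allI)
    show "internal_direct_sum (T_ring t) {1 - k..} (G_piece W \<alpha> t) (H_filt W \<alpha> t k)" for k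
      unfolding H_filt_def by (rule direct_sum)
    show "Dlog k = H_filt W \<alpha> t k" for k
      by (rule H[symmetric])
    show "internal_direct_sum (T_ring t) UNIV (G_piece W \<alpha> t) Dlog_inf"
      using direct_sum[of UNIV] by (simp add: FS_UNIV)
    show "module_iso (T_ring t) (nabla (primitive t)) (H_filt W \<alpha> t k) (H_filt W \<alpha> t (k + 1))" for k
      unfolding H by (rule nablaD_iso_Dlog)
    show "module_iso (T_ring t) (nabla (primitive t)) Dlog_inf Dlog_inf"
      by (rule nablaD_iso_Dlog_inf)
  qed
qed

end
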